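(* There exist absolute constants $c, C>0$ such that for every integer $k\ge 2$ and every even integer $n\ge 100\log k$, $$c\,k^2(\log k)\,n\ \le\ \widehat R_k(C_n)\ \le\ C\,k^2(\log k)\,n .$$ That is, $\widehat R_k(C_n)=\Theta(k^2\log k)\,n$ with implied constants independent of both $k$ and $n$.
   Context: All graphs are finite and simple; $\log$ is the natural logarithm. $C_n$ denotes the cycle on $n$ vertices. For a graph $H$ and an integer $k$, the $k$-colour size--Ramsey number $\widehat R_k(H)$ is the minimum number of edges in a graph $G$ such that every $k$-edge-colouring of $G$ (i.e. every assignment of one of $k$ colours to each edge of $G$, with no further restriction) contains a monochromatic copy of $H$ as a (not necessarily induced) subgraph. *)

theory Defs
  imports Complex_Main
begin

type_synonym 'a ugraph = "'a set \<times> 'a set set"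

abbreviation uverts :: "'a ugraph \<Rightarrow> 'a set" where
  "uverts G \<equiv> fst G"

abbreviation uedges :: "'a ugraph \<Rightarrow> 'a set set" where
  "uedges G \<equiv> snd G"

definition finite_simple_graph :: "'a ugraph \<Rightarrow> bool" where
  "finite_simple_graph G \<longleftrightarrow>
     finite (uverts G) \<and> (\<forall>e\<in>uedges G. e \<subseteq> uverts G \<and> card e = 2)"

text \<open>A copy is a subgraph that need not be induced, hence only edges have to be preserved.\<close>

definition contains_copy :: "'a ugraph \<Rightarrow> 'b ugraph \<Rightarrow> bool" where
  "contains_copy G H \<longleftrightarrow>
     (\<exists>f. inj_on f (uverts H) \<and> f ` uverts H \<subseteq> uverts G \<and> (\<forall>e\<in>uedges H. f ` e \<in> uedges G))"

definition edge_colouring :: "nat \<Rightarrow> 'a ugraph \<Rightarrow> ('a set \<Rightarrow> nat) \<Rightarrow> bool" where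
  "edge_colouring k G \<chi> \<longleftrightarrow> (\<forall>e\<in>uedges G. \<chi> e < k)"

definition colour_class :: "'a ugraph \<Rightarrow> ('a set \<Rightarrow> nat) \<Rightarrow> nat \<Rightarrow> 'a ugraph" where
  "colour_class G \<chi> i = (uverts G, {e \<in> uedges G. \<chi> e = i})"

definition ramsey_for :: "nat \<Rightarrow> 'a ugraph \<Rightarrow> 'b ugraph \<Rightarrow> bool" where
  "ramsey_for k G H \<longleftrightarrow>
     (\<forall>\<chi>. edge_colouring k G \<chi> \<longrightarrow> (\<exists>i<k. contains_copy (colour_class G \<chi> i) H))"

text \<open>
  Every finite graph is isomorphic to one with vertices in \<^typ>\<open>nat\<close>, so restricting the host
  graphs to this vertex type loses nothing.  For a finite simple graph \<open>H\<close> and \<open>k \<ge> 1\<close>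
  the minimum is over a nonempty set, by Ramsey's theorem.
\<close>

definition size_ramsey :: "nat \<Rightarrow> 'b ugraph \<Rightarrow> nat" where
  "size_ramsey k H =
     (LEAST m. \<exists>G :: nat ugraph. finite_simple_graph G \<and> ramsey_for k G H \<and> card (uedges G) = m)"

text \<open>This is the cycle on \<open>n\<close> vertices when \<open>n \<ge> 3\<close>.\<close>

definition cycle_graph :: "nat \<Rightarrow> nat ugraph" where
  "cycle_graph n = ({..<n}, {{i, (i + 1) mod n} | i. i < n})"

end

theory Submission
  imports Defs "HOL-Library.FuncSet" "HOL-Library.Disjoint_Sets" "HOL-Analysis.Convex" "HOL-Real_Asymp.Real_Asymp"
begin

text \<open>
  Upper bound. The host is a bipartite graph on \<open>O(kn)\<close> vertices with \<open>\<Theta>(k\<^sup>2 n log k)\<close> edges in which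
  every set of at most \<open>2n\<close> vertices spans few edges; it exists by a first moment count. The
  densest colour has a subgraph of large minimum degree. A breadth-first search in it must stop
  doubling after fewer than \<open>n / 2\<close> levels, so two consecutive levels span a dense graph. Local
  sparseness gives long paths in that graph from any starting vertex, and a path of the appropriate
  length closes up through the search tree to a cycle of length exactly \<open>n\<close>.

  Lower bound. Every graph with \<open>m \<ge> n \<surd>k\<close> edges contains a subgraph without \<open>C\<^sub>n\<close> that has
  \<open>\<Omega>(\<surd>(m n log k))\<close> edges. Removing such subgraphs one by one, \<open>\<surd>m\<close> drops by a fixed
  multiple of \<open>\<surd>(n log k)\<close> in each step, so \<open>k / 2\<close> colours reduce \<open>c k\<^sup>2 n log k\<close> edges to fewer
  than \<open>n \<surd>k\<close>, which are coloured in pieces of \<open>n - 1\<close> edges. For the subgraph, label the vertices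
  of one side of a bipartite graph so that each label occurs fewer than \<open>n / 2\<close> times, and let every
  vertex of the other side keep only its edges to one label: a cycle then sees a single label and
  is too short. For a random labelling a typical vertex has some label that is much more
  frequent among its neighbours than average, and this gains the factor \<open>log k\<close>.
\<close>

section \<open>Edge counts and dense cores\<close>

section \<open>Graphs as edge sets\<close>

text \<open>The logarithm enters the two bounds from different sides. In the host, choosing a set of
  \<open>s\<close> vertices, with \<open>s\<close> of order \<open>n\<close>, among
  \<open>O(k n)\<close> vertices costs a factor \<open>k^O(s)\<close> in the union bound, so the
  local density that random edges can guarantee is of order \<open>log k\<close>. Every colour class
  must beat this density, so the average degree of the host is of order \<open>k * log k\<close>. In
  the lower bound the number of labels is polynomial in \<open>k\<close>. An event whose probability
  for a fixed label is as small as \<open>k^(-1/5)\<close> is then still expected for some label,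
  and this large deviation is what lifts the best label of a vertex above the average one.

  The hypothesis \<open>n >= 100 log k\<close> serves three purposes: the search tree has depth
  below \<open>n / 2\<close>, the \<open>\<Theta>(k^2 n log k)\<close> edges fit between the two
  sides of the host, and a label class of fewer than \<open>n / 2\<close> vertices has room for the
  \<open>O(log k)\<close> neighbours that a vertex keeps.\<close>

definition has_cycle :: "'a set set \<Rightarrow> nat \<Rightarrow> bool" where
  "has_cycle E n \<longleftrightarrow> (\<exists>c. inj_on c {..<n} \<and> (\<forall>i<n. {c i, c (Suc i mod n)} \<in> E))"

definition simple_edges :: "'a set set \<Rightarrow> bool" where
  "simple_edges E \<longleftrightarrow> finite E \<and> (\<forall>e\<in>E. card e = 2)"

definition induced :: "'a set set \<Rightarrow> 'a set \<Rightarrow> 'a set set" where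
  "induced E W = {e \<in> E. e \<subseteq> W}"

text \<open>\<open>v\<close> need not belong to \<open>W\<close>: below, \<open>W\<close> is often
  one side of a bipartition and \<open>v\<close> lies on the other.\<close>

definition nbrs :: "'a set set \<Rightarrow> 'a set \<Rightarrow> 'a \<Rightarrow> 'a set" where
  "nbrs E W v = {u \<in> W. {u, v} \<in> E}"

text \<open>Every vertex of a cycle lies on an edge, so host graphs and colour classes can be
  handled as bare edge sets from here on.\<close>

lemma contains_copy_cycle_graph_iff:
  assumes "\<forall>e\<in>E. e \<subseteq> V" "n > 0"
  shows "contains_copy (V, E) (cycle_graph n) \<longleftrightarrow> has_cycle E n"
proof
  assume "contains_copy (V, E) (cycle_graph n)"
  then obtain f where f: "inj_on f {..<n}" and e: "\<forall>e\<in>{{i, (i + 1) mod n} | i. i < n}. f ` e \<in> E"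
    unfolding contains_copy_def cycle_graph_def by auto
  have "{f i, f (Suc i mod n)} \<in> E" if "i < n" for i
  proof -
    have "f ` {i, (i + 1) mod n} \<in> E" using e that by blast
    then show ?thesis by simp
  qed
  then show "has_cycle E n" using f unfolding has_cycle_def by blast
next
  assume "has_cycle E n"
  then obtain c where c: "inj_on c {..<n}" "\<forall>i<n. {c i, c (Suc i mod n)} \<in> E"
    unfolding has_cycle_def by blast
  have "c i \<in> V" if "i < n" for i using c(2) that assms(1) by blast
  then show "contains_copy (V, E) (cycle_graph n)"
    unfolding contains_copy_def cycle_graph_def
    by (intro exI[of _ c]) (use c in auto)
qed

lemma simple_edges_subset: "simple_edges E \<Longrightarrow> F \<subseteq> E \<Longrightarrow> simple_edges F"
  unfolding simple_edges_def by (auto intro: finite_subset)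

lemma finite_nbrs: "finite W \<Longrightarrow> finite (nbrs E W v)"
  unfolding nbrs_def by auto

lemma card_nbrs:
  assumes "simple_edges E" "v \<in> W"
  shows "card (nbrs E W v) = card {e \<in> induced E W. v \<in> e}"
proof (rule bij_betw_same_card[of "\<lambda>u. {u, v}"], unfold bij_betw_def, intro conjI)
  show "inj_on (\<lambda>u. {u, v}) (nbrs E W v)"
    by (auto simp: inj_on_def doubleton_eq_iff)
  show "(\<lambda>u. {u, v}) ` nbrs E W v = {e \<in> induced E W. v \<in> e}"
  proof (intro equalityI subsetI)
    fix e assume e: "e \<in> {e \<in> induced E W. v \<in> e}"
    then have "card e = 2" using assms unfolding simple_edges_def induced_def by auto
    then obtain x y where "e = {x, y}" "x \<noteq> y" by (auto simp: card_2_iff)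
    then show "e \<in> (\<lambda>u. {u, v}) ` nbrs E W v"
      using e unfolding induced_def nbrs_def by (auto simp: insert_commute)
  qed (use assms in \<open>auto simp: induced_def nbrs_def\<close>)
qed

lemma card_induced_remove:
  assumes "simple_edges E" "v \<in> W"
  shows "card (induced E W) = card (induced E (W - {v})) + card (nbrs E W v)"
proof -
  have fin: "finite (induced E W)" using assms unfolding simple_edges_def induced_def by auto
  have "induced E W = induced E (W - {v}) \<union> {e \<in> induced E W. v \<in> e}"
    unfolding induced_def by auto
  moreover have "induced E (W - {v}) \<inter> {e \<in> induced E W. v \<in> e} = {}"
    unfolding induced_def by auto
  moreover have "induced E (W - {v}) \<subseteq> induced E W" unfolding induced_def by auto
  ultimately show ?thesis
    using fin card_nbrs[OF assms] by (metis (no_types, lifting) card_Un_disjoint finite_Un)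
qed

text \<open>Handshake with degree information on \<open>R\<close> only: a search knows the degrees
  of its explored vertices, while their edges may end in the boundary \<open>S - R\<close>.\<close>

lemma degree_sum_le:
  fixes r :: real
  assumes "simple_edges E" "finite S" "R \<subseteq> S" "\<And>v. v \<in> R \<Longrightarrow> r \<le> card (nbrs E S v)"
  shows "r * card R \<le> 2 * card (induced E S)"
proof -
  have finR: "finite R" and finI: "finite (induced E S)"
    using assms finite_subset unfolding simple_edges_def induced_def by auto
  have "r * card R = (\<Sum>v\<in>R. r)" by simp
  also have "\<dots> \<le> (\<Sum>v\<in>R. real (card {e \<in> induced E S. v \<in> e}))"
  proof (rule sum_mono)
    fix v assume "v \<in> R"
    then show "r \<le> real (card {e \<in> induced E S. v \<in> e})"
      using assms card_nbrs[of E v S] by (metis subsetD)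
  qed
  also have "\<dots> = real (\<Sum>v\<in>R. \<Sum>e\<in>induced E S. if v \<in> e then 1 else 0)"
    by (simp add: sum.If_cases finI Int_def)
  also have "\<dots> = real (\<Sum>e\<in>induced E S. \<Sum>v\<in>R. if v \<in> e then 1 else 0)"
    by (subst sum.swap) simp
  also have "\<dots> \<le> real (\<Sum>e\<in>induced E S. 2)"
  proof (intro of_nat_mono sum_mono)
    fix e assume "e \<in> induced E S"
    then have ce: "card e = 2" using assms unfolding simple_edges_def induced_def by auto
    then have "finite e" by (metis card.infinite zero_neq_numeral)
    then have "card (R \<inter> e) \<le> 2" using ce by (metis card_mono Int_lower2)
    then show "(\<Sum>v\<in>R. if v \<in> e then 1 else 0) \<le> (2::nat)"
      by (simp add: sum.If_cases finR Int_def)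
  qed
  finally show ?thesis by simp
qed

text \<open>Maximise \<open>e(W) - \<phi>(|W|)\<close>: deleting a vertex of too small degree would increase the value.\<close>

lemma exists_weighted_core:
  fixes \<phi> :: "nat \<Rightarrow> real"
  assumes "simple_edges E" "finite V"
  obtains W where "W \<subseteq> V"
    "card (induced E V) - \<phi> (card V) \<le> card (induced E W) - \<phi> (card W)"
    "\<And>v. v \<in> W \<Longrightarrow> \<phi> (card W) - \<phi> (card W - 1) \<le> card (nbrs E W v)"
proof -
  define F where "F W = card (induced E W) - \<phi> (card W)" for W
  have "finite (F ` Pow V)" "F ` Pow V \<noteq> {}" using assms by auto
  then obtain W where W: "W \<subseteq> V" "F W = Max (F ` Pow V)"
    by (metis (no_types, lifting) Max_in PowD imageE)
  have max: "F U \<le> F W" if "U \<subseteq> V" for U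
    using that W(2) \<open>finite (F ` Pow V)\<close> by auto
  have "\<phi> (card W) - \<phi> (card W - 1) \<le> card (nbrs E W v)" if v: "v \<in> W" for v
  proof -
    have "card (W - {v}) = card W - 1" using v by simp
    moreover have "F (W - {v}) \<le> F W" using W by (intro max) auto
    ultimately show ?thesis
      using card_induced_remove[OF assms(1) v] unfolding F_def by simp
  qed
  then show ?thesis using that[OF W(1)] max[of V] unfolding F_def by auto
qed

text \<open>For a linear weight the increment is the constant \<open>d\<close>. The strict
  inequality makes the value of \<open>V\<close> positive, which the empty set cannot reach.\<close>

lemma exists_min_degree_core:
  fixes d :: real
  assumes "simple_edges E" "finite V" "d * card V < card (induced E V)"
  obtains W where "W \<subseteq> V" "W \<noteq> {}" "\<And>v. v \<in> W \<Longrightarrow> d \<le> card (nbrs E W v)"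
proof -
  obtain W where W: "W \<subseteq> V"
    "card (induced E V) - d * card V \<le> card (induced E W) - d * card W"
    "\<And>v. v \<in> W \<Longrightarrow> d * card W - d * (card W - 1) \<le> card (nbrs E W v)"
    using exists_weighted_core[OF assms(1,2), of "\<lambda>N. d * N"] by auto
  have "W \<noteq> {}"
  proof
    assume "W = {}"
    moreover have "induced E {} = {}" using assms(1) unfolding simple_edges_def induced_def by auto
    ultimately show False using W(2) assms(3) by simp
  qed
  moreover have "d \<le> card (nbrs E W v)" if "v \<in> W" for v
  proof -
    have "card W \<ge> 1" using that W(1) assms(2)
      by (metis One_nat_def Suc_leI card_gt_0_iff empty_iff finite_subset)
    then show ?thesis using W(3)[OF that] by (simp add: algebra_simps of_nat_diff)
  qed
  ultimately show ?thesis using that W(1) by blast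
qed

section \<open>Upper bound: cycles of a prescribed even length under local sparseness\<close>

section \<open>Cycles in locally sparse bipartite graphs\<close>

text \<open>Depth-first search from \<open>q\<close>: the explored vertices \<open>R\<close> have all their neighbours in
  \<open>R\<close> or on the current path, so as long as the path stays short, \<open>R\<close> cannot grow to size \<open>n\<close>
  without creating a dense set.\<close>

lemma exists_long_path:
  fixes \<eta> :: real
  assumes E: "simple_edges E" and K: "finite K" "q \<in> K" and \<eta>: "\<eta> > 0" and n: "n \<ge> 1"
    and deg: "\<And>v. v \<in> K \<Longrightarrow> 4 * \<eta> \<le> card (nbrs E K v)"
    and sparse: "\<And>S. S \<subseteq> K \<Longrightarrow> S \<noteq> {} \<Longrightarrow> card S \<le> 2 * n \<Longrightarrow> card (induced E S) < \<eta> * card S"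
  shows "\<exists>xs. length xs = n \<and> distinct xs \<and> hd xs = q \<and> set xs \<subseteq> K \<and>
           successively (\<lambda>u v. {u, v} \<in> E) xs"
proof (rule ccontr)
  assume no: "\<not> ?thesis"
  \<comment> \<open>Paths are stored with the active end at the head and \<open>q\<close> last, so
    extending and backtracking both act on the head.\<close>
  define path where "path xs \<longleftrightarrow> xs \<noteq> [] \<and> distinct xs \<and> last xs = q \<and> set xs \<subseteq> K \<and>
    successively (\<lambda>u v. {u, v} \<in> E) xs" for xs
  have path_short: "length xs < n" if "path xs" for xs
  proof (rule ccontr)
    assume "\<not> length xs < n"
    then have len: "length xs \<ge> n" by simp
    define ys where "ys = take n (rev xs)"
    have "successively (\<lambda>u v. {u, v} \<in> E) (rev xs)"
      using that unfolding path_def by (simp add: successively_rev insert_commute)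
    moreover have "rev xs = ys @ drop n (rev xs)" unfolding ys_def by simp
    ultimately have "successively (\<lambda>u v. {u, v} \<in> E) ys"
      by (metis successively_append_iff)
    moreover have "hd ys = q"
    proof -
      have "hd (rev xs) = q" using that unfolding path_def by (simp add: hd_rev)
      then show ?thesis unfolding ys_def using n by (simp add: hd_take)
    qed
    moreover have "set ys \<subseteq> set xs" unfolding ys_def by (metis set_rev set_take_subset)
    moreover have "length ys = n" "distinct ys"
      using that len unfolding path_def ys_def by auto
    moreover have "set xs \<subseteq> K" using that unfolding path_def by simp
    ultimately have "length ys = n \<and> distinct ys \<and> hd ys = q \<and> set ys \<subseteq> K \<and>
        successively (\<lambda>u v. {u, v} \<in> E) ys" by (simp add: subset_trans[of "set ys" "set xs" K])
    then show False using no by blast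
  qed
  \<comment> \<open>This contradicts \<open>sparse\<close> as soon as
    \<open>card S <= 2 * card R\<close>.\<close>
  have dense: "2 * \<eta> * card R \<le> card (induced E S)"
    if "R \<subseteq> S" "S \<subseteq> K" "\<And>v. v \<in> R \<Longrightarrow> nbrs E K v \<subseteq> S" for R S
  proof -
    have finS: "finite S" using that(2) K finite_subset by auto
    have "4 * \<eta> \<le> card (nbrs E S v)" if v: "v \<in> R" for v
    proof -
      have "nbrs E K v \<subseteq> nbrs E S v" using \<open>v \<in> R \<Longrightarrow> nbrs E K v \<subseteq> S\<close>[OF v]
        unfolding nbrs_def by auto
      then have "card (nbrs E K v) \<le> card (nbrs E S v)"
        using finite_nbrs[OF finS] card_mono by blast
      then show ?thesis using deg[of v] v that \<open>R \<subseteq> S\<close> \<open>S \<subseteq> K\<close> by force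
    qed
    from degree_sum_le[OF E finS that(1) this] show ?thesis by simp
  qed
  define ok where "ok r R xs \<longleftrightarrow> path xs \<and> R \<subseteq> K \<and> card R = r \<and> R \<inter> set xs = {} \<and>
    (\<forall>v\<in>R. nbrs E K v \<subseteq> R \<union> set xs)" for r R xs
  have "\<exists>R xs. ok r R xs" if "r \<le> n" for r
    using that
  proof (induction r)
    case 0
    have "ok 0 {} [q]" unfolding ok_def path_def using K by auto
    then show ?case by blast
  next
    case (Suc r)
    then obtain R xs0 where ok0: "ok r R xs0" by auto
    \<comment> \<open>Among all states with \<open>r\<close> explored vertices take one with a
      longest path: its head has no neighbour left to visit, so it can be moved to
      \<open>R\<close>.\<close>
    define Q where "Q l \<longleftrightarrow> (\<exists>xs. ok r R xs \<and> length xs = l)" for l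
    have "Q (length xs0)" unfolding Q_def using ok0 by blast
    moreover have "l \<le> n" if "Q l" for l
      using that path_short unfolding Q_def ok_def by (meson less_imp_le)
    ultimately obtain l where "Q l" and l_max: "\<And>l'. Q l' \<Longrightarrow> l' \<le> l"
      by (metis GreatestI_ex_nat Greatest_le_nat)
    then obtain xs where xs: "ok r R xs" "length xs = l" unfolding Q_def by blast
    obtain v ys where vy: "xs = v # ys" using xs unfolding ok_def path_def by (cases xs) auto
    have RK: "R \<subseteq> K" and cR: "card R = r" and disj: "R \<inter> set xs = {}"
      and cl: "\<And>w. w \<in> R \<Longrightarrow> nbrs E K w \<subseteq> R \<union> set xs" and pxs: "path xs"
      using xs(1) unfolding ok_def by auto
    have finR: "finite R" using RK K finite_subset by auto
    have vK: "v \<in> K" and vR: "v \<notin> R" using pxs disj vy unfolding path_def by auto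
    have nv: "nbrs E K v \<subseteq> R \<union> set xs"
    proof
      fix u assume u: "u \<in> nbrs E K v"
      show "u \<in> R \<union> set xs"
      proof (rule ccontr)
        assume un: "u \<notin> R \<union> set xs"
        have "path (u # xs)"
          using pxs u un vy unfolding path_def nbrs_def by auto
        then have "ok r R (u # xs)" using xs(1) un unfolding ok_def by auto
        then have "Q (Suc l)" unfolding Q_def using xs(2) by (intro exI[of _ "u # xs"]) simp
        then show False using l_max by fastforce
      qed
    qed
    \<comment> \<open>If the search had to retire its root \<open>q\<close>, then
      \<open>R \<union> {v}\<close> would contain all its neighbours in \<open>K\<close>, which
      \<open>dense\<close> and \<open>sparse\<close> exclude.\<close>
    have "ys \<noteq> []"
    proof
      assume "ys = []"
      then have sx: "set xs = {v}" using vy by simp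
      have "card (R \<union> {v}) \<le> 2 * n" using finR vR cR Suc.prems by simp
      moreover have "R \<union> {v} \<subseteq> K" using RK vK by simp
      ultimately have "card (induced E (R \<union> {v})) < \<eta> * card (R \<union> {v})"
        using sparse by blast
      moreover have "2 * \<eta> * card (R \<union> {v}) \<le> card (induced E (R \<union> {v}))"
        using dense[of "R \<union> {v}" "R \<union> {v}"] \<open>R \<union> {v} \<subseteq> K\<close> cl nv sx by auto
      moreover have "\<eta> * card (R \<union> {v}) \<ge> 0" using \<eta> by simp
      ultimately show False by linarith
    qed
    then have "path ys" using pxs vy unfolding path_def
      by (auto simp: successively_Cons)
    moreover have "card (insert v R) = Suc r" using finR vR cR by simp
    moreover have "insert v R \<inter> set ys = {}" using disj vy pxs unfolding path_def by auto
    moreover have "insert v R \<union> set ys = R \<union> set xs" using vy by auto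
    ultimately have "ok (Suc r) (insert v R) ys"
      unfolding ok_def using RK vK cl nv by auto
    then show ?case by blast
  qed
  then obtain R xs where ok: "ok n R xs" by blast
  let ?S = "R \<union> set xs"
  have cR: "card R = n" and cl: "\<And>w. w \<in> R \<Longrightarrow> nbrs E K w \<subseteq> ?S" and SK: "?S \<subseteq> K"
    using ok unfolding ok_def path_def by auto
  have "card ?S \<le> card R + card (set xs)" by (rule card_Un_le)
  also have "\<dots> \<le> n + length xs" using cR card_length[of xs] by simp
  finally have cS: "card ?S \<le> 2 * n" using path_short[of xs] ok unfolding ok_def by simp
  have "?S \<noteq> {}" using ok unfolding ok_def path_def by auto
  then have "card (induced E ?S) < \<eta> * card ?S" using sparse SK cS by blast
  \<comment> \<open>\<open>n\<close> explored vertices and fewer than \<open>n\<close> on the path: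
    \<open>2 * \<eta> * n\<close> edges at least, but fewer than
    \<open>\<eta> * card S <= 2 * \<eta> * n\<close>.\<close>
  moreover have "2 * \<eta> * n \<le> card (induced E ?S)" using dense[of R ?S] SK cl cR by auto
  moreover have "\<eta> * card ?S \<le> \<eta> * real (2 * n)" using cS \<eta> by (intro mult_left_mono) auto
  ultimately show False by simp
qed

lemma successively_nthD:
  "successively P xs \<Longrightarrow> Suc i < length xs \<Longrightarrow> P (xs ! i) (xs ! Suc i)"
proof (induction xs arbitrary: i)
  case (Cons x xs)
  then show ?case by (cases i) (auto simp: successively_Cons hd_conv_nth)
qed simp

lemma successively_if_nth:
  "(\<And>i. Suc i < length xs \<Longrightarrow> P (xs ! i) (xs ! Suc i)) \<Longrightarrow> successively P xs"
proof (induction xs)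
  case (Cons x xs)
  have "successively P xs" using Cons.prems[of "Suc _"] by (intro Cons.IH) auto
  moreover have "P x (hd xs)" if "xs \<noteq> []" using Cons.prems[of 0] that by (simp add: hd_conv_nth)
  ultimately show ?case by (auto simp: successively_Cons)
qed simp

lemma has_cycle_listI:
  assumes "distinct xs" "length xs = n" "n > 0" "successively (\<lambda>u v. {u, v} \<in> E) xs"
    "{last xs, hd xs} \<in> E"
  shows "has_cycle E n"
  unfolding has_cycle_def
proof (intro exI[of _ "\<lambda>i. xs ! i"] conjI allI impI)
  show "inj_on ((!) xs) {..<n}" using assms by (simp add: inj_on_nth)
  fix i assume i: "i < n"
  show "{xs ! i, xs ! (Suc i mod n)} \<in> E"
  proof (cases "Suc i = n")
    case True
    have "xs \<noteq> []" using assms by auto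
    then have "last xs = xs ! i" "hd xs = xs ! 0" using True assms
      by (auto simp: last_conv_nth hd_conv_nth)
    then show ?thesis using assms True by simp
  next
    case False
    then have "Suc i < length xs" using i assms by simp
    then show ?thesis using successively_nthD[OF assms(4)] i assms(2) by simp
  qed
qed


text \<open>The last levels of the search ball are not doubling, so they carry a dense bipartite graph
  between two consecutive levels \<open>l\<close>, \<open>l + 1\<close>. A path of the right length in it is closed up
  through the search tree: by the choice of \<open>h\<close>, the tree distance between its end \<open>v\<close> and one of
  the two vertices \<open>a\<close>, \<open>b\<close> is exactly \<open>2h\<close>.\<close>

lemma sparse_bipartite_has_cycle:
  fixes \<eta> :: real and V P :: "'a set"
  assumes E: "simple_edges E" and V: "finite V" "\<And>e. e \<in> E \<Longrightarrow> e \<subseteq> V"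
    and bip: "\<And>u v. {u, v} \<in> E \<Longrightarrow> u \<in> P \<longleftrightarrow> v \<notin> P"
    and n: "even n" "n \<ge> 2" and \<eta>: "\<eta> \<ge> 1 / 2"
    and small: "card V < 2 ^ (n div 2)"
    and sparse: "\<And>S. S \<subseteq> V \<Longrightarrow> S \<noteq> {} \<Longrightarrow> card S \<le> 2 * n \<Longrightarrow> card (induced E S) < \<eta> * card S"
    and dense: "72 * \<eta> * card V < card E"
  shows "has_cycle E n"
proof -
  have "induced E V = E" using V unfolding induced_def by auto
  then obtain W where WV: "W \<subseteq> V" and "W \<noteq> {}"
    and degW: "\<And>v. v \<in> W \<Longrightarrow> 72 * \<eta> \<le> card (nbrs E W v)"
    using exists_min_degree_core[OF E V(1), of "72 * \<eta>"] dense by auto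
  then obtain r where rW: "r \<in> W" by auto
  have finW: "finite W" using WV V(1) by (rule finite_subset)
  define B where "B = rec_nat {r} (\<lambda>_ S. S \<union> {u \<in> W. \<exists>v\<in>S. {u, v} \<in> E})"
  have B0: "B 0 = {r}" and BS: "B (Suc i) = B i \<union> {u \<in> W. \<exists>v\<in>B i. {u, v} \<in> E}" for i
    unfolding B_def by auto
  have Bmono: "B i \<subseteq> B j" if "i \<le> j" for i j using that
    by (rule lift_Suc_mono_le[rotated]) (auto simp: BS)
  have BW: "B i \<subseteq> W" for i by (induction i) (auto simp: B0 BS rW)
  have finB: "finite (B i)" for i by (rule finite_subset[OF BW finW])
  define lev where "lev u = (LEAST i. u \<in> B i)" for u
  define C where "C = (\<Union>i. B i)"
  have levI: "u \<in> B (lev u)" if "u \<in> C" for u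
    using that unfolding lev_def C_def by (auto intro: LeastI)
  have lev_le: "lev u \<le> i" if "u \<in> B i" for u i
    using that unfolding lev_def by (rule Least_le)
  have B_iff: "u \<in> B i \<longleftrightarrow> u \<in> C \<and> lev u \<le> i" for u i
    using levI lev_le Bmono unfolding C_def by blast
  have CW: "C \<subseteq> W" using BW unfolding C_def by auto
  have closed: "u \<in> C" "lev u \<le> Suc (lev v)" if "v \<in> C" "u \<in> W" "{u, v} \<in> E" for u v
  proof -
    have "u \<in> B (Suc (lev v))" using that levI[OF that(1)] by (auto simp: BS)
    then show "u \<in> C" "lev u \<le> Suc (lev v)" using B_iff by auto
  qed
  have parent: "\<exists>v\<in>C. lev u = Suc (lev v) \<and> {u, v} \<in> E" if u: "u \<in> C" "lev u \<noteq> 0" for u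
  proof -
    obtain i where i: "lev u = Suc i" using u(2) by (cases "lev u") auto
    then have "u \<in> B (Suc i)" "u \<notin> B i" using levI[OF u(1)] lev_le[of u i] by auto
    then obtain v where v: "v \<in> B i" "{u, v} \<in> E" "u \<in> W" by (auto simp: BS)
    then have "v \<in> C" "lev v \<le> i" using B_iff by auto
    moreover have "lev u \<le> Suc (lev v)" using closed[of v u] v \<open>v \<in> C\<close> by auto
    ultimately show ?thesis using v i by (intro bexI[of _ v]) auto
  qed
  define par where "par u = (SOME v. v \<in> C \<and> lev u = Suc (lev v) \<and> {u, v} \<in> E)" for u
  have par: "par u \<in> C" "lev u = Suc (lev (par u))" "{u, par u} \<in> E" if "u \<in> C" "lev u \<noteq> 0" for u
  proof -
    have "par u \<in> C \<and> lev u = Suc (lev (par u)) \<and> {u, par u} \<in> E"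
      unfolding par_def by (rule someI_ex) (use parent[OF that] in blast)
    then show "par u \<in> C" "lev u = Suc (lev (par u))" "{u, par u} \<in> E" by auto
  qed
  have root: "u = r" if "u \<in> C" "lev u = 0" for u using levI[OF that(1)] that(2) B0 by simp
  \<comment> \<open>The levels alternate between the two sides, which excludes edges inside a
    level.\<close>
  have parity: "(u \<in> P \<longleftrightarrow> r \<in> P) \<longleftrightarrow> even (lev u)" if "u \<in> C" for u
    using that
  proof (induction "lev u" arbitrary: u)
    case 0
    then show ?case using root[of u] by auto
  next
    case (Suc i)
    then have p: "par u \<in> C" "lev u = Suc (lev (par u))" "{u, par u} \<in> E" using par[of u] by auto
    then have "lev (par u) = i" using Suc by simp
    then show ?case using Suc.hyps(1)[of "par u"] p bip[OF p(3)] by auto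
  qed
  have step: "lev u = Suc (lev v) \<or> lev v = Suc (lev u)" if "u \<in> C" "v \<in> C" "{u, v} \<in> E" for u v
  proof -
    have "lev u \<le> Suc (lev v)" "lev v \<le> Suc (lev u)"
      using closed(2)[of v u] closed(2)[of u v] that CW by (auto simp: insert_commute)
    moreover have "even (lev u) \<noteq> even (lev v)" using parity[OF that(1)] parity[OF that(2)] bip[OF that(3)] by auto
    ultimately show ?thesis by (metis le_antisym le_SucE)
  qed

  have "\<exists>i<n div 2. card (B (Suc i)) \<le> 2 * card (B i)"
  proof (rule ccontr)
    assume no: "\<not> ?thesis"
    then have "\<not> card (B (Suc i)) \<le> 2 * card (B i)" if "i < n div 2" for i
      using that no by blast
    then have grow: "2 * card (B i) < card (B (Suc i))" if "i < n div 2" for i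
      using that not_le by blast
    have "j \<le> n div 2 \<Longrightarrow> 2 ^ j \<le> card (B j)" for j
    proof (induction j)
      case (Suc j)
      then show ?case using grow[of j] by simp
    qed (simp add: B0)
    then have "2 ^ (n div 2) \<le> card (B (n div 2))" by simp
    also have "\<dots> \<le> card V" using BW WV V(1) by (meson card_mono subset_trans)
    finally show False using small by simp
  qed
  then obtain i where i: "i < n div 2" "card (B (Suc i)) \<le> 2 * card (B i)" by blast

  define L where "L l = {u \<in> C. lev u = l}" for l
  define F where "F l = {e \<in> E. \<exists>u v. e = {u, v} \<and> u \<in> L l \<and> v \<in> L (Suc l)}" for l
  have FE: "F l \<subseteq> E" for l unfolding F_def by auto
  have F_I: "e \<in> F l" if "e \<in> E" "e = {u, v}" "u \<in> L l" "v \<in> L (Suc l)" for e u v l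
    unfolding F_def using that by blast
  have finC: "finite C" using CW finW finite_subset by auto
  have finL: "finite (L l)" for l unfolding L_def using finC by auto
  have finF: "finite (F l)" for l using FE E finite_subset unfolding simple_edges_def by blast
  have sumL: "(\<Sum>l\<in>A. card (L l)) \<le> card (B (Suc i))" if "A \<subseteq> {..Suc i}" for A
  proof -
    have finA: "finite A" using that finite_subset by auto
    have "(\<Sum>l\<in>A. card (L l)) = card (\<Union>l\<in>A. L l)"
      by (rule card_UN_disjoint[symmetric]) (use finA finL in \<open>auto simp: L_def\<close>)
    also have "\<dots> \<le> card (B (Suc i))"
      by (rule card_mono[OF finB]) (use that B_iff in \<open>auto simp: L_def\<close>)
    finally show ?thesis .
  qed
  \<comment> \<open>Otherwise \<open>72 * \<eta> * card (B i)\<close> would be at most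
    \<open>64 * \<eta> * card (B i)\<close>, where \<open>64 = 2 * 8 * 2 * 2\<close>: handshake,
    density \<open>8 * \<eta>\<close>, each level in two pairs, and the failure to double.\<close>
  have "\<exists>l\<le>i. 8 * \<eta> * (card (L l) + card (L (Suc l))) < card (F l)"
  proof (rule ccontr)
    assume no: "\<not> ?thesis"
    then have sp: "real (card (F l)) \<le> 8 * \<eta> * (card (L l) + card (L (Suc l)))" if "l \<le> i" for l
      using that not_le by blast
    have "72 * \<eta> * card (B i) \<le> 2 * card (induced E (B (Suc i)))"
    proof (rule degree_sum_le[OF E finB])
      show "B i \<subseteq> B (Suc i)" by (simp add: Bmono)
      fix v assume v: "v \<in> B i"
      have "nbrs E W v \<subseteq> nbrs E (B (Suc i)) v" using v unfolding nbrs_def by (auto simp: BS)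
      then have "card (nbrs E W v) \<le> card (nbrs E (B (Suc i)) v)"
        using finite_nbrs[OF finB] card_mono by blast
      then show "72 * \<eta> \<le> card (nbrs E (B (Suc i)) v)" using degW[of v] v BW by force
    qed
    moreover have "card (induced E (B (Suc i))) \<le> (\<Sum>l\<le>i. card (F l))"
    proof -
      have "induced E (B (Suc i)) \<subseteq> (\<Union>l\<in>{..i}. F l)"
      proof
        fix e assume e: "e \<in> induced E (B (Suc i))"
        then have "card e = 2" "e \<in> E" using E unfolding simple_edges_def induced_def by auto
        then obtain u v where uv: "e = {u, v}" by (auto simp: card_2_iff)
        then have uvB: "u \<in> B (Suc i)" "v \<in> B (Suc i)" using e unfolding induced_def by auto
        then have uvC: "u \<in> C" "v \<in> C" "lev u \<le> Suc i" "lev v \<le> Suc i" using B_iff by auto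
        from step[OF uvC(1,2)] uv \<open>e \<in> E\<close> have "lev u = Suc (lev v) \<or> lev v = Suc (lev u)" by simp
        then show "e \<in> (\<Union>l\<in>{..i}. F l)"
        proof
          assume *: "lev u = Suc (lev v)"
          then have "e \<in> F (lev v)" using uv uvC \<open>e \<in> E\<close>
            by (intro F_I[of e v u]) (auto simp: L_def)
          then show ?thesis using * uvC by auto
        next
          assume *: "lev v = Suc (lev u)"
          then have "e \<in> F (lev u)" using uv uvC \<open>e \<in> E\<close>
            by (intro F_I[of e u v]) (auto simp: L_def)
          then show ?thesis using * uvC by auto
        qed
      qed
      then have "card (induced E (B (Suc i))) \<le> card (\<Union>l\<in>{..i}. F l)"
        using finF by (intro card_mono) auto
      also have "\<dots> \<le> (\<Sum>l\<le>i. card (F l))" by (rule card_UN_le) simp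
      finally show ?thesis .
    qed
    moreover have "real (\<Sum>l\<le>i. card (F l)) \<le> 8 * \<eta> * (2 * card (B (Suc i)))"
    proof -
      have "real (\<Sum>l\<le>i. card (F l)) \<le> (\<Sum>l\<le>i. 8 * \<eta> * (card (L l) + card (L (Suc l))))"
        unfolding of_nat_sum by (intro sum_mono) (use sp in auto)
      also have "\<dots> = 8 * \<eta> * real ((\<Sum>l\<le>i. card (L l)) + (\<Sum>l\<le>i. card (L (Suc l))))"
        by (simp add: sum_distrib_left sum.distrib distrib_left)
      also have "(\<Sum>l\<le>i. card (L (Suc l))) = (\<Sum>l\<in>Suc ` {..i}. card (L l))"
        by (subst sum.reindex) auto
      also have "8 * \<eta> * real ((\<Sum>l\<le>i. card (L l)) + (\<Sum>l\<in>Suc ` {..i}. card (L l)))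
          \<le> 8 * \<eta> * (2 * card (B (Suc i)))"
      proof -
        have "(\<Sum>l\<le>i. card (L l)) + (\<Sum>l\<in>Suc ` {..i}. card (L l)) \<le> 2 * card (B (Suc i))"
          using add_mono[OF sumL[of "{..i}"] sumL[of "Suc ` {..i}"]] by fastforce
        then have "real ((\<Sum>l\<le>i. card (L l)) + (\<Sum>l\<in>Suc ` {..i}. card (L l))) \<le> 2 * real (card (B (Suc i)))"
          by linarith
        then show ?thesis using \<eta> by (intro mult_left_mono) auto
      qed
      finally show ?thesis .
    qed
    moreover have "8 * \<eta> * (2 * real (card (B (Suc i)))) \<le> 8 * \<eta> * (2 * (2 * real (card (B i))))"
      using i(2) \<eta> by (intro mult_left_mono) auto
    moreover have "card (B i) > 0" using finB Bmono[of 0 i] B0 by (auto simp: card_gt_0_iff)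
    then have "\<eta> * card (B i) > 0" using \<eta> by simp
    ultimately show False by linarith
  qed
  then obtain l where l: "l \<le> i" "8 * \<eta> * (card (L l) + card (L (Suc l))) < card (F l)" by blast

  have F_simple: "simple_edges (F l)" using simple_edges_subset[OF E FE] .
  have "induced (F l) (L l \<union> L (Suc l)) = F l" unfolding induced_def F_def by auto
  moreover have "card (L l \<union> L (Suc l)) = card (L l) + card (L (Suc l))"
    by (rule card_Un_disjoint[OF finL finL]) (auto simp: L_def)
  ultimately obtain K where K: "K \<subseteq> L l \<union> L (Suc l)" "K \<noteq> {}"
    and degK: "\<And>v. v \<in> K \<Longrightarrow> 8 * \<eta> \<le> card (nbrs (F l) K v)"
    using exists_min_degree_core[OF F_simple, of "L l \<union> L (Suc l)" "8 * \<eta>"] l(2) finL by auto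
  have KC: "K \<subseteq> C" using K(1) unfolding L_def by auto
  have finK: "finite K" using KC finC finite_subset by auto
  have F_lev: "(lev u = l \<and> lev v = Suc l) \<or> (lev u = Suc l \<and> lev v = l)" if "{u, v} \<in> F l" for u v
    using that unfolding F_def L_def by (auto simp: doubleton_eq_iff)
  have nb2: "\<exists>a b. a \<in> nbrs (F l) K v \<and> b \<in> nbrs (F l) K v \<and> a \<noteq> b" if "v \<in> K" for v
  proof -
    have "card (nbrs (F l) K v) \<ge> 2" using degK[OF that] \<eta> by linarith
    then obtain S where "S \<subseteq> nbrs (F l) K v" "card S = 2" by (metis obtain_subset_with_card_n)
    then show ?thesis by (auto simp: card_2_iff)
  qed
  have "l < n div 2" using l i by simp

  have pow_par: "(par ^^ j) u \<in> C \<and> lev ((par ^^ j) u) + j = lev u" if "u \<in> C" "j \<le> lev u" for u j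
    using that(2)
  proof (induction j)
    case (Suc j)
    then have "(par ^^ j) u \<in> C" "lev ((par ^^ j) u) + j = lev u" by auto
    moreover from this have "lev ((par ^^ j) u) \<noteq> 0" using Suc.prems by simp
    ultimately show ?case using par[of "(par ^^ j) u"] by simp
  qed (use that in simp)
  have pow_eq_mono: "(par ^^ j) u = (par ^^ j) v" if "(par ^^ i) u = (par ^^ i) v" "i \<le> j" for i j u v
  proof -
    have "par ^^ j = par ^^ (j - i) \<circ> par ^^ i" using that(2) by (metis funpow_add le_add_diff_inverse2)
    then show ?thesis using that(1) by simp
  qed
  \<comment> \<open>Vertices two steps apart on a path in \<open>K\<close>, both on level
    \<open>l\<close>, are neighbours of the same vertex on level \<open>l + 1\<close>. So
    \<open>meet h\<close> makes the \<open>h\<close>-th ancestor constant along the path, while the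
    failure of \<open>meet (h - 1)\<close> provides two branches that join exactly at height
    \<open>h\<close>.\<close>
  define meet where "meet h \<longleftrightarrow> (\<forall>q\<in>K. lev q = Suc l \<longrightarrow>
    (\<forall>a\<in>nbrs (F l) K q. \<forall>b\<in>nbrs (F l) K q. (par ^^ h) a = (par ^^ h) b))" for h
  define h where "h = (LEAST h. meet h)"
  have nb_lev: "lev a = l" "a \<in> C" "a \<in> K" if "a \<in> nbrs (F l) K q" "lev q = Suc l" for a q
    using that F_lev[of a q] KC unfolding nbrs_def by auto
  have "meet l"
    unfolding meet_def
  proof (intro ballI impI)
    fix q a b assume q: "q \<in> K" "lev q = Suc l" and ab: "a \<in> nbrs (F l) K q" "b \<in> nbrs (F l) K q"
    have "(par ^^ l) a = r" "(par ^^ l) b = r"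
      using pow_par[of a l] pow_par[of b l] nb_lev[OF ab(1) q(2)] nb_lev[OF ab(2) q(2)] root by auto
    then show "(par ^^ l) a = (par ^^ l) b" by simp
  qed
  then have meet_h: "meet h" and h_le: "h \<le> l" unfolding h_def by (auto intro: LeastI Least_le)
  have K_top: "\<exists>q\<in>K. lev q = Suc l"
  proof -
    obtain v where v: "v \<in> K" using K(2) by auto
    then obtain u where u: "u \<in> nbrs (F l) K v" using nb2 by blast
    then have "{u, v} \<in> F l" "u \<in> K" unfolding nbrs_def by auto
    then show ?thesis using F_lev[of u v] v by auto
  qed
  have "h \<noteq> 0"
  proof
    assume "h = 0"
    then have "meet 0" using meet_h by simp
    then show False using K_top nb2 unfolding meet_def by fastforce
  qed
  then have "\<not> meet (h - 1)" unfolding h_def using not_less_Least[of "h - 1" meet] h_def by simp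
  then obtain q a b where q: "q \<in> K" "lev q = Suc l"
    and ab: "a \<in> nbrs (F l) K q" "b \<in> nbrs (F l) K q"
    and ab_ne: "(par ^^ (h - 1)) a \<noteq> (par ^^ (h - 1)) b"
    unfolding meet_def by blast
  note la = nb_lev[OF ab(1) q(2)] and lb = nb_lev[OF ab(2) q(2)]

  \<comment> \<open>\<open>a\<close> and \<open>b\<close> are kept off the path so that the one
    chosen as \<open>w\<close> is a new vertex. Deleting them costs at most
    \<open>2 <= 4 * \<eta>\<close> in each degree, so \<open>8 * \<eta>\<close> leaves
    \<open>4 * \<eta>\<close>.\<close>
  have "\<exists>xs. length xs = n \<and> distinct xs \<and> hd xs = q \<and> set xs \<subseteq> K - {a, b} \<and>
           successively (\<lambda>u v. {u, v} \<in> F l) xs"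
  proof (rule exists_long_path[OF F_simple, of _ _ \<eta>])
    show "q \<in> K - {a, b}" using q la lb by auto
    show "4 * \<eta> \<le> card (nbrs (F l) (K - {a, b}) v)" if v: "v \<in> K - {a, b}" for v
    proof -
      have "nbrs (F l) K v \<subseteq> nbrs (F l) (K - {a, b}) v \<union> {a, b}" unfolding nbrs_def by auto
      then have "card (nbrs (F l) K v) \<le> card (nbrs (F l) (K - {a, b}) v \<union> {a, b})"
        using finK by (intro card_mono) (auto intro: finite_nbrs)
      also have "\<dots> \<le> card (nbrs (F l) (K - {a, b}) v) + card {a, b}" by (rule card_Un_le)
      also have "\<dots> \<le> card (nbrs (F l) (K - {a, b}) v) + 2" by (simp add: card_insert_if)
      finally show ?thesis using degK[of v] v \<eta> by simp
    qed
    show "card (induced (F l) S) < \<eta> * card S" if "S \<subseteq> K - {a, b}" "S \<noteq> {}" "card S \<le> 2 * n" for S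
    proof -
      have "induced (F l) S \<subseteq> induced E S" using FE unfolding induced_def by auto
      then have "card (induced (F l) S) \<le> card (induced E S)"
        using E unfolding simple_edges_def induced_def by (intro card_mono) auto
      moreover have "S \<subseteq> V" using that KC CW WV by auto
      then have "card (induced E S) < \<eta> * card S" using sparse that by blast
      ultimately show ?thesis by linarith
    qed
  qed (use finK n \<eta> in auto)
  then obtain xs where xs: "length xs = n" "distinct xs" "hd xs = q" "set xs \<subseteq> K - {a, b}"
    "successively (\<lambda>u v. {u, v} \<in> F l) xs" by auto
  have xs_step: "{xs ! j, xs ! Suc j} \<in> F l" if "Suc j < n" for j
    using successively_nthD[OF xs(5)] that xs(1) by simp
  have xs0: "xs ! 0 = q" using xs(1,3) n by (cases xs) auto
  have xsK: "xs ! j \<in> K" "xs ! j \<in> C" if "j < n" for j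
  proof -
    have "xs ! j \<in> set xs" using that xs(1) by simp
    then show "xs ! j \<in> K" "xs ! j \<in> C" using xs(4) KC by auto
  qed
  have xs_lev: "j < n \<Longrightarrow> lev (xs ! j) = (if even j then Suc l else l)" for j
  proof (induction j)
    case (Suc j)
    then show ?case using F_lev[OF xs_step[of j]] by auto
  qed (use xs0 q in auto)
  have xs_meet: "odd j \<Longrightarrow> j < n \<Longrightarrow> (par ^^ h) (xs ! j) = (par ^^ h) a" for j
  proof (induction j rule: less_induct)
    case (less j)
    show ?case
    proof (cases "j = 1")
      case True
      have "xs ! 1 \<in> nbrs (F l) K q"
        using xs_step[of 0] xs0 xsK(1)[of 1] less True unfolding nbrs_def by (simp add: insert_commute)
      then show ?thesis using meet_h q ab(1) True unfolding meet_def by blast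
    next
      case False
      then obtain j' where j': "j = Suc (Suc j')" using less.prems
        by (metis One_nat_def even_zero not0_implies_Suc)
      let ?q = "xs ! Suc j'"
      have "xs ! j' \<in> nbrs (F l) K ?q" "xs ! j \<in> nbrs (F l) K ?q"
        using xs_step[of j'] xs_step[of "Suc j'"] xsK less j' unfolding nbrs_def
        by (auto simp: insert_commute)
      moreover have "?q \<in> K" "lev ?q = Suc l" using xsK[of "Suc j'"] xs_lev[of "Suc j'"] less j' by auto
      ultimately have "(par ^^ h) (xs ! j) = (par ^^ h) (xs ! j')" using meet_h unfolding meet_def by blast
      then show ?thesis using less j' by simp
    qed
  qed

  \<comment> \<open>The cycle consists of \<open>w\<close>, the \<open>p + 1\<close> path vertices
    from \<open>q\<close> to \<open>v\<close>, the \<open>h\<close> ancestors of \<open>v\<close> up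
    to the meeting point, and \<open>h - 1\<close> ancestors of \<open>w\<close>. Since
    \<open>n\<close> is even, \<open>p\<close> is odd and \<open>v\<close> is on level
    \<open>l\<close>; \<open>h <= l < n / 2\<close> leaves \<open>p >= 1\<close>.\<close>
  define p where "p = n - 1 - 2 * h"
  have p: "odd p" "p < n" "p + 1 + 2 * h = n"
    using n h_le \<open>l < n div 2\<close> unfolding p_def by (auto elim!: evenE)
  define v where "v = xs ! p"
  have v: "v \<in> C" "lev v = l" "(par ^^ h) v = (par ^^ h) a" "v \<in> set xs"
    unfolding v_def using xsK xs_lev xs_meet p xs(1) by auto
  have ab_h: "(par ^^ h) a = (par ^^ h) b" using meet_h q ab unfolding meet_def by blast
  \<comment> \<open>The ancestors of \<open>a\<close> and \<open>b\<close> at height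
    \<open>h - 1\<close> differ, so that of \<open>v\<close> differs from at least one of
    them.\<close>
  have "\<exists>w\<in>{a, b}. (par ^^ (h - 1)) v \<noteq> (par ^^ (h - 1)) w"
    using ab_ne by (metis insertCI)
  then obtain w where w: "w \<in> {a, b}" "(par ^^ (h - 1)) v \<noteq> (par ^^ (h - 1)) w" by blast
  have w_facts: "w \<in> C" "lev w = l" "(par ^^ h) v = (par ^^ h) w" "w \<notin> set xs" "{w, q} \<in> F l"
    using w la lb v ab_h xs(4) ab unfolding nbrs_def by auto
  have vw_ne: "(par ^^ j) v \<noteq> (par ^^ j) w" if "j < h" for j
  proof
    assume "(par ^^ j) v = (par ^^ j) w"
    then have "(par ^^ (h - 1)) v = (par ^^ (h - 1)) w" using that by (intro pow_eq_mono[of j v w "h - 1"]) simp_all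
    then show False using w(2) by simp
  qed
  have lev_pow: "(par ^^ j) u \<in> C" "lev ((par ^^ j) u) = l - j" if "j \<le> h" "u \<in> {v, w}" for j u
    using pow_par[of u j] that v w_facts h_le by auto
  have par_edge: "{(par ^^ j) u, (par ^^ Suc j) u} \<in> E" if "j < h" "u \<in> {v, w}" for j u
    using par(3)[of "(par ^^ j) u"] lev_pow[of j u] that h_le by auto

  define ys where "ys = take (Suc p) xs"
  \<comment> \<open>The common ancestor at height \<open>h\<close> is the last entry of
    \<open>as\<close>; \<open>bs\<close> starts one level above it and returns towards
    \<open>w\<close>, which itself opens the cycle.\<close>
  define as where "as = map (\<lambda>j. (par ^^ j) v) [1..<Suc h]"
  define bs where "bs = rev (map (\<lambda>j. (par ^^ j) w) [1..<h])"
  have len_ys: "length ys = Suc p" using xs p unfolding ys_def by simp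
  have last_ys: "last ys = v" using len_ys xs p unfolding ys_def v_def
    by (subst last_conv_nth) auto
  have hd_ys: "hd ys = q" unfolding ys_def using xs by (simp add: hd_take)
  have h1: "h \<ge> 1" using \<open>h \<noteq> 0\<close> by simp
  have as_ne: "as \<noteq> []" unfolding as_def using h1 by simp
  have "hd as = as ! 0" using as_ne by (rule hd_conv_nth)
  then have hd_as: "hd as = par v" unfolding as_def using h1 by (simp del: upt_Suc)
  have last_as: "last as = (par ^^ h) w" unfolding as_def using h1 w_facts(3) by simp
  have suc_as: "successively (\<lambda>u v. {u, v} \<in> E) as"
    unfolding as_def successively_map
  proof (rule successively_if_nth)
    fix j assume "Suc j < length [1..<Suc h]"
    then show "{(par ^^ ([1..<Suc h] ! j)) v, (par ^^ ([1..<Suc h] ! Suc j)) v} \<in> E"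
      using par_edge[of "Suc j" v] by (simp del: upt_Suc)
  qed
  have suc_bs: "successively (\<lambda>u v. {u, v} \<in> E) bs"
    unfolding bs_def successively_map successively_rev
  proof (rule successively_if_nth)
    fix j assume "Suc j < length [1..<h]"
    then show "{(par ^^ ([1..<h] ! Suc j)) w, (par ^^ ([1..<h] ! j)) w} \<in> E"
      using par_edge[of "Suc j" w] by (simp add: insert_commute)
  qed
  show ?thesis
  proof (rule has_cycle_listI[where xs = "w # ys @ as @ bs"])
    show "length (w # ys @ as @ bs) = n"
      using len_ys p h1 unfolding as_def bs_def by simp
    show "n > 0" using n by simp
    have set_ys: "set ys \<subseteq> set xs" unfolding ys_def by (rule set_take_subset)
    have lev_ys: "l \<le> lev u" if "u \<in> set ys" for u
    proof -
      have "u \<in> set xs" using that set_ys by auto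
      then obtain j where "j < n" "u = xs ! j" using xs(1) by (auto simp: in_set_conv_nth)
      then show ?thesis using xs_lev[of j] by auto
    qed
    \<comment> \<open>Proper ancestors lie below level \<open>l\<close>, path vertices on levels
      \<open>l\<close> and \<open>l + 1\<close>: the detour through the tree never meets the
      path.\<close>
    have lev_ab: "lev u < l" if "u \<in> set as \<union> set bs" for u
      using that lev_pow(2)[of _ v] lev_pow(2)[of _ w] h_le h1 unfolding as_def bs_def by fastforce
    have "distinct as" unfolding as_def distinct_map
    proof (intro conjI inj_onI)
      fix x y assume xy: "x \<in> set [1..<Suc h]" "y \<in> set [1..<Suc h]" "(par ^^ x) v = (par ^^ y) v"
      then have "l - x = l - y" using lev_pow(2)[of x v] lev_pow(2)[of y v] by auto
      then show "x = y" using xy h_le by auto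
    qed simp
    moreover have "distinct bs" unfolding bs_def distinct_rev distinct_map
    proof (intro conjI inj_onI)
      fix x y assume xy: "x \<in> set [1..<h]" "y \<in> set [1..<h]" "(par ^^ x) w = (par ^^ y) w"
      then have "l - x = l - y" using lev_pow(2)[of x w] lev_pow(2)[of y w] by auto
      then show "x = y" using xy h_le by auto
    qed simp
    moreover have "set as \<inter> set bs = {}"
    proof (rule ccontr)
      assume "set as \<inter> set bs \<noteq> {}"
      then obtain u where u: "u \<in> set as" "u \<in> set bs" by auto
      obtain x where x: "x \<in> set [1..<Suc h]" "u = (par ^^ x) v"
        using u(1) unfolding as_def set_map by blast
      obtain y where y: "y \<in> set [1..<h]" "u = (par ^^ y) w"
        using u(2) unfolding bs_def set_rev set_map by blast
      have xy: "1 \<le> x" "x \<le> h" "1 \<le> y" "y < h" "(par ^^ x) v = (par ^^ y) w"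
        using x y by auto
      then have "l - x = l - y" using lev_pow(2)[of x v] lev_pow(2)[of y w] by auto
      then have "x = y" using xy h_le by auto
      then show False using vw_ne[of x] xy by auto
    qed
    moreover have "distinct ys" unfolding ys_def using xs(2) by simp
    moreover have "set ys \<inter> (set as \<union> set bs) = {}" using lev_ys lev_ab by fastforce
    moreover have "w \<notin> set ys" using w_facts set_ys by auto
    moreover have "w \<notin> set as \<union> set bs" using lev_ab[of w] w_facts by auto
    ultimately show "distinct (w # ys @ as @ bs)" by auto
    have "successively (\<lambda>u v. {u, v} \<in> F l) ys"
      using xs(5) unfolding ys_def by (metis append_take_drop_id successively_append_iff)
    then have "successively (\<lambda>u v. {u, v} \<in> E) ys"
      by (rule successively_mono) (use FE in auto)
    moreover have "{last ys, hd as} \<in> E" using last_ys hd_as par_edge[of 0 v] h1 by simp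
    moreover have "bs = [] \<or> {last as, hd bs} \<in> E"
    proof (cases "h = 1")
      case False
      then have "hd bs = (par ^^ (h - 1)) w" unfolding bs_def using h1 by (simp add: hd_rev last_map)
      then show ?thesis using last_as par_edge[of "h - 1" w] h1 by (simp add: insert_commute)
    qed (simp add: bs_def)
    moreover have "{w, hd ys} \<in> E" using w_facts(5) FE hd_ys by auto
    moreover have "ys \<noteq> []" using len_ys by auto
    ultimately show "successively (\<lambda>u v. {u, v} \<in> E) (w # ys @ as @ bs)"
      using suc_as suc_bs as_ne by (simp add: successively_append_iff successively_Cons)
    show "{last (w # ys @ as @ bs), hd (w # ys @ as @ bs)} \<in> E"
    proof (cases "h = 1")
      case True
      then have "last (w # ys @ as @ bs) = par w" using as_ne last_as by (simp add: bs_def)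
      then show ?thesis using par_edge[of 0 w] True by (simp add: insert_commute)
    next
      case False
      then have "bs \<noteq> []" "last bs = par w" unfolding bs_def using h1
        by (auto simp: last_rev hd_map)
      then show ?thesis using par_edge[of 0 w] h1 by (simp add: insert_commute)
    qed
  qed
qed

section \<open>Upper bound: the random host and its parameters\<close>

section \<open>Locally sparse hosts\<close>

lemma ln_ge_half:
  assumes "k \<ge> (2::nat)"
  shows "ln (real k) \<ge> 1 / 2"
proof -
  have "exp (1 / 2 :: real) ^ 2 = exp 1" by (simp add: exp_of_nat_mult[symmetric])
  also have "\<dots> \<le> 2 ^ 2" using exp_le by simp
  finally have "exp (1 / 2 :: real) \<le> 2" by (rule power2_le_imp_le) simp
  also have "2 \<le> real k" using assms by simp
  finally show ?thesis using assms ln_ge_iff[of "real k" "1 / 2"] by simp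
qed

text \<open>Divided by \<open>p choose M\<close> this bounds the probability that a uniform
  \<open>M\<close>-subset of a \<open>p\<close>-set contains \<open>\<tau>\<close> given elements.
  Exposing these one by one yields factors \<open>(M - i) / (p - i) <= M / p\<close>.\<close>

lemma binomial_diff_le:
  assumes "\<tau> \<le> M" "M \<le> p"
  shows "real ((p - \<tau>) choose (M - \<tau>)) \<le> real (p choose M) * (real M / real p) ^ \<tau>"
  using assms(1)
proof (induction \<tau>)
  case (Suc \<tau>)
  have "(M - \<tau>) * ((p - \<tau>) choose (M - \<tau>)) = (p - \<tau>) * ((p - Suc \<tau>) choose (M - Suc \<tau>))"
    using times_binomial_minus1_eq[of "M - \<tau>" "p - \<tau>"] Suc.prems by simp
  then have "real (M - \<tau>) * real ((p - \<tau>) choose (M - \<tau>)) = real (p - \<tau>) * real ((p - Suc \<tau>) choose (M - Suc \<tau>))"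
    by (metis of_nat_mult)
  moreover have pos: "real (p - \<tau>) > 0" using Suc.prems assms(2) by simp
  ultimately have "real ((p - Suc \<tau>) choose (M - Suc \<tau>)) = real ((p - \<tau>) choose (M - \<tau>)) * (real (M - \<tau>) / real (p - \<tau>))"
    by (simp add: field_simps)
  also have "\<dots> \<le> (real (p choose M) * (real M / real p) ^ \<tau>) * (real M / real p)"
  proof (rule mult_mono)
    show "real (M - \<tau>) / real (p - \<tau>) \<le> real M / real p"
    proof -
      have "real (M - \<tau>) = real M - real \<tau>" "real (p - \<tau>) = real p - real \<tau>"
        using Suc.prems assms(2) by (auto simp: of_nat_diff)
      moreover have "real \<tau> * real M \<le> real \<tau> * real p" using assms(2) by (intro mult_left_mono) auto
      moreover have "real p > 0" using Suc.prems assms(2) by simp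
      ultimately show ?thesis using pos by (simp add: divide_le_eq le_divide_eq field_simps)
    qed
  qed (use Suc in auto)
  finally show ?case by (simp add: mult_ac)
qed simp

text \<open>First moment over uniform \<open>M\<close>-subsets of \<open>P\<close>. Fixing the size,
  instead of choosing elements independently, makes the number of edges of the host exact without a
  concentration bound.\<close>

lemma exists_subset_avoiding:
  fixes T :: "'i \<Rightarrow> 'a set"
  assumes P: "finite P" "M \<le> card P" and I: "finite I" "\<And>i. i \<in> I \<Longrightarrow> T i \<subseteq> P"
    and sum: "(\<Sum>i\<in>I. (real M / real (card P)) ^ card (T i)) < 1"
  obtains E where "E \<subseteq> P" "card E = M" "\<And>i. i \<in> I \<Longrightarrow> \<not> T i \<subseteq> E"
proof -
  define \<Omega> where "\<Omega> = {E. E \<subseteq> P \<and> card E = M}"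
  define bad where "bad i = {E \<in> \<Omega>. T i \<subseteq> E}" for i
  have fin\<Omega>: "finite \<Omega>" unfolding \<Omega>_def using P by auto
  have card\<Omega>: "card \<Omega> = card P choose M" unfolding \<Omega>_def using n_subsets[OF P(1)] .
  have cbad: "real (card (bad i)) \<le> real (card \<Omega>) * (real M / real (card P)) ^ card (T i)" if i: "i \<in> I" for i
  proof (cases "card (T i) \<le> M")
    case True
    have fT: "finite (T i)" using I(2)[OF i] P(1) finite_subset by blast
    have "bij_betw (\<lambda>E. E - T i) (bad i) {F. F \<subseteq> P - T i \<and> card F = M - card (T i)}"
    proof (rule bij_betwI[where g = "\<lambda>F. F \<union> T i"])
      show "(\<lambda>E. E - T i) \<in> bad i \<rightarrow> {F. F \<subseteq> P - T i \<and> card F = M - card (T i)}"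
        using fT unfolding bad_def \<Omega>_def by (auto simp: card_Diff_subset)
      show "(\<lambda>F. F \<union> T i) \<in> {F. F \<subseteq> P - T i \<and> card F = M - card (T i)} \<rightarrow> bad i"
      proof
        fix F assume F: "F \<in> {F. F \<subseteq> P - T i \<and> card F = M - card (T i)}"
        then have "finite F" using P(1) by (metis (no_types, lifting) finite_Diff finite_subset mem_Collect_eq)
        then have "card (F \<union> T i) = card F + card (T i)" using F fT by (intro card_Un_disjoint) auto
        then show "F \<union> T i \<in> bad i" using F True I(2)[OF i] unfolding bad_def \<Omega>_def by auto
      qed
    qed (auto simp: bad_def)
    then have "card (bad i) = card {F. F \<subseteq> P - T i \<and> card F = M - card (T i)}" by (rule bij_betw_same_card)
    also have "\<dots> = card (P - T i) choose (M - card (T i))" using P(1) by (intro n_subsets) auto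
    also have "card (P - T i) = card P - card (T i)" using fT I(2)[OF i] by (rule card_Diff_subset)
    finally show ?thesis using binomial_diff_le[OF True P(2)] card\<Omega> by simp
  next
    case False
    have "bad i = {}"
    proof (rule ccontr)
      assume "bad i \<noteq> {}"
      then obtain E where "E \<subseteq> P" "card E = M" "T i \<subseteq> E" unfolding bad_def \<Omega>_def by auto
      then have "card (T i) \<le> M" using P(1) by (metis card_mono finite_subset)
      then show False using False by simp
    qed
    then show ?thesis by simp
  qed
  have "\<exists>E\<in>\<Omega>. \<forall>i\<in>I. E \<notin> bad i"
  proof (rule ccontr)
    assume "\<not> ?thesis"
    then have "\<Omega> \<subseteq> (\<Union>i\<in>I. bad i)" by auto
    then have "card \<Omega> \<le> card (\<Union>i\<in>I. bad i)"
      using I(1) fin\<Omega> by (intro card_mono) (auto simp: bad_def)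
    also have "\<dots> \<le> (\<Sum>i\<in>I. card (bad i))" by (rule card_UN_le[OF I(1)])
    finally have "real (card \<Omega>) \<le> (\<Sum>i\<in>I. real (card (bad i)))" by (metis of_nat_le_iff of_nat_sum)
    also have "\<dots> \<le> (\<Sum>i\<in>I. real (card \<Omega>) * (real M / real (card P)) ^ card (T i))"
      by (intro sum_mono cbad)
    also have "\<dots> = real (card \<Omega>) * (\<Sum>i\<in>I. (real M / real (card P)) ^ card (T i))"
      by (simp add: sum_distrib_left)
    also have "\<dots> < real (card \<Omega>) * 1"
      using sum card\<Omega> P(2) by (intro mult_strict_left_mono) auto
    finally show False by simp
  qed
  then show ?thesis using that unfolding bad_def \<Omega>_def by blast
qed

text \<open>A single term of the exponential series at \<open>s\<close>.\<close>

lemma power_self_le_exp_fact: "real s ^ s \<le> exp (real s) * fact s"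
proof -
  have "summable (\<lambda>n. inverse (fact n) *\<^sub>R (real s) ^ n)" by (rule summable_exp_generic)
  then have "(\<Sum>n\<in>{s}. inverse (fact n) *\<^sub>R (real s) ^ n) \<le> (\<Sum>n. inverse (fact n) *\<^sub>R (real s) ^ n)"
    by (intro sum_le_suminf) auto
  then have "inverse (fact s) * real s ^ s \<le> exp (real s)" unfolding exp_def by simp
  then have "fact s * (inverse (fact s) * real s ^ s) \<le> fact s * exp (real s)"
    by (intro mult_left_mono) auto
  then show ?thesis by (simp add: mult.assoc[symmetric] mult.commute)
qed

lemma binomial_le_exp_power:
  assumes "s > 0"
  shows "real (N choose s) \<le> (exp 1 * real N / real s) ^ s"
proof -
  have "real (N choose s) * real s ^ s \<le> real (N choose s) * (exp (real s) * fact s)"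
    by (intro mult_left_mono power_self_le_exp_fact) auto
  also have "\<dots> = exp (real s) * real ((N choose s) * fact s)" by simp
  also have "\<dots> \<le> exp (real s) * real (N ^ s)"
    by (intro mult_left_mono of_nat_mono binomial_fact_pow) auto
  finally have "real (N choose s) * real s ^ s \<le> exp (real s) * real N ^ s" by simp
  moreover have "exp (real s) = exp 1 ^ s" by (simp add: exp_of_nat_mult[symmetric])
  ultimately show ?thesis using assms
    by (simp add: power_divide power_mult_distrib le_divide_eq)
qed

lemma sum_quarter_powers_less_1: "(\<Sum>s=1..m. (1 / 4 :: real) ^ s) < 1"
proof -
  define q :: real where "q = 1 / 4"
  have "(\<Sum>s=1..m. q ^ s) = (1 - q ^ m) / 3"
  proof (induction m)
    case (Suc m)
    have "q ^ Suc m = q ^ m / 4" by (simp add: q_def)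
    moreover have "(\<Sum>s=1..Suc m. q ^ s) = (\<Sum>s=1..m. q ^ s) + q ^ Suc m" by simp
    ultimately show ?case using Suc by (simp only: field_simps)
  qed simp
  moreover have "q ^ m > 0" by (simp add: q_def)
  ultimately have "(\<Sum>s=1..m. q ^ s) < 1" by (simp only: field_simps)
  then show ?thesis by (simp add: q_def)
qed

text \<open>The left side bounds the expected number of pairs of an \<open>s\<close>-set and
  \<open>\<tau>\<close> chosen edges inside it. With \<open>y = s / (2 n)\<close> the edges
  contribute at most \<open>(y * exp (-2))^\<tau> <= (y * exp (-2 \<eta>))^s\<close> and the
  vertices \<open>(exp 1 * 2^14 * k / y)^s\<close>. So \<open>y\<close> cancels, and
  \<open>exp (-2 \<eta>) <= k^(-40)\<close> absorbs \<open>k\<close> and the constants.\<close>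

lemma union_bound_term_le:
  fixes \<eta> :: real
  assumes k: "k \<ge> 2" and n: "n > 0" and s: "1 \<le> s" "s \<le> 2 * n"
    and \<eta>: "\<eta> \<ge> 20 * ln (real k)" and N0: "N0 = 2 ^ 14 * k * n" and M: "real M = 160 * real k * real N0 * \<eta>"
    and \<tau>: "\<tau> = nat \<lceil>\<eta> * real s\<rceil>"
  shows "real ((2 * N0) choose s) * (real (s\<^sup>2 choose \<tau>) * (real M / real (N0\<^sup>2)) ^ \<tau>) \<le> (1 / 4) ^ s"
proof -
  have "ln (real k) \<ge> 1 / 2" using k by (rule ln_ge_half)
  then have \<eta>1: "\<eta> \<ge> 1" using \<eta> by simp
  define y where "y = real s / (2 * real n)"
  have y: "0 < y" "y \<le> 1" unfolding y_def using s n by (auto simp: field_simps)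
  have \<tau>_ge: "real \<tau> \<ge> \<eta> * real s" unfolding \<tau> by linarith
  have "\<eta> * real s \<ge> 1 * real s" using \<eta>1 s by (intro mult_right_mono) auto
  then have \<tau>s: "\<tau> \<ge> s" using \<tau>_ge by linarith
  then have \<tau>0: "\<tau> > 0" using s by simp
  have N0pos: "real N0 > 0" using N0 k n by simp
  have e3: "exp (1::real) \<le> 3" by (rule exp_le)
  have "real (s\<^sup>2 choose \<tau>) * (real M / real (N0\<^sup>2)) ^ \<tau> \<le> (exp 1 * real (s\<^sup>2) / real \<tau>) ^ \<tau> * (real M / real (N0\<^sup>2)) ^ \<tau>"
    by (intro mult_right_mono binomial_le_exp_power[OF \<tau>0]) auto
  also have "\<dots> = (exp 1 * real (s\<^sup>2) / real \<tau> * (real M / real (N0\<^sup>2))) ^ \<tau>" by (simp only: power_mult_distrib)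
  also have "\<dots> \<le> (y * exp (-2)) ^ \<tau>"
  proof (rule power_mono)
    have "exp 1 * real (s\<^sup>2) / real \<tau> * (real M / real (N0\<^sup>2))
        \<le> exp 1 * real (s\<^sup>2) / (\<eta> * real s) * (real M / real (N0\<^sup>2))"
      using \<tau>_ge s \<eta>1 \<tau>0 by (intro mult_right_mono divide_left_mono) auto
    also have "\<dots> = exp 1 * (160 * real k * real s / real N0)"
      unfolding M using N0pos s \<eta>1 by (simp add: field_simps power2_eq_square)
    \<comment> \<open>The factor \<open>2^14\<close> in \<open>N0\<close> is large enough for
      \<open>exp 3 * 5 / 256 < 1\<close>, which yields the \<open>exp (-2)\<close> per edge.\<close>
    also have "\<dots> = exp 1 * (5 / 256 * y)"
      unfolding N0 y_def using k n by (simp add: field_simps)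
    also have "\<dots> \<le> y * exp (-2)"
    proof -
      have "exp (1::real) * exp 2 = exp 1 ^ 3" by (simp add: exp_of_nat_mult[symmetric] exp_add[symmetric])
      also have "\<dots> \<le> 3 ^ 3" using e3 by (intro power_mono) auto
      finally have "exp (1::real) * exp 2 \<le> 27" by simp
      then have "exp (1::real) * (5 / 256) \<le> exp (-2)" by (simp add: exp_minus field_simps)
      then have "exp (1::real) * (5 / 256) * y \<le> exp (-2) * y" using y by (intro mult_right_mono) auto
      then show ?thesis by (simp add: mult_ac)
    qed
    finally show "exp 1 * real (s\<^sup>2) / real \<tau> * (real M / real (N0\<^sup>2)) \<le> y * exp (-2)" .
  qed auto
  also have "\<dots> = y ^ \<tau> * exp (- 2 * real \<tau>)"
    by (simp add: power_mult_distrib exp_of_nat_mult[symmetric] mult.commute)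
  also have "\<dots> \<le> y ^ s * exp (- 2 * \<eta> * real s)"
    using y \<tau>s \<tau>_ge by (intro mult_mono power_decreasing) auto
  also have "\<dots> = (y * exp (- 2 * \<eta>)) ^ s"
    by (simp add: power_mult_distrib exp_of_nat_mult[symmetric] mult.commute mult.left_commute)
  finally have A: "real (s\<^sup>2 choose \<tau>) * (real M / real (N0\<^sup>2)) ^ \<tau> \<le> (y * exp (- 2 * \<eta>)) ^ s" .
  have B: "real ((2 * N0) choose s) \<le> (exp 1 * real (2 * N0) / real s) ^ s"
    using s by (intro binomial_le_exp_power) auto
  have "real ((2 * N0) choose s) * (real (s\<^sup>2 choose \<tau>) * (real M / real (N0\<^sup>2)) ^ \<tau>)
      \<le> (exp 1 * real (2 * N0) / real s) ^ s * (y * exp (- 2 * \<eta>)) ^ s"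
    by (intro mult_mono A B) auto
  also have "\<dots> = (exp 1 * real (2 * N0) / real s * (y * exp (- 2 * \<eta>))) ^ s"
    by (simp only: power_mult_distrib)
  also have "exp 1 * real (2 * N0) / real s * (y * exp (- 2 * \<eta>)) = exp 1 * 2 ^ 14 * (real k * exp (- 2 * \<eta>))"
    unfolding N0 y_def using s n by (simp add: field_simps)
  also have "(exp 1 * 2 ^ 14 * (real k * exp (- 2 * \<eta>))) ^ s \<le> (1 / 4) ^ s"
  proof (rule power_mono)
    have "exp (- 2 * \<eta>) \<le> exp (real 40 * (- ln (real k)))" using \<eta> by simp
    also have "\<dots> = inverse (real k) ^ 40" using k by (subst exp_of_nat_mult) (simp add: exp_minus)
    finally have "real k * exp (- 2 * \<eta>) \<le> real k * inverse (real k) ^ 40" by (intro mult_left_mono) auto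
    also have "\<dots> = real k * (inverse (real k) * inverse (real k) ^ 39)"
      by (simp only: power_Suc[symmetric]) simp
    also have "\<dots> = inverse (real k) ^ 39" using k by simp
    also have "\<dots> \<le> inverse 2 ^ 39" using k by (intro power_mono) (auto simp: field_simps)
    finally have "exp 1 * 2 ^ 14 * (real k * exp (- 2 * \<eta>)) \<le> 3 * 2 ^ 14 * inverse 2 ^ 39"
      using e3 by (intro mult_mono) auto
    also have "\<dots> \<le> 1 / 4" by (simp add: field_simps)
    finally show "exp 1 * 2 ^ 14 * (real k * exp (- 2 * \<eta>)) \<le> 1 / 4" .
  qed auto
  finally show ?thesis .
qed

definition bipartite_pairs :: "nat \<Rightarrow> nat set set" where
  "bipartite_pairs N = (\<lambda>(i, j). {i, j}) ` ({..<N} \<times> {N..<2 * N})"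

lemma card_bipartite_pairs: "card (bipartite_pairs N) = N\<^sup>2"
proof -
  have "inj_on (\<lambda>(i, j). {i, j}) ({..<N} \<times> {N..<2 * N})"
    by (auto simp: inj_on_def doubleton_eq_iff)
  then show ?thesis unfolding bipartite_pairs_def by (simp add: card_image power2_eq_square)
qed

lemma finite_bipartite_pairs: "finite (bipartite_pairs N)"
  unfolding bipartite_pairs_def by simp

lemma bipartite_pairsD:
  assumes "e \<in> bipartite_pairs N"
  shows "card e = 2" "e \<subseteq> {..<2 * N}"
  using assms unfolding bipartite_pairs_def by auto

lemma card_induced_bipartite_pairs: "finite S \<Longrightarrow> card (induced (bipartite_pairs N) S) \<le> (card S)\<^sup>2"
proof -
  assume S: "finite S"
  have "induced (bipartite_pairs N) S \<subseteq> (\<lambda>(i, j). {i, j}) ` (S \<times> S)"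
    unfolding bipartite_pairs_def induced_def by auto
  then have "card (induced (bipartite_pairs N) S) \<le> card (S \<times> S)"
    using S by (meson card_image_le card_mono finite_SigmaI finite_imageI order_trans)
  then show ?thesis by (simp add: card_cartesian_product power2_eq_square)
qed

lemma exists_sparse_bipartite:
  fixes \<eta> :: real
  assumes k: "k \<ge> 2" and n: "n > 0"
    and \<eta>: "\<eta> \<ge> 20 * ln (real k)" and N0: "N0 = 2 ^ 14 * k * n" and M: "real M = 160 * real k * real N0 * \<eta>"
    and M_le: "M \<le> N0\<^sup>2"
  obtains E where "E \<subseteq> bipartite_pairs N0" "card E = M"
    "\<And>S. S \<subseteq> {..<2 * N0} \<Longrightarrow> S \<noteq> {} \<Longrightarrow> card S \<le> 2 * n \<Longrightarrow> card (induced E S) < \<eta> * card S"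
proof -
  let ?P = "bipartite_pairs N0"
  define \<tau> where "\<tau> s = nat \<lceil>\<eta> * real s\<rceil>" for s
  define A where "A s = {S. S \<subseteq> {..<2 * N0} \<and> card S = s}" for s
  define D where "D s S = {T. T \<subseteq> induced ?P S \<and> card T = \<tau> s}" for s S
  \<comment> \<open>Forbidden configurations: a vertex set \<open>S\<close> with
    \<open>\<tau> s\<close> potential edges \<open>T\<close> inside it. The size \<open>s\<close> is
    recorded as well so that the sum splits by size.\<close>
  define I where "I = Sigma {1..2 * n} (\<lambda>s. Sigma (A s) (D s))"
  have indP: "induced ?P S \<subseteq> ?P" for S unfolding induced_def by auto
  have find: "finite (induced ?P S)" for S using indP finite_bipartite_pairs finite_subset by blast
  have finA: "finite (A s)" for s unfolding A_def by simp
  have finD: "finite (D s S)" for s S unfolding D_def using find by simp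
  have fin: "finite I" unfolding I_def using finA finD by (intro finite_SigmaI) auto
  let ?q = "real M / real (N0\<^sup>2)"
  have "(\<Sum>i\<in>I. ?q ^ card (snd (snd i))) = (\<Sum>s=1..2 * n. \<Sum>S\<in>A s. \<Sum>T\<in>D s S. ?q ^ card T)"
    unfolding I_def using finA finD by (simp add: sum.Sigma case_prod_unfold)
  also have "\<dots> \<le> (\<Sum>s=1..2 * n. (1 / 4) ^ s)"
  proof (rule sum_mono)
    fix s assume s: "s \<in> {1..2 * n}"
    have "(\<Sum>S\<in>A s. \<Sum>T\<in>D s S. ?q ^ card T) \<le> (\<Sum>S\<in>A s. real (s\<^sup>2 choose \<tau> s) * ?q ^ \<tau> s)"
    proof (rule sum_mono)
      fix S assume S: "S \<in> A s"
      have "(\<Sum>T\<in>D s S. ?q ^ card T) = (\<Sum>T\<in>D s S. ?q ^ \<tau> s)"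
        by (rule sum.cong) (auto simp: D_def)
      also have "\<dots> = real (card (D s S)) * ?q ^ \<tau> s" by simp
      also have "card (D s S) = card (induced ?P S) choose \<tau> s"
        unfolding D_def by (rule n_subsets[OF find])
      also have "real (card (induced ?P S) choose \<tau> s) * ?q ^ \<tau> s \<le> real (s\<^sup>2 choose \<tau> s) * ?q ^ \<tau> s"
      proof (intro mult_right_mono of_nat_mono binomial_right_mono)
        have "finite S" using S unfolding A_def by (auto intro: finite_subset)
        then show "card (induced ?P S) \<le> s\<^sup>2"
          using card_induced_bipartite_pairs[of S N0] S unfolding A_def by auto
      qed auto
      finally show "(\<Sum>T\<in>D s S. ?q ^ card T) \<le> real (s\<^sup>2 choose \<tau> s) * ?q ^ \<tau> s" .
    qed
    also have "\<dots> = real (card (A s)) * (real (s\<^sup>2 choose \<tau> s) * ?q ^ \<tau> s)" by simp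
    also have "card (A s) = (2 * N0) choose s" unfolding A_def by (subst n_subsets) auto
    also have "real ((2 * N0) choose s) * (real (s\<^sup>2 choose \<tau> s) * ?q ^ \<tau> s) \<le> (1 / 4) ^ s"
      using s by (intro union_bound_term_le[OF k n _ _ \<eta> N0 M]) (auto simp: \<tau>_def)
    finally show "(\<Sum>S\<in>A s. \<Sum>T\<in>D s S. ?q ^ card T) \<le> (1 / 4) ^ s" .
  qed
  also have "\<dots> < 1" by (rule sum_quarter_powers_less_1)
  finally have sum: "(\<Sum>i\<in>I. ?q ^ card (snd (snd i))) < 1" .
  obtain E where E: "E \<subseteq> ?P" "card E = M" and avoid: "\<And>i. i \<in> I \<Longrightarrow> \<not> snd (snd i) \<subseteq> E"
  proof (rule exists_subset_avoiding[of ?P M I "\<lambda>i. snd (snd i)"])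
    show "snd (snd i) \<subseteq> ?P" if "i \<in> I" for i
      using that indP unfolding I_def D_def by force
  qed (use finite_bipartite_pairs M_le fin sum in \<open>auto simp: card_bipartite_pairs\<close>)
  have "card (induced E S) < \<eta> * card S" if S: "S \<subseteq> {..<2 * N0}" "S \<noteq> {}" "card S \<le> 2 * n" for S
  proof (rule ccontr)
    assume "\<not> ?thesis"
    then have "\<tau> (card S) \<le> card (induced E S)" unfolding \<tau>_def by linarith
    then obtain T where T: "T \<subseteq> induced E S" "card T = \<tau> (card S)" by (metis obtain_subset_with_card_n)
    have finS: "finite S" using S(1) finite_subset by blast
    have "T \<subseteq> induced ?P S" using T(1) E(1) unfolding induced_def by auto
    then have "(card S, S, T) \<in> I"
      using S T finS unfolding I_def A_def D_def by (auto simp: card_gt_0_iff Suc_le_eq)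
    moreover have "T \<subseteq> E" using T(1) unfolding induced_def by auto
    ultimately show False using avoid by force
  qed
  then show ?thesis using that E by blast
qed

text \<open>Integer form of \<open>2^16 * m * (21/20)^m < 2^m\<close>. The base case
  \<open>m = 25\<close> is a computation, and the step needs only
  \<open>21 * (m + 1) <= 40 * m\<close>.\<close>

lemma exponential_dominates:
  assumes "m \<ge> 25"
  shows "2 ^ 16 * m * 21 ^ m < (40::nat) ^ m"
  using assms
proof (induction m rule: dec_induct)
  case (step m)
  have "2 ^ 16 * Suc m * 21 ^ Suc m = (Suc m * 21) * (2 ^ 16 * 21 ^ m)" by simp
  also have "\<dots> \<le> (m * 40) * (2 ^ 16 * 21 ^ m)" using step by (intro mult_right_mono) auto
  also have "\<dots> = 40 * (2 ^ 16 * m * 21 ^ m)" by simp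
  also have "\<dots> < 40 * 40 ^ m" using step by simp
  finally show ?case by simp
qed simp

text \<open>This margin keeps the search from doubling through \<open>n / 2\<close> levels. With
  \<open>n = 2 m\<close> the hypothesis gives
  \<open>k <= exp (m / 50) <= (21 / 20)^m\<close>.\<close>

lemma host_smaller_than_half_exponential:
  assumes k: "k \<ge> 2" and n: "even n" "real n \<ge> 100 * ln (real k)"
  shows "2 * (2 ^ 14 * k * n) < (2::nat) ^ (n div 2)"
proof -
  obtain m where m: "n = 2 * m" using n by (auto elim: evenE)
  have "real n \<ge> 50" using ln_ge_half[OF k] n by simp
  then have m25: "m \<ge> 25" using m by linarith
  have "real k = exp (ln (real k))" using k by simp
  also have "\<dots> \<le> exp (real m * (1 / 50))" using n m by simp
  also have "\<dots> = exp (1 / 50) ^ m" by (rule exp_of_nat_mult)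
  also have "\<dots> \<le> (21 / 20) ^ m"
  proof (rule power_mono)
    have "1 + (- 1 / 50) \<le> exp (- 1 / 50 :: real)" by (rule exp_ge_add_one_self)
    then show "exp (1 / 50 :: real) \<le> 21 / 20" by (simp add: exp_minus field_simps)
  qed auto
  finally have "real k * (2 ^ 16 * real m) \<le> (21 / 20) ^ m * (2 ^ 16 * real m)" by (intro mult_right_mono) auto
  also have "\<dots> < 2 ^ m"
  proof -
    have "real (2 ^ 16 * m * 21 ^ m) < real (40 ^ m)" using exponential_dominates[OF m25] of_nat_less_iff by blast
    moreover have "(40::real) ^ m = 2 ^ m * 20 ^ m" by (simp add: power_mult_distrib[symmetric])
    ultimately show ?thesis by (simp add: power_divide field_simps)
  qed
  finally have "real (k * (2 ^ 16 * m)) < real (2 ^ m)" by simp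
  then have "k * (2 ^ 16 * m) < 2 ^ m" using of_nat_less_iff by blast
  then show ?thesis using m by (simp add: mult_ac)
qed


lemma exists_small_ramsey_graph:
  assumes k: "k \<ge> 2" and n: "even n" "real n \<ge> 100 * ln (real k)"
  shows "\<exists>G :: nat ugraph. finite_simple_graph G \<and> ramsey_for k G (cycle_graph n) \<and>
    real (card (uedges G)) \<le> 3200 * 2 ^ 15 * (real k)\<^sup>2 * ln (real k) * real n"
proof -
  have lnk: "ln (real k) \<ge> 1 / 2" using k by (rule ln_ge_half)
  have n50: "real n \<ge> 50" using lnk n by simp
  then have npos: "n > 0" by simp
  define N0 where "N0 = 2 ^ 14 * k * n"
  define M where "M = nat \<lceil>160 * real k * real N0 * (20 * ln (real k))\<rceil>"
  \<comment> \<open>Recovering \<open>\<eta>\<close> from the rounded \<open>M\<close> makes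
    \<open>M = 160 * k * N0 * \<eta>\<close> exact. The densest colour then has at least
    \<open>160 * N0 * \<eta>\<close> edges, more than the \<open>72 * \<eta> * 2 * N0\<close> that
    force a cycle.\<close>
  define \<eta> where "\<eta> = real M / (160 * real k * real N0)"
  have N0pos: "real N0 > 0" and kpos: "real k > 0" unfolding N0_def using k npos by auto
  have base: "160 * real k * real N0 * (20 * ln (real k)) = 3200 * 2 ^ 14 * ((real k)\<^sup>2 * real n * ln (real k))"
    unfolding N0_def by (simp add: power2_eq_square)
  have X1: "(real k)\<^sup>2 * real n * ln (real k) \<ge> 1"
  proof -
    have "(real k)\<^sup>2 * real n * ln (real k) \<ge> 2\<^sup>2 * 50 * (1 / 2)"
      using k n50 lnk by (intro mult_mono power_mono) auto
    then show ?thesis by simp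
  qed
  have M_ge: "160 * real k * real N0 * (20 * ln (real k)) \<le> real M" unfolding M_def by linarith
  have M_le: "real M \<le> 3200 * 2 ^ 15 * ((real k)\<^sup>2 * real n * ln (real k))"
  proof -
    have "real M \<le> 160 * real k * real N0 * (20 * ln (real k)) + 1"
    proof -
      have "160 * real k * real N0 * (20 * ln (real k)) \<ge> 0"
        using kpos N0pos lnk by (intro mult_nonneg_nonneg) simp_all
      then show ?thesis unfolding M_def by linarith
    qed
    then have "real M \<le> 3200 * 2 ^ 14 * ((real k)\<^sup>2 * real n * ln (real k)) + 1" unfolding base .
    then show ?thesis using X1 by simp
  qed
  have M_eq: "real M = 160 * real k * real N0 * \<eta>" unfolding \<eta>_def using N0pos kpos by simp
  have \<eta>_ge: "\<eta> \<ge> 20 * ln (real k)"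
    unfolding \<eta>_def using M_ge N0pos kpos by (simp add: le_divide_eq mult_ac)
  have Mpos: "real M > 0"
  proof (rule less_le_trans[OF _ M_ge])
    have "ln (real k) > 0" using lnk by linarith
    then show "0 < 160 * real k * real N0 * (20 * ln (real k))"
      using kpos N0pos by (intro mult_pos_pos) simp_all
  qed
  \<comment> \<open>The complete bipartite graph has room for \<open>M\<close> edges because
    \<open>100 * ln k <= n\<close>.\<close>
  have "real M \<le> real (N0\<^sup>2)"
  proof -
    have "3200 * 2 ^ 15 * ((real k)\<^sup>2 * real n * ln (real k)) = 2 ^ 15 * 32 * ((real k)\<^sup>2 * real n) * (100 * ln (real k))"
      by simp
    also have "\<dots> \<le> 2 ^ 15 * 32 * ((real k)\<^sup>2 * real n) * real n"
      using n(2) by (intro mult_left_mono) auto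
    also have "\<dots> \<le> 2 ^ 28 * ((real k)\<^sup>2 * real n) * real n"
      by (intro mult_right_mono) auto
    also have "\<dots> = real (N0\<^sup>2)" unfolding N0_def by (simp add: power2_eq_square)
    finally show ?thesis using M_le by linarith
  qed
  then have M_le_sq: "M \<le> N0\<^sup>2" using of_nat_le_iff by blast
  obtain E where E: "E \<subseteq> bipartite_pairs N0" "card E = M"
    and sparse: "\<And>S. S \<subseteq> {..<2 * N0} \<Longrightarrow> S \<noteq> {} \<Longrightarrow> card S \<le> 2 * n \<Longrightarrow> card (induced E S) < \<eta> * card S"
    using exists_sparse_bipartite[OF k npos \<eta>_ge N0_def M_eq M_le_sq] by blast
  have finE: "finite E" using E(1) finite_bipartite_pairs finite_subset by blast
  define G where "G = ({..<2 * N0}, E)"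
  have sub: "\<And>e. e \<in> E \<Longrightarrow> e \<subseteq> {..<2 * N0}" and c2: "\<And>e. e \<in> E \<Longrightarrow> card e = 2"
    using bipartite_pairsD[of _ N0] subsetD[OF E(1)] by simp_all
  have "finite_simple_graph G" unfolding finite_simple_graph_def G_def using sub c2 by auto
  moreover have "ramsey_for k G (cycle_graph n)"
    unfolding ramsey_for_def
  proof (intro allI impI)
    fix \<chi> assume \<chi>: "edge_colouring k G \<chi>"
    define F where "F i = {e \<in> E. \<chi> e = i}" for i
    have "\<exists>i<k. real M \<le> real k * real (card (F i))"
    proof (rule ccontr)
      assume "\<not> ?thesis"
      then have lt: "real k * real (card (F i)) < real M" if "i < k" for i using that not_le by blast
      have "E = (\<Union>i<k. F i)" using \<chi> unfolding edge_colouring_def G_def F_def by auto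
      then have "M \<le> (\<Sum>i<k. card (F i))" using E(2) card_UN_le[of "{..<k}" F] by simp
      then have "real k * real M \<le> real k * real (\<Sum>i<k. card (F i))" by (intro mult_left_mono of_nat_mono) auto
      also have "\<dots> = (\<Sum>i<k. real k * real (card (F i)))" by (simp add: sum_distrib_left)
      also have "\<dots> < (\<Sum>i<k. real M)" 
      proof (rule sum_strict_mono)
        show "{..<k} \<noteq> {}" using k by (auto simp: lessThan_empty_iff)
      qed (use lt in auto)
      finally show False by simp
    qed
    then obtain i where i: "i < k" "real M \<le> real k * real (card (F i))" by blast
    have FE: "F i \<subseteq> E" unfolding F_def by auto
    have "has_cycle (F i) n"
    proof (rule sparse_bipartite_has_cycle[where V = "{..<2 * N0}" and P = "{..<N0}" and \<eta> = \<eta>])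
      show "simple_edges (F i)" unfolding simple_edges_def using FE c2 finE finite_subset by blast
      show "u \<in> {..<N0} \<longleftrightarrow> v \<notin> {..<N0}" if "{u, v} \<in> F i" for u v
      proof -
        have "{u, v} \<in> bipartite_pairs N0" using that FE E(1) by auto
        then show ?thesis unfolding bipartite_pairs_def by (auto simp: doubleton_eq_iff)
      qed
      show "card {..<2 * N0} < 2 ^ (n div 2)"
        using host_smaller_than_half_exponential[OF k n] unfolding N0_def by simp
      show "card (induced (F i) S) < \<eta> * card S" if "S \<subseteq> {..<2 * N0}" "S \<noteq> {}" "card S \<le> 2 * n" for S
      proof -
        have "induced (F i) S \<subseteq> induced E S" using FE unfolding induced_def by auto
        moreover have "finite (induced E S)" using finE unfolding induced_def by simp
        ultimately have "card (induced (F i) S) \<le> card (induced E S)" using card_mono by blast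
        then show ?thesis using sparse[OF that] by linarith
      qed
      show "72 * \<eta> * card {..<2 * N0} < card (F i)"
      proof -
        have "72 * \<eta> * real (2 * N0) * real k = 9 / 10 * real M" unfolding M_eq by simp
        also have "\<dots> < real M" using Mpos by simp
        also have "\<dots> \<le> real (card (F i)) * real k" using i(2) by (simp add: mult.commute)
        finally show ?thesis using kpos by simp
      qed
      show "e \<subseteq> {..<2 * N0}" if "e \<in> F i" for e using that FE sub by blast
      show "n \<ge> 2" using n50 by simp
      show "\<eta> \<ge> 1 / 2" using \<eta>_ge lnk by simp
    qed (use n in simp_all)
    moreover have "\<forall>e\<in>F i. e \<subseteq> {..<2 * N0}" using sub FE by blast
    ultimately have "contains_copy (colour_class G \<chi> i) (cycle_graph n)"
      using contains_copy_cycle_graph_iff[of "F i" "{..<2 * N0}" n] npos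
      unfolding colour_class_def G_def F_def by simp
    then show "\<exists>i<k. contains_copy (colour_class G \<chi> i) (cycle_graph n)" using i by blast
  qed
  moreover have "real (card (uedges G)) \<le> 3200 * 2 ^ 15 * (real k)\<^sup>2 * ln (real k) * real n"
    using M_le E(2) unfolding G_def by (simp add: mult_ac)
  ultimately show ?thesis by blast
qed

section \<open>Lower bound: subgraphs without long even cycles from vertex labels\<close>

section \<open>Star decompositions\<close>

text \<open>A cycle of length \<open>n\<close> in \<open>F\<close> keeps one label and visits \<open>P\<close> in every second step,
  so it would need \<open>n / 2\<close> vertices of \<open>P\<close> with the same label.\<close>

lemma star_decomposition_no_cycle:
  assumes n: "even n" "n \<ge> 2"
    and F: "\<And>e. e \<in> F \<Longrightarrow> \<exists>x y. e = {x, y} \<and> x \<in> P \<and> y \<notin> P \<and> lab x = lab y \<and>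
       finite {z \<in> P. lab z = lab x} \<and> 2 * card {z \<in> P. lab z = lab x} < n"
  shows "\<not> has_cycle F n"
proof
  assume "has_cycle F n"
  then obtain c where inj: "inj_on c {..<n}" and c: "\<And>i. i < n \<Longrightarrow> {c i, c (Suc i mod n)} \<in> F"
    unfolding has_cycle_def by blast
  have edge: "(c i \<in> P \<longleftrightarrow> c (Suc i mod n) \<notin> P) \<and> lab (c i) = lab (c (Suc i mod n)) \<and>
      finite {z \<in> P. lab z = lab (c i)} \<and> 2 * card {z \<in> P. lab z = lab (c i)} < n" if i: "i < n" for i
    using F[OF c[OF i]] by (auto simp: doubleton_eq_iff)
  have lab0: "i < n \<Longrightarrow> lab (c i) = lab (c 0)" for i
  proof (induction i)
    case (Suc i)
    then show ?case using edge[of i] by simp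
  qed simp
  have side: "i < n \<Longrightarrow> c i \<in> P \<longleftrightarrow> (even i \<longleftrightarrow> c 0 \<in> P)" for i
  proof (induction i)
    case (Suc i)
    then show ?case using edge[of i] by auto
  qed simp
  obtain m where m: "n = 2 * m" using n by (auto elim: evenE)
  define r :: nat where "r = (if c 0 \<in> P then 0 else 1)"
  let ?I = "(\<lambda>j. 2 * j + r) ` {..<m}"
  have I: "?I \<subseteq> {..<n}" unfolding m r_def by auto
  have "inj_on c ?I" using inj I inj_on_subset by blast
  then have "card (c ` ?I) = card ?I" by (rule card_image)
  also have "\<dots> = m" by (subst card_image) (auto simp: inj_on_def)
  finally have "card (c ` ?I) = m" .
  moreover have "c ` ?I \<subseteq> {z \<in> P. lab z = lab (c 0)}"
  proof
    fix z assume "z \<in> c ` ?I"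
    then obtain j where j: "j < m" "z = c (2 * j + r)" by auto
    then have "2 * j + r < n" using m unfolding r_def by auto
    moreover have "even (2 * j + r) \<longleftrightarrow> c 0 \<in> P" unfolding r_def by auto
    ultimately show "z \<in> {z \<in> P. lab z = lab (c 0)}"
      using j lab0[of "2 * j + r"] side[of "2 * j + r"] by simp
  qed
  moreover have "finite {z \<in> P. lab z = lab (c 0)}" "2 * card {z \<in> P. lab z = lab (c 0)} < n"
    using edge[of 0] n by auto
  ultimately have "m \<le> card {z \<in> P. lab z = lab (c 0)}" using card_mono by metis
  then show False using \<open>2 * card {z \<in> P. lab z = lab (c 0)} < n\<close> m by simp
qed

text \<open>Edges to overfull labels are discarded instead of requiring a balanced labelling, since
  a random labelling is controlled only one label at a time. Different centres \<open>y\<close>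
  contribute disjoint edge sets, hence the sum.\<close>

lemma exists_star_decomposition:
  fixes f g :: "'a \<Rightarrow> nat"
  assumes E: "simple_edges E" and W: "finite W" and n: "even n" "n \<ge> 2" and L: "2 * L < n"
  obtains F where "F \<subseteq> E" "\<not> has_cycle F n"
    "card F = (\<Sum>y\<in>W - P. card {x \<in> nbrs E (W \<inter> P) y. f x = g y \<and> card {z \<in> W \<inter> P. f z = f x} \<le> L})"
proof -
  define N where "N y = {x \<in> nbrs E (W \<inter> P) y. f x = g y \<and> card {z \<in> W \<inter> P. f z = f x} \<le> L}" for y
  define F where "F = (\<lambda>(y, x). {x, y}) ` (SIGMA y:W - P. N y)"
  have NP: "x \<in> W \<inter> P" "{x, y} \<in> E" "f x = g y" "card {z \<in> W \<inter> P. f z = f x} \<le> L" if "x \<in> N y" for x y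
    using that unfolding N_def nbrs_def by auto
  have finN: "finite (N y)" for y using finite_nbrs[of "W \<inter> P" E y] W unfolding N_def by auto
  have "inj_on (\<lambda>(y, x). {x, y}) (SIGMA y:W - P. N y)"
    by (rule inj_onI) (use NP(1) in \<open>auto simp: doubleton_eq_iff\<close>)
  then have "card F = card (SIGMA y:W - P. N y)" unfolding F_def by (rule card_image)
  also have "\<dots> = (\<Sum>y\<in>W - P. card (N y))" using W finN by (intro card_SigmaI) auto
  finally have "card F = (\<Sum>y\<in>W - P. card (N y))" .
  moreover have "F \<subseteq> E" unfolding F_def using NP by auto
  moreover have "\<not> has_cycle F n"
  proof (rule star_decomposition_no_cycle[OF n, where P = "W \<inter> P" and lab = "\<lambda>v. if v \<in> P then f v else g v"])
    fix e assume "e \<in> F"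
    then obtain x y where xy: "e = {x, y}" "x \<in> N y" "y \<in> W - P" unfolding F_def by auto
    have "{z \<in> W \<inter> P. (if z \<in> P then f z else g z) = f x} = {z \<in> W \<inter> P. f z = f x}" by auto
    then show "\<exists>x y. e = {x, y} \<and> x \<in> W \<inter> P \<and> y \<notin> W \<inter> P \<and>
        (if x \<in> P then f x else g x) = (if y \<in> P then f y else g y) \<and>
        finite {z \<in> W \<inter> P. (if z \<in> P then f z else g z) = (if x \<in> P then f x else g x)} \<and>
        2 * card {z \<in> W \<inter> P. (if z \<in> P then f z else g z) = (if x \<in> P then f x else g x)} < n"
      using xy NP[OF xy(2)] W L by (intro exI[of _ x] exI[of _ y]) simp
  qed
  ultimately show ?thesis using that unfolding N_def by blast
qed

text \<open>Greedy cut: each new vertex goes to the side opposite to the majority of its earlier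
  neighbours.\<close>

lemma exists_bipartition:
  assumes E: "simple_edges E" and V: "finite V"
  shows "\<exists>P. card (induced E V) \<le> 2 * card {e \<in> induced E V. card (e \<inter> P) = 1}"
  using V
proof (induction V rule: finite_induct)
  case empty
  have "induced E {} = {}" using E unfolding simple_edges_def induced_def by auto
  then show ?case by simp
next
  case (insert v V)
  then obtain P where P: "card (induced E V) \<le> 2 * card {e \<in> induced E V. card (e \<inter> P) = 1}" by blast
  define N1 where "N1 = {u \<in> nbrs E V v. u \<in> P}"
  define N2 where "N2 = {u \<in> nbrs E V v. u \<notin> P}"
  define b where "b \<longleftrightarrow> card N1 \<ge> card N2"
  define P' where "P' = (if b then P - {v} else insert v P)"
  define N where "N = (if b then N1 else N2)"
  have loop: "{v, v} \<notin> E" using E unfolding simple_edges_def by fastforce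
  have nb: "nbrs E (insert v V) v = nbrs E V v" unfolding nbrs_def using loop by auto
  have "nbrs E V v = N1 \<union> N2" "N1 \<inter> N2 = {}" unfolding N1_def N2_def by auto
  moreover have fin: "finite N1" "finite N2" using finite_nbrs[OF insert(1)] unfolding N1_def N2_def by auto
  ultimately have "card (nbrs E V v) = card N1 + card N2" by (simp add: card_Un_disjoint)
  then have cN: "card (nbrs E V v) \<le> 2 * card N" unfolding N_def b_def by auto
  have finI: "finite (induced E S)" for S using E unfolding simple_edges_def induced_def by auto
  have "insert v V - {v} = V" using insert by auto
  then have tot: "card (induced E (insert v V)) = card (induced E V) + card (nbrs E V v)"
    using card_induced_remove[OF E, of v "insert v V"] nb by simp
  let ?A = "{e \<in> induced E V. card (e \<inter> P) = 1}" and ?B = "(\<lambda>u. {u, v}) ` N"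
  let ?C = "{e \<in> induced E (insert v V). card (e \<inter> P') = 1}"
  have "?A \<subseteq> ?C"
  proof
    fix e assume e: "e \<in> ?A"
    then have "e \<inter> P' = e \<inter> P" using insert(2) unfolding P'_def induced_def by auto
    then show "e \<in> ?C" using e unfolding induced_def by auto
  qed
  moreover have "?B \<subseteq> ?C"
  proof
    fix e assume "e \<in> ?B"
    then obtain u where u: "u \<in> N" "e = {u, v}" by auto
    then have uu: "u \<in> V" "{u, v} \<in> E" "u \<noteq> v" "u \<in> P \<longleftrightarrow> b"
      using loop unfolding N_def N1_def N2_def nbrs_def by (auto split: if_splits)
    have "e \<inter> P' = (if b then {u} else {v})" using u uu unfolding P'_def by auto
    then show "e \<in> ?C" using u uu unfolding induced_def by auto
  qed
  moreover have "?A \<inter> ?B = {}" using insert(2) unfolding induced_def by auto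
  moreover have "finite ?A" "finite ?B" "finite ?C" using finI fin unfolding N_def by auto
  ultimately have "card ?A + card ?B \<le> card ?C"
    using card_mono[of ?C "?A \<union> ?B"] card_Un_disjoint[of ?A ?B] by simp
  moreover have "card ?B = card N" by (rule card_image) (auto simp: inj_on_def doubleton_eq_iff)
  ultimately have "card ?A + card N \<le> card ?C" by simp
  then have "card (induced E (insert v V)) \<le> 2 * card ?C" using tot P cN by simp
  then show ?case by blast
qed

lemma exists_popular_label:
  fixes f :: "'a \<Rightarrow> nat"
  assumes "finite N" "\<And>x. x \<in> N \<Longrightarrow> f x < q" "q > 0"
  shows "\<exists>i. card N \<le> q * card {x \<in> N. f x = i}"
proof (rule ccontr)
  assume "\<not> ?thesis"
  then have lt: "q * card {x \<in> N. f x = i} < card N" for i using not_le by blast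
  have "card N = (\<Sum>i<q. card {x \<in> N. f x = i})"
  proof -
    have "N = (\<Union>i<q. {x \<in> N. f x = i})" using assms(2) by auto
    then have "card N = card (\<Union>i<q. {x \<in> N. f x = i})" by simp
    also have "\<dots> = (\<Sum>i<q. card {x \<in> N. f x = i})" using assms(1) by (intro card_UN_disjoint) auto
    finally show ?thesis .
  qed
  then have "q * card N = (\<Sum>i<q. q * card {x \<in> N. f x = i})" by (simp add: sum_distrib_left)
  also have "\<dots> < (\<Sum>i<q. card N)" using lt assms(3) by (intro sum_strict_mono) auto
  finally show False by simp
qed

text \<open>Enumerate \<open>X\<close> and cut the enumeration into blocks of length
  \<open>L\<close>.\<close>

lemma exists_balanced_labelling:
  assumes "finite X" "L > 0"
  obtains f :: "'a \<Rightarrow> nat" where "\<And>x. x \<in> X \<Longrightarrow> f x < card X div L + 1"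
    "\<And>i. card {x \<in> X. f x = i} \<le> L"
proof -
  obtain h where h: "bij_betw h X {0..<card X}" using ex_bij_betw_finite_nat[OF assms(1)] by blast
  have hX: "h x < card X" if "x \<in> X" for x using h that unfolding bij_betw_def by auto
  have "card {x \<in> X. h x div L = i} \<le> L" for i
  proof -
    have "inj_on h {x \<in> X. h x div L = i}" using h unfolding bij_betw_def by (auto intro: inj_on_subset)
    moreover have "h ` {x \<in> X. h x div L = i} \<subseteq> {i * L..<i * L + L}"
    proof
      fix y assume "y \<in> h ` {x \<in> X. h x div L = i}"
      then have "i * L + y mod L = y" using div_mult_mod_eq[of y L] by auto
      moreover have "y mod L < L" using assms(2) by simp
      ultimately show "y \<in> {i * L..<i * L + L}" unfolding atLeastLessThan_iff by linarith
    qed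
    ultimately show ?thesis using card_inj_on_le[of h _ "{i * L..<i * L + L}"] by simp
  qed
  moreover have "h x div L < card X div L + 1" if "x \<in> X" for x
    using div_le_mono[of "h x" "card X" L] hX[OF that] by simp
  ultimately show ?thesis using that[of "\<lambda>x. h x div L"] by blast
qed

lemma card_induced_bipartite_le:
  assumes E: "simple_edges E" and W: "finite W" and bip: "\<And>u v. {u, v} \<in> E \<Longrightarrow> u \<in> P \<longleftrightarrow> v \<notin> P"
  shows "card (induced E W) \<le> (\<Sum>y\<in>W - P. card (nbrs E (W \<inter> P) y))"
proof -
  let ?S = "\<Union>y\<in>W - P. (\<lambda>x. {x, y}) ` nbrs E (W \<inter> P) y"
  have fin: "finite (nbrs E (W \<inter> P) y)" for y using W by (intro finite_nbrs) auto
  have "induced E W \<subseteq> ?S"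
  proof
    fix e assume e: "e \<in> induced E W"
    then have "card e = 2" "e \<in> E" "e \<subseteq> W" using E unfolding simple_edges_def induced_def by auto
    then obtain u v where uv: "e = {u, v}" by (auto simp: card_2_iff)
    show "e \<in> ?S"
    proof (cases "u \<in> P")
      case True
      then have "v \<in> W - P" "u \<in> nbrs E (W \<inter> P) v"
        using bip[of u v] \<open>e \<in> E\<close> \<open>e \<subseteq> W\<close> uv unfolding nbrs_def by auto
      then show ?thesis using uv by blast
    next
      case False
      then have "u \<in> W - P" "v \<in> nbrs E (W \<inter> P) u"
        using bip[of u v] \<open>e \<in> E\<close> \<open>e \<subseteq> W\<close> uv unfolding nbrs_def by (auto simp: insert_commute)
      then show ?thesis using uv by (auto simp: insert_commute)
    qed
  qed
  then have "card (induced E W) \<le> card ?S" using W fin by (intro card_mono) auto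
  also have "\<dots> \<le> (\<Sum>y\<in>W - P. card ((\<lambda>x. {x, y}) ` nbrs E (W \<inter> P) y))" using W by (intro card_UN_le) auto
  also have "\<dots> \<le> (\<Sum>y\<in>W - P. card (nbrs E (W \<inter> P) y))" by (intro sum_mono card_image_le fin)
  finally show ?thesis .
qed

section \<open>Lower bound: first and second moments of the labels common to disjoint groups\<close>

section \<open>Common labels under random labellings\<close>

text \<open>Independence of a uniform labelling on disjoint sets. Probabilities are kept
  unnormalised, as sums over all labellings.\<close>

lemma sum_PiE_disjoint_union:
  fixes u v :: "('a \<Rightarrow> 'b) \<Rightarrow> real"
  assumes "A \<inter> C = {}"
  shows "(\<Sum>f\<in>(A \<union> C) \<rightarrow>\<^sub>E T. u (restrict f A) * v (restrict f C)) = (\<Sum>f\<in>A \<rightarrow>\<^sub>E T. u f) * (\<Sum>f\<in>C \<rightarrow>\<^sub>E T. v f)"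
proof -
  have "(\<Sum>f\<in>A \<rightarrow>\<^sub>E T. u f) * (\<Sum>f\<in>C \<rightarrow>\<^sub>E T. v f) = (\<Sum>(f, g)\<in>(A \<rightarrow>\<^sub>E T) \<times> (C \<rightarrow>\<^sub>E T). u f * v g)"
    by (simp add: sum_product sum.cartesian_product)
  also have "\<dots> = (\<Sum>f\<in>(A \<union> C) \<rightarrow>\<^sub>E T. u (restrict f A) * v (restrict f C))"
  proof (rule sum.reindex_bij_witness[where i = "\<lambda>f. (restrict f A, restrict f C)"
        and j = "\<lambda>(f, g). (\<lambda>x. if x \<in> A then f x else g x)"], goal_cases)
    case (1 p)
    then show ?case using assms by (auto simp: fun_eq_iff restrict_def PiE_iff extensional_def)
  next
    case (2 p)
    then show ?case using assms by (auto simp: PiE_iff extensional_def)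
  next
    case (3 f)
    then show ?case using assms by (auto simp: fun_eq_iff PiE_iff extensional_def)
  next
    case (4 f)
    then show ?case by (auto simp: PiE_iff)
  next
    case (5 p)
    obtain f g where p: "p = (f, g)" "f \<in> A \<rightarrow>\<^sub>E T" "g \<in> C \<rightarrow>\<^sub>E T" using 5 by auto
    have "restrict (\<lambda>x. if x \<in> A then f x else g x) A = f" "restrict (\<lambda>x. if x \<in> A then f x else g x) C = g"
      using p(2,3) assms by (auto simp: fun_eq_iff restrict_def PiE_iff extensional_def)
    then show ?case using p(1) by simp
  qed
  finally show ?thesis by simp
qed

text \<open>\<open>R\<close> collects the elements outside all groups. In the applications
  \<open>v\<close> is constant or follows the label of one element of \<open>R\<close>.\<close>

lemma sum_PiE_groups:
  fixes u :: "nat \<Rightarrow> ('a \<Rightarrow> 'b) \<Rightarrow> real" and v :: "('a \<Rightarrow> 'b) \<Rightarrow> real"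
  assumes "disjoint_family_on A {..<B}" "\<And>a. a < B \<Longrightarrow> A a \<inter> R = {}"
  shows "(\<Sum>f\<in>((\<Union>a<B. A a) \<union> R) \<rightarrow>\<^sub>E T. (\<Prod>a<B. u a (restrict f (A a))) * v (restrict f R))
    = (\<Prod>a<B. \<Sum>f\<in>A a \<rightarrow>\<^sub>E T. u a f) * (\<Sum>f\<in>R \<rightarrow>\<^sub>E T. v f)"
  using assms
proof (induction B)
  case 0
  have "(\<Sum>f\<in>R \<rightarrow>\<^sub>E T. v (restrict f R)) = (\<Sum>f\<in>R \<rightarrow>\<^sub>E T. v f)" by (rule sum.cong) auto
  then show ?case by simp
next
  case (Suc B)
  let ?C = "(\<Union>a<B. A a) \<union> R"
  have "A B \<inter> A a = {}" if "a < B" for a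
    using Suc.prems(1) that unfolding disjoint_family_on_def by simp
  then have disj: "A B \<inter> ?C = {}" using Suc.prems(2)[of B] by auto
  have un: "(\<Union>a<Suc B. A a) \<union> R = A B \<union> ?C" by (auto simp: less_Suc_eq)
  have "(\<Sum>f\<in>((\<Union>a<Suc B. A a) \<union> R) \<rightarrow>\<^sub>E T. (\<Prod>a<Suc B. u a (restrict f (A a))) * v (restrict f R))
    = (\<Sum>f\<in>(A B \<union> ?C) \<rightarrow>\<^sub>E T. u B (restrict f (A B)) *
        ((\<Prod>a<B. u a (restrict (restrict f ?C) (A a))) * v (restrict (restrict f ?C) R)))"
    unfolding un
  proof (rule sum.cong[OF refl])
    fix f
    have "?C \<inter> A a = A a" if "a < B" for a using that by auto
    then have "(\<Prod>a<B. u a (restrict (restrict f ?C) (A a))) = (\<Prod>a<B. u a (restrict f (A a)))"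
      by (intro prod.cong) auto
    moreover have "?C \<inter> R = R" by auto
    ultimately show "(\<Prod>a<Suc B. u a (restrict f (A a))) * v (restrict f R) = u B (restrict f (A B)) *
        ((\<Prod>a<B. u a (restrict (restrict f ?C) (A a))) * v (restrict (restrict f ?C) R))"
      by (simp add: mult_ac)
  qed
  also have "\<dots> = (\<Sum>f\<in>A B \<rightarrow>\<^sub>E T. u B f) *
      (\<Sum>f\<in>?C \<rightarrow>\<^sub>E T. (\<Prod>a<B. u a (restrict f (A a))) * v (restrict f R))"
    by (rule sum_PiE_disjoint_union[OF disj])
  also have "(\<Sum>f\<in>?C \<rightarrow>\<^sub>E T. (\<Prod>a<B. u a (restrict f (A a))) * v (restrict f R))
      = (\<Prod>a<B. \<Sum>f\<in>A a \<rightarrow>\<^sub>E T. u a f) * (\<Sum>f\<in>R \<rightarrow>\<^sub>E T. v f)"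
  proof (rule Suc.IH)
    show "disjoint_family_on A {..<B}"
      using Suc.prems(1) by (rule disjoint_family_on_mono[rotated]) auto
  qed (use Suc.prems(2) in auto)
  finally show ?case by (simp add: mult_ac)
qed

text \<open>By inclusion-exclusion, meeting one or two given labels reduces to avoiding
  \<open>J\<close> for \<open>J\<close> among \<open>{}\<close>, \<open>{i}\<close>,
  \<open>{j}\<close> and \<open>{i, j}\<close>.\<close>

lemma sum_PiE_avoid:
  assumes "finite A" "finite T" "J \<subseteq> T"
  shows "(\<Sum>f\<in>A \<rightarrow>\<^sub>E T. of_bool (\<forall>x\<in>A. f x \<notin> J)) = (real (card T) - real (card J)) ^ card A"
proof -
  have "(A \<rightarrow>\<^sub>E T) \<inter> {f. \<forall>x\<in>A. f x \<notin> J} = A \<rightarrow>\<^sub>E (T - J)" by (auto simp: PiE_iff)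
  moreover have "finite (A \<rightarrow>\<^sub>E T)" using assms by (intro finite_PiE) auto
  ultimately have "(\<Sum>f\<in>A \<rightarrow>\<^sub>E T. of_bool (\<forall>x\<in>A. f x \<notin> J)) = real (card (A \<rightarrow>\<^sub>E (T - J)))"
    by (simp add: sum_of_bool_eq)
  also have "\<dots> = real (card (T - J)) ^ card A" using assms by (simp add: card_funcsetE)
  also have "real (card (T - J)) = real (card T) - real (card J)"
    using assms by (simp add: card_Diff_subset finite_subset card_mono of_nat_diff)
  finally show ?thesis .
qed

lemma sum_PiE_hit:
  assumes "finite A" "i < t"
  shows "(\<Sum>f\<in>A \<rightarrow>\<^sub>E {..<t}. of_bool (\<exists>x\<in>A. f x = i)) = real t ^ card A - (real t - 1) ^ card A"
proof -
  have "(\<Sum>f\<in>A \<rightarrow>\<^sub>E {..<t}. of_bool (\<exists>x\<in>A. f x = i)) =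
      (\<Sum>f\<in>A \<rightarrow>\<^sub>E {..<t}. of_bool (\<forall>x\<in>A. f x \<notin> {}) - of_bool (\<forall>x\<in>A. f x \<notin> {i}) :: real)"
    by (rule sum.cong) auto
  then show ?thesis using assms
    by (simp only: sum_subtractf) (subst (1 2) sum_PiE_avoid; simp)
qed

text \<open>Negative correlation, multiplied out to avoid division. After expanding, it reduces to
  \<open>(t - 2) * t <= (t - 1)^2\<close>, raised to the power \<open>card A\<close>.\<close>

lemma sum_PiE_hit_two:
  assumes "finite A" "i < t" "j < t" "i \<noteq> j"
  shows "(\<Sum>f\<in>A \<rightarrow>\<^sub>E {..<t}. of_bool (\<exists>x\<in>A. f x = i) * of_bool (\<exists>x\<in>A. f x = j)) * real t ^ card A
    \<le> (real t ^ card A - (real t - 1) ^ card A)\<^sup>2"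
proof -
  define S :: real where "S = (\<Sum>f\<in>A \<rightarrow>\<^sub>E {..<t}. of_bool (\<exists>x\<in>A. f x = i) * of_bool (\<exists>x\<in>A. f x = j))"
  have "S = (\<Sum>f\<in>A \<rightarrow>\<^sub>E {..<t}. of_bool (\<forall>x\<in>A. f x \<notin> {}) - of_bool (\<forall>x\<in>A. f x \<notin> {i})
        - of_bool (\<forall>x\<in>A. f x \<notin> {j}) + of_bool (\<forall>x\<in>A. f x \<notin> {i, j}) :: real)"
    unfolding S_def by (rule sum.cong) auto
  also have "\<dots> = real t ^ card A - 2 * (real t - 1) ^ card A + (real t - 2) ^ card A"
    using assms by (simp only: sum_subtractf sum.distrib) (subst (1 2 3 4) sum_PiE_avoid; simp)
  finally have S: "S = real t ^ card A - 2 * (real t - 1) ^ card A + (real t - 2) ^ card A" .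
  have "s * a = a\<^sup>2 - 2 * b * a + c * a" if "s = a - 2 * b + c" for s a b c :: real
    unfolding that by (simp add: algebra_simps power2_eq_square)
  from this[OF S] have "S * real t ^ card A
    = (real t ^ card A)\<^sup>2 - 2 * (real t - 1) ^ card A * real t ^ card A + (real t - 2) ^ card A * real t ^ card A" .
  moreover have "(real t - 2) ^ card A * real t ^ card A \<le> ((real t - 1) ^ card A)\<^sup>2"
  proof -
    have "t \<ge> 2" using assms by linarith
    then have "((real t - 2) * real t) ^ card A \<le> ((real t - 1)\<^sup>2) ^ card A"
      by (intro power_mono) (auto simp: power2_eq_square algebra_simps)
    then show ?thesis by (simp add: power_mult_distrib power_mult[symmetric] mult.commute)
  qed
  ultimately show ?thesis unfolding S_def[symmetric] by (simp add: power2_eq_square algebra_simps)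
qed

lemma sum_PiE_point:
  assumes "finite A" "x \<in> A" "i < t"
  shows "real t * (\<Sum>f\<in>A \<rightarrow>\<^sub>E {..<t}. of_bool (f x = i)) = real t ^ card A"
proof -
  have "(A \<rightarrow>\<^sub>E {..<t}) \<inter> {f. f x = i} = PiE A (\<lambda>y. if y = x then {i} else {..<t})"
    using assms by (auto simp: PiE_iff split: if_splits)
  moreover have "finite (A \<rightarrow>\<^sub>E {..<t})" using assms by (intro finite_PiE) auto
  ultimately have "(\<Sum>f\<in>A \<rightarrow>\<^sub>E {..<t}. of_bool (f x = i)) = real (card (PiE A (\<lambda>y. if y = x then {i} else {..<t})))"
    by (simp add: sum_of_bool_eq)
  also have "card (PiE A (\<lambda>y. if y = x then {i} else {..<t})) = (\<Prod>y\<in>A. if y = x then 1 else t)"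
    using assms by (subst card_PiE) (auto intro!: prod.cong)
  also have "\<dots> = t ^ card (A - {x})"
    using assms by (subst prod.remove[of _ x]) auto
  finally have "real t * (\<Sum>f\<in>A \<rightarrow>\<^sub>E {..<t}. of_bool (f x = i)) = real t ^ Suc (card (A - {x}))" by simp
  then show ?thesis using card_Suc_Diff1[OF assms(1,2)] by simp
qed

text \<open>With \<open>z = g / t <= 1\<close>, a group of \<open>g\<close> elements misses a label
  with probability at most \<open>exp (-z) <= 1 / (1 + z) <= 1 - z / 2\<close>.\<close>

lemma hit_count_ge:
  assumes "1 \<le> g" "g \<le> t"
  shows "real g / (2 * real t) * real t ^ g \<le> real t ^ g - (real t - 1) ^ g"
proof -
  have t: "real t > 0" using assms by simp
  define z where "z = real g / real t"
  have z: "0 \<le> z" "z \<le> 1" unfolding z_def using assms by auto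
  have "(1 - 1 / real t) ^ g \<le> exp (- 1 / real t) ^ g"
    using exp_ge_add_one_self[of "- 1 / real t"] assms t by (intro power_mono) auto
  also have "\<dots> = exp (- z)" unfolding z_def by (simp add: exp_of_nat_mult[symmetric])
  also have "\<dots> \<le> 1 / (1 + z)"
    using exp_ge_add_one_self[of z] z by (simp add: exp_minus field_simps)
  also have "\<dots> \<le> 1 - z / 2"
  proof -
    have "z * z \<le> 1 * z" using z by (intro mult_right_mono) auto
    then have "1 \<le> (1 - z / 2) * (1 + z)" by (simp add: algebra_simps)
    then show ?thesis using z by (simp add: divide_le_eq)
  qed
  finally have "(1 - 1 / real t) ^ g * real t ^ g \<le> (1 - z / 2) * real t ^ g"
    by (intro mult_right_mono) auto
  moreover have "(1 - 1 / real t) ^ g * real t ^ g = (real t - 1) ^ g"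
    using t by (simp add: power_mult_distrib[symmetric] algebra_simps)
  ultimately show ?thesis unfolding z_def using t by (simp add: field_simps)
qed


text \<open>Second moment: for distinct labels \<open>i\<close>, \<open>j\<close> the events that all groups contain label \<open>i\<close>,
  respectively \<open>j\<close>, are negatively correlated.\<close>

lemma common_label_fraction:
  fixes A :: "nat \<Rightarrow> 'a set" and L :: real
  assumes X: "finite X" and A: "\<And>a. a < B \<Longrightarrow> A a \<subseteq> X" "\<And>a. a < B \<Longrightarrow> card (A a) = g"
    and disj: "disjoint_family_on A {..<B}" and g: "1 \<le> g" "g \<le> t"
    and L: "4 * real (card X) \<le> real t * L" "8 * real B \<le> L" "0 < L"
    and many: "1 \<le> real t * (real g / (2 * real t)) ^ B"
  shows "real (card (X \<rightarrow>\<^sub>E {..<t})) \<le> 8 * real (card {f \<in> X \<rightarrow>\<^sub>E {..<t}. \<exists>i<t.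
      (\<forall>a<B. \<exists>x\<in>A a. f x = i) \<and> real (card {x \<in> X. f x = i}) \<le> L})"
proof -
  define R where "R = X - (\<Union>a<B. A a)"
  have XR: "X = (\<Union>a<B. A a) \<union> R" unfolding R_def using A by auto
  have disjR: "A a \<inter> R = {}" if "a < B" for a unfolding R_def using that by auto
  have finR: "finite R" unfolding R_def using X by simp
  have finA: "finite (A a)" if "a < B" for a using A(1)[OF that] X finite_subset by blast
  let ?\<Omega> = "X \<rightarrow>\<^sub>E {..<t}"
  have fin\<Omega>: "finite ?\<Omega>" using X by (intro finite_PiE) auto
  have t: "real t > 0" using g by simp
  define H where "H = real t ^ g - (real t - 1) ^ g"
  have H_ge: "real g / (2 * real t) * real t ^ g \<le> H" unfolding H_def by (rule hit_count_ge[OF g])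
  have gpos: "real g / (2 * real t) > 0" using g t by simp
  have Hpos: "H > 0" using H_ge gpos t by (meson less_le_trans mult_pos_pos zero_less_power)
  define hit :: "nat \<Rightarrow> nat \<Rightarrow> ('a \<Rightarrow> nat) \<Rightarrow> real" where "hit i a f = of_bool (\<exists>x\<in>A a. f x = i)" for i a f
  define ev :: "nat \<Rightarrow> ('a \<Rightarrow> nat) \<Rightarrow> real" where "ev i f = of_bool (\<forall>a<B. \<exists>x\<in>A a. f x = i)" for i f
  have hit_restrict: "hit i a (restrict f (A a)) = hit i a f" for i a f unfolding hit_def by simp
  have ev_prod: "ev i f = (\<Prod>a<B. hit i a (restrict f (A a)))" for i f
    unfolding hit_restrict unfolding ev_def hit_def by (induction B) (auto simp: less_Suc_eq)
  have sum_hit: "(\<Sum>f\<in>A a \<rightarrow>\<^sub>E {..<t}. hit i a f) = H" if "a < B" "i < t" for i a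
    unfolding hit_def H_def using sum_PiE_hit[OF finA[OF that(1)] that(2)] A(2)[OF that(1)] by simp
  have sum_one: "(\<Sum>f\<in>R \<rightarrow>\<^sub>E {..<t}. (1::real)) = real t ^ card R" using finR by (simp add: card_funcsetE)
  have card\<Omega>: "real (card ?\<Omega>) = (real t ^ g) ^ B * real t ^ card R"
  proof -
    have "(\<Sum>f\<in>?\<Omega>. (1::real)) = (\<Prod>a<B. \<Sum>f\<in>A a \<rightarrow>\<^sub>E {..<t}. 1) * (\<Sum>f\<in>R \<rightarrow>\<^sub>E {..<t}. 1)"
      using sum_PiE_groups[OF disj disjR, where u = "\<lambda>_ _. 1" and v = "\<lambda>_. 1" and T = "{..<t}"] XR by simp
    also have "(\<Prod>a<B. \<Sum>f\<in>A a \<rightarrow>\<^sub>E {..<t}. (1::real)) = (\<Prod>a<B. real t ^ g)"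
      by (rule prod.cong) (use finA A(2) in \<open>auto simp: card_funcsetE\<close>)
    finally show ?thesis using sum_one by simp
  qed
  define p where "p = (H / real t ^ g) ^ B"
  have ppos: "p > 0" unfolding p_def using Hpos t by simp
  have HB: "H ^ B * real t ^ card R = p * real (card ?\<Omega>)"
    unfolding p_def card\<Omega> using t by (simp add: power_divide)
  have sum_ev: "(\<Sum>f\<in>?\<Omega>. ev i f) = p * real (card ?\<Omega>)" if i: "i < t" for i
  proof -
    have "(\<Sum>f\<in>?\<Omega>. ev i f) = (\<Prod>a<B. \<Sum>f\<in>A a \<rightarrow>\<^sub>E {..<t}. hit i a f) * (\<Sum>f\<in>R \<rightarrow>\<^sub>E {..<t}. 1)"
      using sum_PiE_groups[OF disj disjR, where u = "hit i" and v = "\<lambda>_. 1" and T = "{..<t}"] XR ev_prod by simp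
    also have "(\<Prod>a<B. \<Sum>f\<in>A a \<rightarrow>\<^sub>E {..<t}. hit i a f) = (\<Prod>a<B. H)"
      by (rule prod.cong) (use sum_hit i in auto)
    finally show ?thesis using sum_one HB by simp
  qed
  have sum_ev2: "(\<Sum>f\<in>?\<Omega>. ev i f * ev j f) \<le> p\<^sup>2 * real (card ?\<Omega>)" if ij: "i < t" "j < t" "i \<noteq> j" for i j
  proof -
    define J where "J a = (\<Sum>f\<in>A a \<rightarrow>\<^sub>E {..<t}. hit i a f * hit j a f)" for a
    have "(\<Sum>f\<in>?\<Omega>. ev i f * ev j f) = (\<Prod>a<B. J a) * (\<Sum>f\<in>R \<rightarrow>\<^sub>E {..<t}. 1)"
      using sum_PiE_groups[OF disj disjR, where u = "\<lambda>a f. hit i a f * hit j a f" and v = "\<lambda>_. 1" and T = "{..<t}"]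
        XR ev_prod unfolding J_def by (simp add: prod.distrib)
    also have "\<dots> = (\<Prod>a<B. J a) * real t ^ card R" by (simp only: sum_one)
    also have "\<dots> \<le> (\<Prod>a<B. H\<^sup>2 / real t ^ g) * real t ^ card R"
    proof (intro mult_right_mono prod_mono conjI)
      fix a assume a: "a \<in> {..<B}"
      show "0 \<le> J a" unfolding J_def hit_def by (intro sum_nonneg) auto
      have "J a * real t ^ g \<le> H\<^sup>2"
        using sum_PiE_hit_two[OF finA ij, of a] a A(2)[of a] unfolding J_def hit_def H_def by simp
      then show "J a \<le> H\<^sup>2 / real t ^ g" using t by (simp add: le_divide_eq)
    qed simp
    also have "\<dots> = p\<^sup>2 * real (card ?\<Omega>)"
    proof -
      have "H\<^sup>2 / real t ^ g = (H / real t ^ g)\<^sup>2 * real t ^ g" using t by (simp add: power2_eq_square)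
      then have "(H\<^sup>2 / real t ^ g) ^ B = p\<^sup>2 * (real t ^ g) ^ B"
        unfolding p_def by (simp only: power_mult_distrib power_mult[symmetric] mult.commute)
      then show ?thesis unfolding card\<Omega> by simp
    qed
    finally show ?thesis .
  qed
  define sz where "sz i f = real (card {x \<in> X. f x = i})" for i and f :: "'a \<Rightarrow> nat"
  have sz_sum: "sz i f = (\<Sum>x\<in>X. of_bool (f x = i))" for i f
    unfolding sz_def using X by (simp add: sum_of_bool_eq Int_def conj_commute)
  have point: "(\<Sum>f\<in>?\<Omega>. ev i f * of_bool (f x = i)) \<le> p * real (card ?\<Omega>) / real t" if i: "i < t" and x: "x \<in> R" for i x
  proof -
    have "(\<Sum>f\<in>?\<Omega>. ev i f * of_bool (f x = i)) =
        (\<Prod>a<B. \<Sum>f\<in>A a \<rightarrow>\<^sub>E {..<t}. hit i a f) * (\<Sum>f\<in>R \<rightarrow>\<^sub>E {..<t}. of_bool (f x = i))"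
      using sum_PiE_groups[OF disj disjR, where u = "hit i" and v = "\<lambda>f. of_bool (f x = i)" and T = "{..<t}"]
        XR ev_prod x by simp
    also have "(\<Prod>a<B. \<Sum>f\<in>A a \<rightarrow>\<^sub>E {..<t}. hit i a f) = (\<Prod>a<B. H)"
      by (rule prod.cong) (use sum_hit i in auto)
    also have "(\<Prod>a<B. H) * (\<Sum>f\<in>R \<rightarrow>\<^sub>E {..<t}. of_bool (f x = i)) = H ^ B * (real t ^ card R / real t)"
      using sum_PiE_point[OF finR x i] t by (simp add: field_simps)
    finally show ?thesis using HB by simp
  qed
  \<comment> \<open>Inside group \<open>b\<close> the condition \<open>f x = i\<close> already
    implies the hit of that group. It therefore replaces one factor \<open>H\<close> by
    \<open>t^g / t\<close>, which is at most \<open>2 / g * H\<close> by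
    \<open>H_ge\<close>.\<close>
  have point_A: "(\<Sum>f\<in>?\<Omega>. ev i f * of_bool (f x = i)) \<le> 2 / real g * (p * real (card ?\<Omega>))"
    if i: "i < t" and b: "b < B" and x: "x \<in> A b" for i x b
  proof -
    define u where "u a f = (if a = b then of_bool (f x = i) else hit i a f)" for a f
    have ev_u: "ev i f * of_bool (f x = i) = (\<Prod>a<B. u a (restrict f (A a)))" for f
    proof -
      have "(\<Prod>a<B. u a (restrict f (A a))) = u b (restrict f (A b)) * (\<Prod>a\<in>{..<B} - {b}. u a (restrict f (A a)))"
        using b by (intro prod.remove) auto
      also have "(\<Prod>a\<in>{..<B} - {b}. u a (restrict f (A a))) = (\<Prod>a\<in>{..<B} - {b}. hit i a (restrict f (A a)))"
        by (rule prod.cong) (auto simp: u_def)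
      also have "u b (restrict f (A b)) = of_bool (f x = i) * hit i b (restrict f (A b))"
        using x unfolding u_def hit_restrict by (auto simp: hit_def)
      also have "of_bool (f x = i) * hit i b (restrict f (A b)) * (\<Prod>a\<in>{..<B} - {b}. hit i a (restrict f (A a)))
          = of_bool (f x = i) * (\<Prod>a<B. hit i a (restrict f (A a)))"
        using b prod.remove[of "{..<B}" b "\<lambda>a. hit i a (restrict f (A a))"] by simp
      finally show ?thesis unfolding ev_prod by (simp only: mult.commute[of _ "of_bool (f x = i)"])
    qed
    have "(\<Sum>f\<in>?\<Omega>. ev i f * of_bool (f x = i)) = (\<Prod>a<B. \<Sum>f\<in>A a \<rightarrow>\<^sub>E {..<t}. u a f) * (\<Sum>f\<in>R \<rightarrow>\<^sub>E {..<t}. 1)"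
      using sum_PiE_groups[OF disj disjR, where u = u and v = "\<lambda>_. 1" and T = "{..<t}"] XR ev_u by simp
    also have "(\<Prod>a<B. \<Sum>f\<in>A a \<rightarrow>\<^sub>E {..<t}. u a f) \<le> (\<Prod>a<B. if a = b then 2 / real g * H else H)"
    proof (intro prod_mono conjI)
      fix a assume a: "a \<in> {..<B}"
      show "0 \<le> (\<Sum>f\<in>A a \<rightarrow>\<^sub>E {..<t}. u a f)" unfolding u_def hit_def by (intro sum_nonneg) auto
      show "(\<Sum>f\<in>A a \<rightarrow>\<^sub>E {..<t}. u a f) \<le> (if a = b then 2 / real g * H else H)"
      proof (cases "a = b")
        case True
        have "real t * (\<Sum>f\<in>A b \<rightarrow>\<^sub>E {..<t}. of_bool (f x = i)) = real t ^ g"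
          using sum_PiE_point[OF finA[OF b] x i] A(2)[OF b] by simp
        then have "(\<Sum>f\<in>A b \<rightarrow>\<^sub>E {..<t}. of_bool (f x = i)) = real t ^ g / real t" using t by (simp add: field_simps)
        also have "\<dots> \<le> 2 / real g * H" using H_ge g t by (simp add: field_simps)
        finally show ?thesis using True unfolding u_def by simp
      next
        case False
        then show ?thesis using sum_hit[of a i] a i unfolding u_def by simp
      qed
    qed
    also have "(\<Prod>a<B. if a = b then 2 / real g * H else H) = 2 / real g * H ^ B"
    proof -
      have "(\<Prod>a<B. if a = b then 2 / real g * H else H) = 2 / real g * H * (\<Prod>a\<in>{..<B} - {b}. H)"
        using b by (subst prod.remove[of _ b]) auto
      also have "\<dots> = 2 / real g * H ^ Suc (card ({..<B} - {b}))" by simp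
      also have "Suc (card ({..<B} - {b})) = B" using b card_Suc_Diff1[of "{..<B}" b] by simp
      finally show ?thesis .
    qed
    finally show ?thesis using sum_one HB by (simp add: mult_right_mono mult.assoc)
  qed
  \<comment> \<open>Conditioned on all groups meeting \<open>i\<close>, the expected size of its
    class is at most \<open>L / 2\<close>: the \<open>B * g\<close> group elements contribute
    \<open>2 * B <= L / 4\<close>, the others \<open>card R / t <= L / 4\<close>.\<close>
  have moment: "(\<Sum>f\<in>?\<Omega>. ev i f * sz i f) \<le> p * real (card ?\<Omega>) * (L / 2)" if i: "i < t" for i
  proof -
    have nn: "0 \<le> p * real (card ?\<Omega>)" using ppos by simp
    have "(\<Sum>f\<in>?\<Omega>. ev i f * sz i f) = (\<Sum>x\<in>X. \<Sum>f\<in>?\<Omega>. ev i f * of_bool (f x = i))"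
      unfolding sz_sum sum_distrib_left by (rule sum.swap)
    also have "\<dots> = (\<Sum>x\<in>(\<Union>a<B. A a). \<Sum>f\<in>?\<Omega>. ev i f * of_bool (f x = i)) + (\<Sum>x\<in>R. \<Sum>f\<in>?\<Omega>. ev i f * of_bool (f x = i))"
      by (subst XR, rule sum.union_disjoint) (use finA finR disjR in auto)
    also have "(\<Sum>x\<in>(\<Union>a<B. A a). \<Sum>f\<in>?\<Omega>. ev i f * of_bool (f x = i)) \<le> (\<Sum>x\<in>(\<Union>a<B. A a). 2 / real g * (p * real (card ?\<Omega>)))"
      by (intro sum_mono) (use point_A[OF i] in auto)
    also have "\<dots> = real (card (\<Union>a<B. A a)) * (2 / real g * (p * real (card ?\<Omega>)))" by simp
    also have "card (\<Union>a<B. A a) = B * g"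
    proof -
      have "card (\<Union>a<B. A a) = (\<Sum>a<B. card (A a))"
        using disj finA by (intro card_UN_disjoint) (auto simp: disjoint_family_on_def)
      then show ?thesis using A(2) by simp
    qed
    also have "real (B * g) * (2 / real g * (p * real (card ?\<Omega>))) = p * real (card ?\<Omega>) * (2 * real B)" using g by simp
    also have "(\<Sum>x\<in>R. \<Sum>f\<in>?\<Omega>. ev i f * of_bool (f x = i)) \<le> (\<Sum>x\<in>R. p * real (card ?\<Omega>) / real t)"
      by (intro sum_mono point[OF i])
    also have "\<dots> = p * real (card ?\<Omega>) * (real (card R) / real t)" by simp
    also have "p * real (card ?\<Omega>) * (2 * real B) + p * real (card ?\<Omega>) * (real (card R) / real t)
        = p * real (card ?\<Omega>) * (2 * real B + real (card R) / real t)" by (simp only: distrib_left)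
    also have "\<dots> \<le> p * real (card ?\<Omega>) * (L / 2)"
    proof (rule mult_left_mono[OF _ nn])
      have "card R \<le> card X" unfolding R_def using X by (intro card_mono) auto
      then have "4 * real (card R) \<le> real t * L" using L(1) by linarith
      then have "real (card R) / real t \<le> L / 4" using t by (simp add: field_simps)
      then show "2 * real B + real (card R) / real t \<le> L / 2" using L(2) by linarith
    qed
    finally show ?thesis by simp
  qed
  define ok where "ok i f = ev i f * of_bool (sz i f \<le> L)" for i f
  have sum_ok: "(\<Sum>f\<in>?\<Omega>. ok i f) \<ge> p * real (card ?\<Omega>) / 2" if i: "i < t" for i
  proof -
    \<comment> \<open>Markov's inequality in pointwise form: at most half of the event is lost to
      label classes larger than \<open>L\<close>.\<close>
    have "ev i f - ev i f * sz i f / L \<le> ok i f" for f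
    proof (cases "sz i f \<le> L")
      case True
      have "0 \<le> ev i f * sz i f / L" using L(3) unfolding ev_def sz_def by simp
      then show ?thesis using True unfolding ok_def by simp
    next
      case False
      then have "1 \<le> sz i f / L" using L(3) by (simp add: le_divide_eq)
      then have "ev i f * 1 \<le> ev i f * (sz i f / L)" by (intro mult_left_mono) (auto simp: ev_def)
      then show ?thesis using False unfolding ok_def by simp
    qed
    then have "(\<Sum>f\<in>?\<Omega>. ev i f - ev i f * sz i f / L) \<le> (\<Sum>f\<in>?\<Omega>. ok i f)" by (intro sum_mono)
    moreover have "(\<Sum>f\<in>?\<Omega>. ev i f - ev i f * sz i f / L) = (\<Sum>f\<in>?\<Omega>. ev i f) - (\<Sum>f\<in>?\<Omega>. ev i f * sz i f) / L"
      by (simp add: sum_subtractf sum_divide_distrib)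
    moreover have "(\<Sum>f\<in>?\<Omega>. ev i f * sz i f) / L \<le> p * real (card ?\<Omega>) / 2"
      using moment[OF i] L(3) by (simp add: divide_le_eq mult.commute mult.left_commute)
    ultimately show ?thesis using sum_ev[OF i] by linarith
  qed
  define Z where "Z f = (\<Sum>i<t. ok i f)" for f
  define Gd where "Gd = {f \<in> ?\<Omega>. \<exists>i<t. (\<forall>a<B. \<exists>x\<in>A a. f x = i) \<and> real (card {x \<in> X. f x = i}) \<le> L}"
  have ok_nonneg: "ok i f \<ge> 0" and ok_le: "ok i f \<le> ev i f" and ok_le1: "ok i f \<le> 1" for i f
    unfolding ok_def ev_def by auto
  have Z0: "Z f = 0" if "f \<in> ?\<Omega> - Gd" for f
    unfolding Z_def using that unfolding Gd_def ok_def ev_def sz_def by (intro sum.neutral) auto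
  have GdS: "Gd \<subseteq> ?\<Omega>" unfolding Gd_def by auto
  define c where "c = real (card ?\<Omega>)"
  \<comment> \<open>The expected number of labels met by all groups; \<open>many\<close> makes it at
    least 1, so in the second moment the diagonal \<open>m * c\<close> is dominated by
    \<open>m^2 * c\<close>.\<close>
  define m where "m = real t * p"
  have cpos: "c > 0" unfolding c_def card\<Omega> using t by simp
  have m1: "m \<ge> 1"
  proof -
    have "real g / (2 * real t) \<le> H / real t ^ g" using H_ge t by (simp add: le_divide_eq)
    then have "(real g / (2 * real t)) ^ B \<le> p" unfolding p_def using gpos by (intro power_mono) auto
    then have "real t * (real g / (2 * real t)) ^ B \<le> m" unfolding m_def using t by (intro mult_left_mono) auto
    then show ?thesis using many by simp
  qed
  have "m * c / 2 = (\<Sum>i<t. p * c / 2)" unfolding m_def by simp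
  also have "\<dots> \<le> (\<Sum>i<t. \<Sum>f\<in>?\<Omega>. ok i f)" unfolding c_def by (intro sum_mono sum_ok) auto
  also have "\<dots> = (\<Sum>f\<in>?\<Omega>. Z f)" unfolding Z_def by (rule sum.swap)
  also have "\<dots> = (\<Sum>f\<in>Gd. Z f)"
    by (rule sum.mono_neutral_right) (use fin\<Omega> GdS Z0 in auto)
  finally have first: "m * c / 2 \<le> (\<Sum>f\<in>Gd. Z f)" .
  have "(\<Sum>f\<in>?\<Omega>. (Z f)\<^sup>2) = (\<Sum>i<t. \<Sum>j<t. \<Sum>f\<in>?\<Omega>. ok i f * ok j f)"
  proof -
    have "(\<Sum>f\<in>?\<Omega>. (Z f)\<^sup>2) = (\<Sum>f\<in>?\<Omega>. \<Sum>i<t. \<Sum>j<t. ok i f * ok j f)"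
      unfolding Z_def power2_eq_square sum_product ..
    also have "\<dots> = (\<Sum>i<t. \<Sum>f\<in>?\<Omega>. \<Sum>j<t. ok i f * ok j f)" by (rule sum.swap)
    also have "\<dots> = (\<Sum>i<t. \<Sum>j<t. \<Sum>f\<in>?\<Omega>. ok i f * ok j f)" by (intro sum.cong refl sum.swap)
    finally show ?thesis .
  qed
  also have "\<dots> \<le> (\<Sum>i<t. \<Sum>j<t. (if j = i then p * c else 0) + p\<^sup>2 * c)"
  proof (intro sum_mono)
    fix i j assume ij: "i \<in> {..<t}" "j \<in> {..<t}"
    show "(\<Sum>f\<in>?\<Omega>. ok i f * ok j f) \<le> (if j = i then p * c else 0) + p\<^sup>2 * c"
    proof (cases "j = i")
      case True
      have "(\<Sum>f\<in>?\<Omega>. ok i f * ok j f) \<le> (\<Sum>f\<in>?\<Omega>. ev i f * 1)"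
        using True by (intro sum_mono mult_mono ok_le ok_le1 ok_nonneg) (auto simp: ev_def)
      also have "\<dots> = p * c" using sum_ev ij unfolding c_def by simp
      finally show ?thesis using True cpos by (simp add: add_increasing2)
    next
      case False
      have "(\<Sum>f\<in>?\<Omega>. ok i f * ok j f) \<le> (\<Sum>f\<in>?\<Omega>. ev i f * ev j f)"
        by (intro sum_mono mult_mono ok_le ok_nonneg) (auto simp: ev_def)
      then show ?thesis using sum_ev2[of i j] ij False unfolding c_def by simp
    qed
  qed
  also have "\<dots> = (\<Sum>i<t. p * c + real t * (p\<^sup>2 * c))"
    by (intro sum.cong) (auto simp: sum.distrib sum.delta)
  also have "\<dots> = m * c + m\<^sup>2 * c" unfolding m_def by (simp add: power2_eq_square algebra_simps)
  also have "\<dots> \<le> 2 * m\<^sup>2 * c"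
  proof -
    have "m * 1 \<le> m * m" using m1 by (intro mult_left_mono) auto
    then have "m * c \<le> m\<^sup>2 * c" using cpos by (intro mult_right_mono) (auto simp: power2_eq_square)
    then show ?thesis by linarith
  qed
  finally have second: "(\<Sum>f\<in>?\<Omega>. (Z f)\<^sup>2) \<le> 2 * m\<^sup>2 * c" .
  \<comment> \<open>Cauchy-Schwarz on the support \<open>Gd\<close> of \<open>Z\<close>;
    \<open>(m * c / 2)^2 <= 2 * m^2 * c * card Gd\<close> gives the constant 8.\<close>
  have "(m * c / 2)\<^sup>2 \<le> (\<Sum>f\<in>Gd. Z f)\<^sup>2" using first m1 cpos by (intro power_mono) auto
  also have "\<dots> \<le> (\<Sum>f\<in>Gd. (Z f)\<^sup>2) * real (card Gd)" by (rule sum_squared_le_sum_of_squares)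
  also have "\<dots> \<le> (\<Sum>f\<in>?\<Omega>. (Z f)\<^sup>2) * real (card Gd)"
    using fin\<Omega> GdS by (intro mult_right_mono sum_mono2) auto
  also have "\<dots> \<le> 2 * m\<^sup>2 * c * real (card Gd)" using second by (intro mult_right_mono) auto
  finally have "m\<^sup>2 * c * c \<le> m\<^sup>2 * c * (8 * real (card Gd))" by (simp add: power2_eq_square field_simps)
  moreover have "m\<^sup>2 * c > 0" using m1 cpos by simp
  ultimately have "c \<le> 8 * real (card Gd)" by (simp only: mult_le_cancel_left_pos)
  then show ?thesis unfolding c_def Gd_def .
qed


text \<open>A label met by each of \<open>B\<close> disjoint blocks of \<open>g\<close> neighbours
  occurs at least \<open>B\<close> times. The blocks make these hits independent and replace a
  binomial tail by a plain power. Averaging over labellings then finds one that serves an eighth of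
  \<open>Y\<close> simultaneously.\<close>

lemma exists_labelling_capturing:
  fixes N :: "'b \<Rightarrow> 'a set" and L :: real
  assumes X: "finite X" and Y: "finite Y" and N: "\<And>y. y \<in> Y \<Longrightarrow> N y \<subseteq> X" "\<And>y. y \<in> Y \<Longrightarrow> B * g \<le> card (N y)"
    and g: "1 \<le> g" "g \<le> t"
    and L: "4 * real (card X) \<le> real t * L" "8 * real B \<le> L" "0 < L"
    and many: "1 \<le> real t * (real g / (2 * real t)) ^ B"
  shows "\<exists>f :: 'a \<Rightarrow> nat. card Y \<le> 8 * card {y \<in> Y. \<exists>i. B \<le> card {x \<in> N y. f x = i} \<and> real (card {x \<in> X. f x = i}) \<le> L}"
proof (rule ccontr)
  let ?\<Omega> = "X \<rightarrow>\<^sub>E {..<t}"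
  let ?good = "\<lambda>y f. \<exists>i. B \<le> card {x \<in> N y. f x = i} \<and> real (card {x \<in> X. f x = i}) \<le> L"
  assume "\<not> ?thesis"
  then have lt: "8 * card {y \<in> Y. ?good y f} < card Y" for f :: "'a \<Rightarrow> nat" using not_le by blast
  have fin\<Omega>: "finite ?\<Omega>" using X by (intro finite_PiE) auto
  have "card ?\<Omega> = t ^ card X" using X by (simp add: card_funcsetE)
  then have ne: "?\<Omega> \<noteq> {}" using g by auto
  have good: "real (card ?\<Omega>) \<le> 8 * real (card {f \<in> ?\<Omega>. ?good y f})" if y: "y \<in> Y" for y
  proof -
    obtain M where M: "M \<subseteq> N y" "card M = B * g" "finite M"
      using N(2)[OF y] by (meson obtain_subset_with_card_n)
    obtain h where h: "bij_betw h {0..<B * g} M" using ex_bij_betw_nat_finite[OF M(3)] M(2) by auto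
    define A where "A a = h ` {a * g..<a * g + g}" for a
    have sub: "{a * g..<a * g + g} \<subseteq> {0..<B * g}" if "a < B" for a
    proof -
      have "(a + 1) * g \<le> B * g" using that by (intro mult_right_mono) auto
      then show ?thesis by auto
    qed
    have inj: "inj_on h {0..<B * g}" using h unfolding bij_betw_def by simp
    have AM: "A a \<subseteq> M" if "a < B" for a
      using sub[OF that] h unfolding A_def bij_betw_def by blast
    have cA: "card (A a) = g" if "a < B" for a
      unfolding A_def using inj_on_subset[OF inj sub[OF that]] by (simp add: card_image)
    have disj_int: "{a * g..<a * g + g} \<inter> {b * g..<b * g + g} = {}" if "a < b" for a b
    proof -
      have "(a + 1) * g \<le> b * g" using that by (intro mult_right_mono) auto
      then show ?thesis by auto
    qed
    have disj: "disjoint_family_on A {..<B}"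
      unfolding disjoint_family_on_def
    proof (intro ballI impI)
      fix a b assume ab: "a \<in> {..<B}" "b \<in> {..<B}" "a \<noteq> b"
      then have "{a * g..<a * g + g} \<inter> {b * g..<b * g + g} = {}"
        using disj_int[of a b] disj_int[of b a] by (metis Int_commute linorder_neqE_nat)
      then show "A a \<inter> A b = {}"
        unfolding A_def using inj_on_image_Int[OF inj sub sub, of a b] ab by auto
    qed
    have "real (card ?\<Omega>) \<le> 8 * real (card {f \<in> ?\<Omega>. \<exists>i<t. (\<forall>a<B. \<exists>x\<in>A a. f x = i) \<and> real (card {x \<in> X. f x = i}) \<le> L})"
      using AM M(1) N(1)[OF y] cA by (intro common_label_fraction[OF X _ _ disj g L many]) auto
    also have "\<dots> \<le> 8 * real (card {f \<in> ?\<Omega>. ?good y f})"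
    proof -
      have "{f \<in> ?\<Omega>. \<exists>i<t. (\<forall>a<B. \<exists>x\<in>A a. f x = i) \<and> real (card {x \<in> X. f x = i}) \<le> L} \<subseteq> {f \<in> ?\<Omega>. ?good y f}"
      proof
        fix f assume "f \<in> {f \<in> ?\<Omega>. \<exists>i<t. (\<forall>a<B. \<exists>x\<in>A a. f x = i) \<and> real (card {x \<in> X. f x = i}) \<le> L}"
        then obtain i where f: "f \<in> ?\<Omega>" and i: "\<forall>a<B. \<exists>x\<in>A a. f x = i" "real (card {x \<in> X. f x = i}) \<le> L" by blast
        from i(1) obtain w where w: "\<And>a. a < B \<Longrightarrow> w a \<in> A a \<and> f (w a) = i" by metis
        have "inj_on w {..<B}"
        proof (rule inj_onI)
          fix a b assume ab: "a \<in> {..<B}" "b \<in> {..<B}" "w a = w b"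
          then have "w a \<in> A a \<inter> A b" using w[of a] w[of b] by auto
          then show "a = b" using disj ab unfolding disjoint_family_on_def by blast
        qed
        moreover have "w ` {..<B} \<subseteq> {x \<in> N y. f x = i}" using w AM M(1) by fastforce
        moreover have "finite {x \<in> N y. f x = i}" using N(1)[OF y] by (intro finite_subset[OF _ X]) auto
        ultimately have "card {..<B} \<le> card {x \<in> N y. f x = i}" by (rule card_inj_on_le)
        then show "f \<in> {f \<in> ?\<Omega>. ?good y f}" using f i(2) by auto
      qed
      then show ?thesis using fin\<Omega> by (simp add: card_mono)
    qed
    finally show ?thesis .
  qed
  have "real (card Y) * real (card ?\<Omega>) = (\<Sum>y\<in>Y. real (card ?\<Omega>))" by simp
  also have "\<dots> \<le> (\<Sum>y\<in>Y. 8 * real (card {f \<in> ?\<Omega>. ?good y f}))" by (intro sum_mono good)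
  also have "\<dots> = 8 * (\<Sum>y\<in>Y. \<Sum>f\<in>?\<Omega>. of_bool (?good y f))"
    using fin\<Omega> by (simp add: sum_distrib_left sum_of_bool_eq Int_def)
  also have "\<dots> = 8 * (\<Sum>f\<in>?\<Omega>. \<Sum>y\<in>Y. of_bool (?good y f))" by (subst sum.swap) simp
  also have "\<dots> = (\<Sum>f\<in>?\<Omega>. real (8 * card {y \<in> Y. ?good y f}))"
    using Y by (simp add: sum_distrib_left sum_of_bool_eq Int_def)
  also have "\<dots> < (\<Sum>f\<in>?\<Omega>. real (card Y))"
    using fin\<Omega> ne lt by (intro sum_strict_mono) (auto simp del: of_nat_mult)
  finally show False by simp
qed

section \<open>Lower bound: choice of parameters for one extraction\<close>

section \<open>Large cycle-free subgraphs\<close>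

text \<open>With a balanced labelling by \<open>q\<close> labels, each centre keeps its most
  frequent label and so at least a fraction \<open>1 / q\<close> of its edges.\<close>

lemma exists_cycle_free_dense:
  assumes E: "simple_edges E" and bip: "\<And>u v. {u, v} \<in> E \<Longrightarrow> u \<in> P \<longleftrightarrow> v \<notin> P"
    and W: "finite W" and n: "even n" "n \<ge> 2" and L: "2 * L < n" "L > 0"
  shows "\<exists>F\<subseteq>E. \<not> has_cycle F n \<and> card (induced E W) \<le> (card W div L + 1) * card F"
proof -
  let ?X = "W \<inter> P" and ?q = "card (W \<inter> P) div L + 1"
  obtain f :: "'a \<Rightarrow> nat" where f: "\<And>x. x \<in> ?X \<Longrightarrow> f x < ?q" "\<And>i. card {x \<in> ?X. f x = i} \<le> L"
    using exists_balanced_labelling[of ?X L] W L(2) by auto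
  have "\<exists>i. card (nbrs E ?X y) \<le> ?q * card {x \<in> nbrs E ?X y. f x = i}" for y
    by (rule exists_popular_label) (use W f(1) in \<open>auto simp: nbrs_def\<close>)
  then obtain g where g: "\<And>y. card (nbrs E ?X y) \<le> ?q * card {x \<in> nbrs E ?X y. f x = g y}"
    using choice[of "\<lambda>y i. card (nbrs E ?X y) \<le> ?q * card {x \<in> nbrs E ?X y. f x = i}"] by blast
  obtain F where F: "F \<subseteq> E" "\<not> has_cycle F n"
    "card F = (\<Sum>y\<in>W - P. card {x \<in> nbrs E ?X y. f x = g y \<and> card {z \<in> ?X. f z = f x} \<le> L})"
    using exists_star_decomposition[OF E W n L(1), of P f g] by blast
  have "card (induced E W) \<le> (\<Sum>y\<in>W - P. card (nbrs E ?X y))" by (rule card_induced_bipartite_le[OF E W bip])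
  also have "\<dots> \<le> (\<Sum>y\<in>W - P. ?q * card {x \<in> nbrs E ?X y. f x = g y})" by (intro sum_mono g)
  also have "\<dots> = ?q * card F" using f(2) F(3) by (simp add: sum_distrib_left)
  also have "\<dots> \<le> (card W div L + 1) * card F"
    using W by (intro mult_right_mono add_right_mono div_le_mono card_mono) auto
  finally show ?thesis using F by blast
qed

text \<open>With injective labels every vertex outside \<open>P\<close> keeps exactly one edge. This
  handles very sparse cores, where one edge per vertex is enough.\<close>

lemma exists_cycle_free_stars:
  assumes E: "simple_edges E" and W: "finite W" and n: "even n" "n > 2"
    and nb: "\<And>y. y \<in> W - P \<Longrightarrow> nbrs E (W \<inter> P) y \<noteq> {}"
  shows "\<exists>F\<subseteq>E. \<not> has_cycle F n \<and> card (W - P) \<le> card F"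
proof -
  obtain f :: "'a \<Rightarrow> nat" where "bij_betw f (W \<inter> P) {0..<card (W \<inter> P)}"
    using ex_bij_betw_finite_nat[of "W \<inter> P"] W by blast
  then have f: "inj_on f (W \<inter> P)" unfolding bij_betw_def by simp
  define g where "g y = f (SOME x. x \<in> nbrs E (W \<inter> P) y)" for y
  obtain F where F: "F \<subseteq> E" "\<not> has_cycle F n"
    "card F = (\<Sum>y\<in>W - P. card {x \<in> nbrs E (W \<inter> P) y. f x = g y \<and> card {z \<in> W \<inter> P. f z = f x} \<le> 1})"
    using exists_star_decomposition[OF E W, of n 1 P f g] n by auto
  have "1 \<le> card {x \<in> nbrs E (W \<inter> P) y. f x = g y \<and> card {z \<in> W \<inter> P. f z = f x} \<le> 1}" if y: "y \<in> W - P" for y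
  proof -
    define x where "x = (SOME x. x \<in> nbrs E (W \<inter> P) y)"
    have x: "x \<in> nbrs E (W \<inter> P) y" unfolding x_def using nb[OF y] by (simp add: some_in_eq)
    then have "{z \<in> W \<inter> P. f z = f x} = {x}" using f unfolding nbrs_def inj_on_def by auto
    then have "{x} \<subseteq> {x \<in> nbrs E (W \<inter> P) y. f x = g y \<and> card {z \<in> W \<inter> P. f z = f x} \<le> 1}"
      using x unfolding g_def x_def[symmetric] by simp
    moreover have "finite (nbrs E (W \<inter> P) y)" using W by (intro finite_nbrs) auto
    ultimately have "card {x} \<le> card {x \<in> nbrs E (W \<inter> P) y. f x = g y \<and> card {z \<in> W \<inter> P. f z = f x} \<le> 1}"
      by (intro card_mono) auto
    then show ?thesis by simp
  qed
  then have "(\<Sum>y\<in>W - P. 1) \<le> card F" unfolding F(3) by (intro sum_mono)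
  then have "card (W - P) \<le> card F" by simp
  then show ?thesis using F(1,2) by blast
qed

text \<open>Only the centres served by the random labelling are counted; all others may choose any
  label.\<close>

lemma exists_cycle_free_random:
  assumes E: "simple_edges E" and W: "finite W" and n: "even n" "n \<ge> 2" and L: "2 * L < n" "0 < L"
    and nb: "\<And>y. y \<in> W - P \<Longrightarrow> B * g \<le> card (nbrs E (W \<inter> P) y)"
    and g: "1 \<le> g" "g \<le> t" and t: "4 * card W \<le> t * L" and B: "8 * B \<le> L"
    and many: "1 \<le> real t * (real g / (2 * real t)) ^ B"
  shows "\<exists>F\<subseteq>E. \<not> has_cycle F n \<and> B * card (W - P) \<le> 8 * card F"
proof -
  let ?X = "W \<inter> P"
  have "card ?X \<le> card W" using W by (intro card_mono) auto
  then have "4 * card ?X \<le> t * L" using t by simp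
  then have tX: "4 * real (card ?X) \<le> real t * real L" by (metis of_nat_le_iff of_nat_mult of_nat_numeral)
  have BL: "8 * real B \<le> real L" using B by linarith
  obtain f :: "'a \<Rightarrow> nat" where f: "card (W - P) \<le> 8 * card {y \<in> W - P. \<exists>i. B \<le> card {x \<in> nbrs E ?X y. f x = i} \<and> real (card {x \<in> ?X. f x = i}) \<le> real L}"
    using exists_labelling_capturing[where X = ?X and Y = "W - P" and N = "nbrs E ?X" and L = "real L", OF _ _ _ nb g tX BL _ many]
      W L(2) by (auto simp: nbrs_def)
  define good where "good y \<longleftrightarrow> (\<exists>i. B \<le> card {x \<in> nbrs E ?X y. f x = i} \<and> card {x \<in> ?X. f x = i} \<le> L)" for y
  define h where "h y = (SOME i. B \<le> card {x \<in> nbrs E ?X y. f x = i} \<and> card {x \<in> ?X. f x = i} \<le> L)" for y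
  have h: "B \<le> card {x \<in> nbrs E ?X y. f x = h y}" "card {x \<in> ?X. f x = h y} \<le> L" if "good y" for y
    using someI_ex[OF that[unfolded good_def]] unfolding h_def by auto
  obtain F where F: "F \<subseteq> E" "\<not> has_cycle F n"
    "card F = (\<Sum>y\<in>W - P. card {x \<in> nbrs E ?X y. f x = h y \<and> card {z \<in> ?X. f z = f x} \<le> L})"
    using exists_star_decomposition[OF E W n L(1), of P f h] by blast
  have "B * card {y \<in> W - P. good y} = (\<Sum>y\<in>{y \<in> W - P. good y}. B)" by simp
  also have "\<dots> \<le> (\<Sum>y\<in>{y \<in> W - P. good y}. card {x \<in> nbrs E ?X y. f x = h y \<and> card {z \<in> ?X. f z = f x} \<le> L})"
  proof (rule sum_mono)
    fix y assume "y \<in> {y \<in> W - P. good y}"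
    then have y: "good y" by simp
    then have "{x \<in> nbrs E ?X y. f x = h y \<and> card {z \<in> ?X. f z = f x} \<le> L} = {x \<in> nbrs E ?X y. f x = h y}"
      using h(2)[OF y] by auto
    then show "B \<le> card {x \<in> nbrs E ?X y. f x = h y \<and> card {z \<in> ?X. f z = f x} \<le> L}" using h(1)[OF y] by simp
  qed
  also have "\<dots> \<le> card F" unfolding F(3) using W by (intro sum_mono2) auto
  finally have "B * card {y \<in> W - P. good y} \<le> card F" .
  moreover have "card (W - P) \<le> 8 * card {y \<in> W - P. good y}" using f unfolding good_def by simp
  then have "B * card (W - P) \<le> B * (8 * card {y \<in> W - P. good y})" by (intro mult_left_mono) auto
  moreover have "B * (8 * card {y \<in> W - P. good y}) = 8 * (B * card {y \<in> W - P. good y})" by simp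
  ultimately have "B * card (W - P) \<le> 8 * card F" by linarith
  then show ?thesis using F by blast
qed


text \<open>
  Here \<open>\<Lambda> = log k\<close>, \<open>\<kappa> = k\<^bsup>1/5\<^esup>\<close> and \<open>z = \<surd>(mn / \<Lambda>)\<close>, so that \<open>\<Lambda> z = \<surd>(mn \<Lambda>)\<close>. The weight
  \<open>K / max |W| N0\<close> with \<open>N0 \<approx> 2z\<close> separates two regimes: either \<open>|W| \<le> N0\<close> and \<open>W\<close> still spans
  half of the edges, so that any balanced labelling works, or \<open>|W| = N0 / x\<close> with \<open>x < 1\<close> and all
  degrees are at least of order \<open>x\<^sup>2 m / z\<close>, in which case random labels capture \<open>\<Lambda> x / 500\<close> edges
  at a positive proportion of the vertices of one side.
\<close>

lemma exists_cycle_free_bipartite: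
  fixes \<Lambda> \<kappa> z :: real
  assumes E: "simple_edges E" and bip: "\<And>u v. {u, v} \<in> E \<Longrightarrow> u \<in> P \<longleftrightarrow> v \<notin> P"
    and n: "even n" "n \<ge> 50" "100 * \<Lambda> \<le> real n" and \<Lambda>: "\<Lambda> > 0"
    and \<kappa>: "\<kappa> \<ge> 1" "\<kappa> \<ge> \<Lambda>" "\<kappa> = exp (\<Lambda> / 5)"
    and z: "z\<^sup>2 * \<Lambda> = real (card E) * real n" "real n * \<kappa> \<le> z"
  shows "\<exists>F\<subseteq>E. \<not> has_cycle F n \<and> \<Lambda> * z / 4000 \<le> real (card F)"
proof -
  define V where "V = \<Union>E"
  have finV: "finite V" unfolding V_def using E unfolding simple_edges_def
    by (intro finite_Union) (auto intro: card_ge_0_finite)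
  have indV: "induced E V = E" unfolding induced_def V_def by auto
  have npos: "real n > 0" using n by simp
  have "real n * 1 \<le> real n * \<kappa>" using \<kappa> by (intro mult_left_mono) auto
  then have zn: "z \<ge> real n" using z(2) by simp
  then have z50: "z \<ge> 50" using n by linarith
  define m where "m = real (card E)"
  have m: "m = z\<^sup>2 * \<Lambda> / real n" using z(1) npos unfolding m_def by (simp add: field_simps)
  have mpos: "m > 0" unfolding m using z50 \<Lambda> npos by simp
  define N0 where "N0 = nat \<lceil>2 * z\<rceil>"
  have N0: "2 * z \<le> real N0" "real N0 \<le> 3 * z" unfolding N0_def using z50 by linarith+
  have N0pos: "real N0 > 0" using N0 z50 by linarith
  \<comment> \<open>Then \<open>K / N0 = m / 2\<close>: a core with at most \<open>N0\<close>
    vertices has lost at most half of the edges.\<close>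
  define K where "K = m * real N0 / 2"
  have Kpos: "K > 0" unfolding K_def using mpos N0pos by simp
  \<comment> \<open>Above \<open>N0\<close> the increments are
    \<open>K / (N * (N - 1)) >= K / N^2\<close>, which becomes the minimum degree \<open>d\<close>.
    The cap at \<open>N0\<close> keeps the reward for small sets bounded.\<close>
  define \<phi> where "\<phi> N = - K / real (max N N0)" for N
  obtain W where WV: "W \<subseteq> V" and val: "card (induced E V) - \<phi> (card V) \<le> card (induced E W) - \<phi> (card W)"
    and deg: "\<And>v. v \<in> W \<Longrightarrow> \<phi> (card W) - \<phi> (card W - 1) \<le> card (nbrs E W v)"
    using exists_weighted_core[OF E finV, of \<phi>] by blast
  have finW: "finite W" using WV finV by (rule finite_subset)
  define N where "N = card W"
  \<comment> \<open>The largest class size with \<open>2 * L < n\<close>, as \<open>n\<close> is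
    even.\<close>
  define L where "L = n div 2 - 1"
  obtain h where h: "n = 2 * h" using n(1) by (auto elim: evenE)
  have L: "2 * L < n" "0 < L" and L3: "real n \<le> 3 * real L" and L2: "2 * real L \<le> real n"
    unfolding L_def h using n(2) h by auto
  have Lpos: "real L > 0" using L by simp
  have n2: "n \<ge> 2" using n by simp
  show ?thesis
  proof (cases "N \<le> N0")
    case True
    have "m + K / real (max (card V) N0) \<le> real (card (induced E W)) + K / real N0"
      using val True unfolding indV \<phi>_def m_def N_def[symmetric] by (simp add: max_absorb2)
    moreover have "K / real (max (card V) N0) \<ge> 0" using Kpos by simp
    moreover have "K / real N0 = m / 2" unfolding K_def using N0pos by simp
    ultimately have eW: "m / 2 \<le> real (card (induced E W))" by linarith
    obtain F where F: "F \<subseteq> E" "\<not> has_cycle F n" and cF: "card (induced E W) \<le> (card W div L + 1) * card F"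
      using exists_cycle_free_dense[OF E bip finW n(1) n2 L] by blast
    have q: "real (card W div L + 1) \<le> 10 * z / real n"
    proof -
      have "real (N div L) \<le> real N / real L" by (rule of_nat_div_le_of_nat)
      also have "\<dots> \<le> 3 * z / real L" using True N0 Lpos by (intro divide_right_mono) auto
      also have "\<dots> \<le> 3 * z / (real n / 3)" using L3 npos z50 Lpos by (intro divide_left_mono) auto
      finally have "real (N div L) \<le> 9 * z / real n" by simp
      moreover have "1 \<le> z / real n" using zn npos by simp
      ultimately have "real (N div L) + 1 \<le> 9 * z / real n + z / real n" by linarith
      also have "\<dots> = 10 * z / real n" by (simp add: add_divide_distrib[symmetric])
      finally show ?thesis unfolding N_def by simp
    qed
    have "m / 2 \<le> real ((card W div L + 1) * card F)" using eW cF by linarith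
    also have "\<dots> = real (card W div L + 1) * real (card F)" by (rule of_nat_mult)
    also have "\<dots> \<le> 10 * z / real n * real (card F)" using q by (intro mult_right_mono) auto
    finally have "z\<^sup>2 * \<Lambda> / real n / 2 \<le> 10 * z / real n * real (card F)" unfolding m .
    then have "z * (z * \<Lambda>) \<le> z * (20 * real (card F))" using npos by (simp add: field_simps power2_eq_square)
    then have "z * \<Lambda> \<le> 20 * real (card F)" using z50 by simp
    then have "\<Lambda> * z / 4000 \<le> real (card F)" by (simp add: mult.commute)
    then show ?thesis using F by blast
  next
    case False
    then have NN0: "real N > real N0" "N0 \<le> N - 1" "N \<ge> 1" by auto
    have Npos: "real N > 0" using NN0 N0pos by linarith
    have Nn: "real N \<ge> real n" using NN0 N0 zn z50 by linarith
    define d where "d = K / (real N)\<^sup>2"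
    have d: "d \<le> real (card (nbrs E W v))" if "v \<in> W" for v
    proof -
      have "real (N - 1) = real N - 1" using NN0 by (simp add: of_nat_diff)
      moreover have "real (N - 1) > 0" using NN0 N0pos by linarith
      moreover have "max N N0 = N" "max (N - 1) N0 = N - 1" using NN0 by auto
      ultimately have "\<phi> N - \<phi> (N - 1) = K / (real N * (real N - 1))" and N1: "real N - 1 > 0"
        unfolding \<phi>_def using Npos by (auto simp: field_simps)
      moreover have "d \<le> K / (real N * (real N - 1))"
        unfolding d_def using Kpos Npos N1 by (intro divide_left_mono) (auto simp: power2_eq_square)
      ultimately show ?thesis using deg[OF that] unfolding N_def[symmetric] by linarith
    qed
    have dpos: "d > 0" unfolding d_def using Kpos Npos by simp
    \<comment> \<open>The roles of the two sides are chosen so that the centres make up at least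
      half of the core.\<close>
    have "\<exists>Q. (\<forall>u v. {u, v} \<in> E \<longrightarrow> (u \<in> Q \<longleftrightarrow> v \<notin> Q)) \<and> N \<le> 2 * card (W - Q)"
    proof (cases "card (W \<inter> P) \<le> card (W - P)")
      case True
      have "N = card (W \<inter> P) + card (W - P)" unfolding N_def using finW card_Int_Diff by blast
      then show ?thesis using True bip by (intro exI[of _ P]) auto
    next
      case False
      have "N = card (W \<inter> P) + card (W - P)" unfolding N_def using finW card_Int_Diff by blast
      moreover have "W - (- P) = W \<inter> P" by auto
      ultimately show ?thesis using False bip by (intro exI[of _ "- P"]) auto
    qed
    then obtain Q where Q: "\<And>u v. {u, v} \<in> E \<Longrightarrow> u \<in> Q \<longleftrightarrow> v \<notin> Q" and Y: "N \<le> 2 * card (W - Q)" by blast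
    have nbQ: "nbrs E (W \<inter> Q) y = nbrs E W y" if "y \<in> W - Q" for y
      using Q[of _ y] that unfolding nbrs_def by blast
    have dQ: "d \<le> real (card (nbrs E (W \<inter> Q) y))" if "y \<in> W - Q" for y
      using d[of y] nbQ[OF that] that by simp
    have Y': "real N \<le> 2 * real (card (W - Q))" using Y by linarith
    define x where "x = real N0 / real N"
    have x: "0 < x" "x < 1" unfolding x_def using NN0 N0pos Npos by auto
    have N0x: "real N0 = x * real N" unfolding x_def using Npos by simp
    \<comment> \<open>\<open>b * N\<close> is a fixed multiple of \<open>\<Lambda> * N0\<close>
      whatever \<open>x\<close> is, so \<open>b\<close> edges at a positive proportion of the
      \<open>N\<close> vertices give the required order \<open>\<Lambda> * z\<close>. The constant
      500 comes from the comparison of \<open>B * g\<close> with \<open>d\<close>.\<close>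
    define b where "b = \<Lambda> * x / 500"
    have bN: "b * real N = \<Lambda> * real N0 / 500" unfolding b_def N0x by simp
    have \<Lambda>z: "\<Lambda> * z \<le> \<Lambda> * real N0 / 2" using N0 \<Lambda> by simp
    show ?thesis
    proof (cases "b \<le> 1")
      case True
      have "nbrs E (W \<inter> Q) y \<noteq> {}" if "y \<in> W - Q" for y using dQ[OF that] dpos by auto
      then obtain F where F: "F \<subseteq> E" "\<not> has_cycle F n" "card (W - Q) \<le> card F"
        using exists_cycle_free_stars[OF E finW n(1), of Q] n by auto
      have "\<Lambda> * real N0 / 500 \<le> real N" using True bN Npos mult_right_mono[of b 1 "real N"] by linarith
      then have "\<Lambda> * z / 4000 \<le> real (card F)" using \<Lambda>z Y' F(3) by linarith
      then show ?thesis using F by blast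
    next
      case False
      then have b1: "b > 1" by simp
      define B where "B = nat \<lceil>b\<rceil>"
      have B: "b \<le> real B" "real B \<le> 2 * b" unfolding B_def using b1 by linarith+
      \<comment> \<open>With this many labels a class has at most \<open>L / 4\<close> elements on
        average.\<close>
      define t where "t = nat \<lceil>4 * real N / real L\<rceil>"
      have t_ge: "4 * real N / real L \<le> real t" unfolding t_def by linarith
      have "4 * real N \<le> real t * real L" using t_ge Lpos by (simp add: divide_le_eq)
      then have tL: "4 * card W \<le> t * L" unfolding N_def by (metis of_nat_le_iff of_nat_mult of_nat_numeral)
      have t_ge': "8 * real N / real n \<le> real t"
      proof -
        have "8 * real N / real n \<le> 8 * real N / (2 * real L)" using L2 Lpos npos Npos by (intro divide_left_mono) auto
        then show ?thesis using t_ge by simp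
      qed
      have t_le: "real t \<le> 13 * real N / real n"
      proof -
        have "real t \<le> 4 * real N / real L + 1" 
        proof -
          have "4 * real N / real L \<ge> 0" by simp
          then show ?thesis unfolding t_def by linarith
        qed
        also have "4 * real N / real L \<le> 4 * real N / (real n / 3)" using L3 npos Npos Lpos by (intro divide_left_mono) auto
        also have "1 \<le> real N / real n" using Nn npos by simp
        finally show ?thesis by (simp add: field_simps)
      qed
      have tpos: "real t > 0" using t_ge' Npos npos by (meson divide_pos_pos less_le_trans mult_pos_pos zero_less_numeral)
      have \<kappa>_le: "16 * \<kappa> \<le> 8 * real N0 / real n"
        using z(2) N0 npos by (simp add: le_divide_eq mult.commute)
      \<comment> \<open>Blocks of about \<open>t * x^2\<close> neighbours fit into the degree
        \<open>d\<close> and meet a given label with probability at least \<open>x^2 / 4\<close>.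
        Since \<open>b > 1\<close> forces \<open>\<Lambda> * x > 500\<close>, the floor is at least
        1.\<close>
      define g where "g = nat \<lfloor>real t * x\<^sup>2\<rfloor>"
      have tx1: "1 \<le> real t * x\<^sup>2"
      proof -
        have "1 \<le> 16 * \<Lambda> * x" using b1 unfolding b_def by linarith
        also have "\<dots> \<le> 16 * \<kappa> * x" using \<kappa> x by (intro mult_right_mono) auto
        also have "\<dots> \<le> 8 * real N0 / real n * x" using \<kappa>_le x by (intro mult_right_mono) auto
        also have "\<dots> = 8 * real N / real n * x\<^sup>2" unfolding N0x by (simp add: power2_eq_square)
        also have "\<dots> \<le> real t * x\<^sup>2" using t_ge' by (intro mult_right_mono) auto
        finally show ?thesis .
      qed
      have "y / 2 \<le> real (nat \<lfloor>y\<rfloor>) \<and> real (nat \<lfloor>y\<rfloor>) \<le> y \<and> 1 \<le> nat \<lfloor>y\<rfloor>" if "1 \<le> y" for y :: real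
      proof (intro conjI)
        have 1: "1 \<le> \<lfloor>y\<rfloor>" using that by (simp add: le_floor_iff)
        then have 2: "real (nat \<lfloor>y\<rfloor>) = of_int \<lfloor>y\<rfloor>" by simp
        show "1 \<le> nat \<lfloor>y\<rfloor>" using 1 by linarith
        show "real (nat \<lfloor>y\<rfloor>) \<le> y" unfolding 2 by (rule of_int_floor_le)
        show "y / 2 \<le> real (nat \<lfloor>y\<rfloor>)"
          unfolding 2 using 1 floor_correct[of y] by linarith
      qed
      from this[OF tx1] have g: "real t * x\<^sup>2 / 2 \<le> real g" "real g \<le> real t * x\<^sup>2" "1 \<le> g"
        unfolding g_def by auto
      have "x\<^sup>2 \<le> 1" using x by (simp add: power_le_one)
      then have "real t * x\<^sup>2 \<le> real t * 1" using tpos by (intro mult_left_mono) auto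
      then have gt: "g \<le> t" using g(2) by linarith
      \<comment> \<open>As \<open>x * N = N0 <= 3 * z\<close>, the comparison comes down to
        \<open>9 * 13 / 250 <= 1 / 2\<close>.\<close>
      have "real (B * g) \<le> d"
      proof -
        have "real (B * g) \<le> 2 * b * (real t * x\<^sup>2)" unfolding of_nat_mult using B g b1 by (intro mult_mono) auto
        also have "\<dots> \<le> 2 * b * (13 * real N / real n * x\<^sup>2)" using t_le b1 by (intro mult_left_mono mult_right_mono) auto
        also have "\<dots> = 13 / 250 * (\<Lambda> * x / (real n * real N)) * (x * real N)\<^sup>2"
          unfolding b_def using Npos npos by (simp add: field_simps power2_eq_square)
        also have "\<dots> = 13 / 250 * (\<Lambda> * x / (real n * real N)) * (real N0)\<^sup>2" by (simp only: N0x)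
        also have "\<dots> \<le> 13 / 250 * (\<Lambda> * x / (real n * real N)) * (3 * z)\<^sup>2"
          using N0 N0pos \<Lambda> x npos Npos by (intro mult_left_mono power_mono) auto
        also have "\<dots> \<le> (\<Lambda> * x / (real n * real N)) * z\<^sup>2 / 2"
        proof -
          have "0 \<le> (\<Lambda> * x / (real n * real N)) * z\<^sup>2" using \<Lambda> x npos Npos by simp
          then show ?thesis by (simp add: power_mult_distrib)
        qed
        also have "\<dots> = d" unfolding d_def K_def m N0x using Npos npos by (simp add: field_simps power2_eq_square)
        finally show ?thesis .
      qed
      then have nb: "B * g \<le> card (nbrs E (W \<inter> Q) y)" if "y \<in> W - Q" for y
        using dQ[OF that] by linarith
      have B8: "8 * B \<le> L"
      proof -
        have "\<Lambda> * x \<le> \<Lambda> * 1" using x \<Lambda> by (intro mult_left_mono) auto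
        then have "8 * real B \<le> real L" using B(2) n(3) L3 \<Lambda> unfolding b_def by linarith
        then show ?thesis by linarith
      qed
      \<comment> \<open>Each block costs at most a factor \<open>exp (- 4 / x)\<close>, and
        \<open>B <= 2 * b\<close> carries a factor \<open>x\<close> that cancels
        \<open>1 / x\<close>. The total is at least
        \<open>exp (- \<Lambda> / 5) = 1 / \<kappa>\<close>, and there are
        \<open>t >= \<kappa>\<close> labels.\<close>
      have "1 \<le> real t * (real g / (2 * real t)) ^ B"
      proof -
        have "2 / x \<le> exp (2 / x)" using exp_ge_add_one_self[of "2 / x"] by linarith
        then have "exp (- (2 / x)) \<le> x / 2" using x by (simp add: exp_minus field_simps)
        then have "(exp (- (2 / x)))\<^sup>2 \<le> (x / 2)\<^sup>2" by (intro power_mono) auto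
        moreover have "(exp (- (2 / x)))\<^sup>2 = exp (- (4 / x))" by (simp add: exp_of_nat_mult[symmetric])
        ultimately have e1: "exp (- (4 / x)) \<le> x\<^sup>2 / 4" by (simp add: power_divide)
        also have "x\<^sup>2 / 4 \<le> real g / (2 * real t)" using g(1) tpos by (simp add: field_simps)
        finally have "exp (- (4 / x)) ^ B \<le> (real g / (2 * real t)) ^ B" by (intro power_mono) auto
        moreover have "exp (- (4 / x)) ^ B = exp (real B * (- (4 / x)))" by (rule exp_of_nat_mult[symmetric])
        moreover have "- (\<Lambda> / 5) \<le> real B * (- (4 / x))"
        proof -
          have "real B * (4 / x) \<le> 2 * b * (4 / x)" using B x by (intro mult_right_mono) auto
          also have "\<dots> = 8 * \<Lambda> / 500" unfolding b_def using x by simp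
          also have "\<dots> \<le> \<Lambda> / 5" using \<Lambda> by simp
          finally show ?thesis by simp
        qed
        ultimately have "exp (- (\<Lambda> / 5)) \<le> (real g / (2 * real t)) ^ B" by (smt (verit) exp_le_cancel_iff)
        moreover have "\<kappa> \<le> real t"
        proof -
          have "8 * real N0 / real n \<le> 8 * real N / real n" using NN0 npos by (intro divide_right_mono) auto
          then show ?thesis using \<kappa>_le t_ge' \<kappa>(1) by linarith
        qed
        ultimately have "\<kappa> * exp (- (\<Lambda> / 5)) \<le> real t * (real g / (2 * real t)) ^ B"
          using \<kappa>(1) by (intro mult_mono) auto
        moreover have "\<kappa> * exp (- (\<Lambda> / 5)) = 1" unfolding \<kappa>(3) by (simp add: exp_minus)
        ultimately show ?thesis by simp
      qed
      then obtain F where F: "F \<subseteq> E" "\<not> has_cycle F n" "B * card (W - Q) \<le> 8 * card F"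
        using exists_cycle_free_random[OF E finW n(1) n2 L nb g(3) gt tL B8] by blast
      have "b * real N \<le> real B * (2 * real (card (W - Q)))" using B Y' b1 by (intro mult_mono) auto
      also have "\<dots> = 2 * real (B * card (W - Q))" by simp
      also have "\<dots> \<le> 2 * real (8 * card F)" using F(3) by (intro mult_left_mono of_nat_mono) auto
      finally have "\<Lambda> * z / 4000 \<le> real (card F)" using bN \<Lambda>z by simp
      then show ?thesis using F by blast
    qed
  qed
qed

text \<open>Passing to a bipartite half costs a factor \<open>sqrt 2 <= 3 / 2\<close>, which turns
  4000 into 6000. The two inequalities between \<open>k\<close> and its logarithm hold for all large
  \<open>k\<close>.\<close>

lemma exists_large_cycle_free_subset:
  assumes E: "simple_edges E" and k: "k \<ge> 2" and n: "even n" "100 * ln (real k) \<le> real n"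
    and large: "real n * sqrt (real k) \<le> real (card E)"
    and \<kappa>: "real k powr (1 / 5) \<ge> ln (real k)" "sqrt (real k) \<ge> 2 * ln (real k) * (real k powr (1 / 5))\<^sup>2"
  shows "\<exists>F\<subseteq>E. \<not> has_cycle F n \<and> sqrt (real (card E) * real n * ln (real k)) / 6000 \<le> real (card F)"
proof -
  define \<Lambda> where "\<Lambda> = ln (real k)"
  define \<kappa> where "\<kappa> = real k powr (1 / 5)"
  have \<Lambda>: "\<Lambda> \<ge> 1 / 2" unfolding \<Lambda>_def using k by (rule ln_ge_half)
  have n50: "real n \<ge> 50" using n(2) \<Lambda> unfolding \<Lambda>_def by linarith
  have \<kappa>_exp: "\<kappa> = exp (\<Lambda> / 5)" unfolding \<kappa>_def \<Lambda>_def powr_def using k by simp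
  have \<kappa>1: "\<kappa> \<ge> 1" unfolding \<kappa>_exp using \<Lambda> by simp
  define V where "V = \<Union>E"
  have finV: "finite V" unfolding V_def using E unfolding simple_edges_def
    by (intro finite_Union) (auto intro: card_ge_0_finite)
  have indV: "induced E V = E" unfolding induced_def V_def by auto
  obtain P where P: "card E \<le> 2 * card {e \<in> E. card (e \<inter> P) = 1}"
    using exists_bipartition[OF E finV] unfolding indV by blast
  define E' where "E' = {e \<in> E. card (e \<inter> P) = 1}"
  have E'E: "E' \<subseteq> E" unfolding E'_def by auto
  have E': "simple_edges E'" using simple_edges_subset[OF E E'E] .
  have bip: "u \<in> P \<longleftrightarrow> v \<notin> P" if "{u, v} \<in> E'" for u v
  proof -
    have "card {u, v} = 2" using that E' unfolding simple_edges_def by blast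
    then have uv: "u \<noteq> v" by auto
    have c1: "card ({u, v} \<inter> P) = 1" using that unfolding E'_def by simp
    show ?thesis
    proof (cases "u \<in> P")
      case True
      have "v \<notin> P"
      proof
        assume "v \<in> P"
        then have "{u, v} \<inter> P = {u, v}" using True by auto
        then show False using c1 uv by simp
      qed
      then show ?thesis using True by simp
    next
      case False
      have "v \<in> P"
      proof (rule ccontr)
        assume "v \<notin> P"
        then have "{u, v} \<inter> P = {}" using False by auto
        then show False using c1 by simp
      qed
      then show ?thesis using False by simp
    qed
  qed
  define m where "m = real (card E')"
  have m: "real (card E) \<le> 2 * m" unfolding m_def E'_def using P by linarith
  define z where "z = sqrt (m * real n / \<Lambda>)"
  have mn: "m * real n / \<Lambda> \<ge> 0" unfolding m_def using \<Lambda> by simp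
  have z2: "z\<^sup>2 * \<Lambda> = m * real n" unfolding z_def using mn \<Lambda> by simp
  \<comment> \<open>After squaring this is \<open>n^2 * \<kappa>^2 * \<Lambda> <= m * n\<close>, and
    \<open>\<kappa>^2 * \<Lambda>\<close> is of order \<open>k^(2/5) * log k\<close>, below the
    \<open>sqrt k\<close> supplied by \<open>large\<close>.\<close>
  have zn: "real n * \<kappa> \<le> z"
    unfolding z_def
  proof (rule real_le_rsqrt)
    have "2 * ((real n * \<kappa>)\<^sup>2 * \<Lambda>) = real n * (real n * (2 * \<Lambda> * \<kappa>\<^sup>2))" by (simp add: power2_eq_square)
    also have "\<dots> \<le> real n * (real n * sqrt (real k))"
      using \<kappa>(2) unfolding \<Lambda>_def \<kappa>_def by (intro mult_left_mono) auto
    also have "\<dots> \<le> real n * (2 * m)" using large m by (intro mult_left_mono) auto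
    also have "\<dots> = 2 * (m * real n)" by simp
    finally have "(real n * \<kappa>)\<^sup>2 * \<Lambda> \<le> m * real n" by linarith
    then show "(real n * \<kappa>)\<^sup>2 \<le> m * real n / \<Lambda>" using \<Lambda> by (simp add: le_divide_eq)
  qed
  obtain F where F: "F \<subseteq> E'" "\<not> has_cycle F n" "\<Lambda> * z / 4000 \<le> real (card F)"
    using exists_cycle_free_bipartite[OF E' bip n(1), of \<Lambda> \<kappa> z] n n50 \<Lambda> \<kappa>1 \<kappa>(1) \<kappa>_exp z2 zn
    unfolding \<Lambda>_def[symmetric] \<kappa>_def[symmetric] m_def by auto
  have zpos: "z \<ge> 0" unfolding z_def by (intro real_sqrt_ge_zero mn)
  have "sqrt (real (card E) * real n * \<Lambda>) / 6000 \<le> \<Lambda> * z / 4000"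
  proof -
    have "real (card E) * real n * \<Lambda> \<le> 2 * m * real n * \<Lambda>" using m \<Lambda> by (intro mult_right_mono) auto
    also have "\<dots> = 2 * (\<Lambda> * z)\<^sup>2" using z2 by (simp add: power_mult_distrib power2_eq_square mult_ac)
    also have "\<dots> \<le> (3 / 2 * (\<Lambda> * z))\<^sup>2"
    proof -
      have "(3 / 2 * w)\<^sup>2 - 2 * w\<^sup>2 = 1 / 4 * w\<^sup>2" for w :: real by (simp add: power2_eq_square)
      from this[of "\<Lambda> * z"] have "(3 / 2 * (\<Lambda> * z))\<^sup>2 - 2 * (\<Lambda> * z)\<^sup>2 \<ge> 0"
        by (simp only: zero_le_mult_iff zero_le_power2) simp
      then show ?thesis by linarith
    qed
    finally have "sqrt (real (card E) * real n * \<Lambda>) \<le> 3 / 2 * (\<Lambda> * z)"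
      using \<Lambda> zpos by (intro real_le_lsqrt) auto
    then show ?thesis by simp
  qed
  then have "sqrt (real (card E) * real n * ln (real k)) / 6000 \<le> real (card F)"
    using F(3) unfolding \<Lambda>_def by linarith
  then show ?thesis using F E'E by blast
qed

section \<open>Lower bound: from one extraction to a colouring\<close>

section \<open>Colouring by repeated extraction\<close>

definition cycle_free_colourable :: "'a set set \<Rightarrow> nat \<Rightarrow> nat \<Rightarrow> bool" where
  "cycle_free_colourable E j n \<longleftrightarrow>
     (\<exists>\<chi>. (\<forall>e\<in>E. \<chi> e < j) \<and> (\<forall>i<j. \<not> has_cycle {e \<in> E. \<chi> e = i} n))"

text \<open>Two equal edges at different positions would make each position the successor of the
  other, possible only for \<open>n = 2\<close>.\<close>

lemma has_cycle_card_le: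
  assumes "has_cycle E n" "finite E" "n \<ge> 3"
  shows "n \<le> card E"
proof -
  obtain c where c: "inj_on c {..<n}" "\<And>i. i < n \<Longrightarrow> {c i, c (Suc i mod n)} \<in> E"
    using assms(1) unfolding has_cycle_def by blast
  have "inj_on (\<lambda>i. {c i, c (Suc i mod n)}) {..<n}"
  proof (rule inj_onI)
    fix i j assume ij: "i \<in> {..<n}" "j \<in> {..<n}" "{c i, c (Suc i mod n)} = {c j, c (Suc j mod n)}"
    have mod: "Suc i mod n < n" "Suc j mod n < n" using assms(3) by auto
    show "i = j"
    proof (rule ccontr)
      assume "i \<noteq> j"
      then have "c i \<noteq> c j" using c(1) ij unfolding inj_on_def by blast
      then have "c i = c (Suc j mod n)" "c (Suc i mod n) = c j" using ij(3) by (auto simp: doubleton_eq_iff)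
      then have "i = Suc j mod n" "Suc i mod n = j" using c(1) ij mod unfolding inj_on_def by auto
      moreover have "Suc a mod n = (if Suc a = n then 0 else Suc a)" if "a \<in> {..<n}" for a
        using that by (simp add: mod_Suc)
      ultimately have i: "i = (if Suc j = n then 0 else Suc j)" and j: "j = (if Suc i = n then 0 else Suc i)"
        using ij(1,2) by metis+
      have "Suc j = n \<and> i = 0 \<or> i = Suc j" using i by (cases "Suc j = n") simp_all
      moreover have "Suc i = n \<and> j = 0 \<or> j = Suc i" using j by (cases "Suc i = n") simp_all
      ultimately show False using assms(3) by linarith
    qed
  qed
  then have "card {..<n} \<le> card E" using c(2) assms(2) by (intro card_inj_on_le) auto
  then show ?thesis by simp
qed

lemma cycle_free_colourable_step:
  assumes "F \<subseteq> E" "\<not> has_cycle F n" "cycle_free_colourable (E - F) j n"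
  shows "cycle_free_colourable E (Suc j) n"
proof -
  obtain \<chi> where \<chi>: "\<forall>e\<in>E - F. \<chi> e < j" "\<forall>i<j. \<not> has_cycle {e \<in> E - F. \<chi> e = i} n"
    using assms(3) unfolding cycle_free_colourable_def by blast
  define \<psi> where "\<psi> e = (if e \<in> F then j else \<chi> e)" for e
  have "{e \<in> E. \<psi> e = i} = {e \<in> E - F. \<chi> e = i}" if "i < j" for i using that unfolding \<psi>_def by auto
  moreover have "{e \<in> E. \<psi> e = j} = F" using assms(1) \<chi>(1) unfolding \<psi>_def by auto
  ultimately have "\<forall>i<Suc j. \<not> has_cycle {e \<in> E. \<psi> e = i} n" using assms(2) \<chi>(2) by (simp add: less_Suc_eq)
  moreover have "\<forall>e\<in>E. \<psi> e < Suc j" using \<chi>(1) unfolding \<psi>_def by (auto intro: less_SucI)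
  ultimately show ?thesis unfolding cycle_free_colourable_def by blast
qed

lemma cycle_free_colourable_few:
  assumes "finite E" "n \<ge> 3" "card E \<le> j * (n - 1)"
  shows "cycle_free_colourable E j n"
proof -
  obtain h where h: "bij_betw h E {0..<card E}" using ex_bij_betw_finite_nat[OF assms(1)] by blast
  let ?\<chi> = "\<lambda>e. h e div (n - 1)"
  have "?\<chi> e < j" if "e \<in> E" for e
  proof -
    have "h e < card E" using h that unfolding bij_betw_def by auto
    then have "h e < j * (n - 1)" using assms(3) by simp
    then show ?thesis by (simp add: less_mult_imp_div_less)
  qed
  moreover have "\<not> has_cycle {e \<in> E. ?\<chi> e = i} n" for i
  proof
    assume "has_cycle {e \<in> E. ?\<chi> e = i} n"
    then have "n \<le> card {e \<in> E. ?\<chi> e = i}" using assms(1,2) by (intro has_cycle_card_le) auto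
    also have "\<dots> \<le> card {i * (n - 1)..<i * (n - 1) + (n - 1)}"
    proof (rule card_inj_on_le[of h])
      show "inj_on h {e \<in> E. ?\<chi> e = i}" using h unfolding bij_betw_def by (auto intro: inj_on_subset)
      show "h ` {e \<in> E. ?\<chi> e = i} \<subseteq> {i * (n - 1)..<i * (n - 1) + (n - 1)}"
      proof
        fix y assume "y \<in> h ` {e \<in> E. ?\<chi> e = i}"
        then have "i * (n - 1) + y mod (n - 1) = y" using div_mult_mod_eq[of y "n - 1"] by auto
        moreover have "y mod (n - 1) < n - 1" using assms(2) by simp
        ultimately show "y \<in> {i * (n - 1)..<i * (n - 1) + (n - 1)}" unfolding atLeastLessThan_iff by linarith
      qed
    qed simp
    also have "\<dots> = n - 1" by simp
    finally show False using assms(2) by simp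
  qed
  ultimately show ?thesis unfolding cycle_free_colourable_def by (intro exI[of _ ?\<chi>]) auto
qed

text \<open>The \<open>j\<close> colours pay for extractions, the other \<open>r\<close> are
  reserved for the remainder once extraction is no longer possible.\<close>

lemma cycle_free_colourable_iterate:
  assumes k: "k \<ge> 2" and n: "even n" "100 * ln (real k) \<le> real n"
    and \<kappa>: "real k powr (1 / 5) \<ge> ln (real k)" "sqrt (real k) \<ge> 2 * ln (real k) * (real k powr (1 / 5))\<^sup>2"
    and r: "real n * sqrt (real k) \<le> real (r * (n - 1))"
    and \<gamma>: "\<gamma> = sqrt (real n * ln (real k)) / 12000"
    and E: "simple_edges E" "sqrt (real (card E)) \<le> real j * \<gamma>"
  shows "cycle_free_colourable E (j + r) n"
proof -
  have n3: "n \<ge> 3" using n(2) ln_ge_half[OF k] by linarith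
  show ?thesis
    using E
  proof (induction j arbitrary: E)
    case 0
    then have "card E \<le> (0 + r) * (n - 1)" by simp
    then show ?case using 0 n3 unfolding simple_edges_def by (intro cycle_free_colourable_few) auto
  next
    case (Suc j)
    have finE: "finite E" using Suc.prems unfolding simple_edges_def by simp
    show ?case
    proof (cases "real (card E) < real n * sqrt (real k)")
      case True
      then have "card E \<le> r * (n - 1)" using r by linarith
      also have "\<dots> \<le> (Suc j + r) * (n - 1)" by (intro mult_right_mono) auto
      finally show ?thesis by (rule cycle_free_colourable_few[OF finE n3])
    next
      case False
      then obtain F where F: "F \<subseteq> E" "\<not> has_cycle F n"
        "sqrt (real (card E) * real n * ln (real k)) / 6000 \<le> real (card F)"
        using exists_large_cycle_free_subset[OF Suc.prems(1) k n _ \<kappa>] by auto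
      define s where "s = sqrt (real (card E))"
      have s: "s \<ge> 0" "s\<^sup>2 = real (card E)" unfolding s_def by auto
      have \<gamma>0: "\<gamma> \<ge> 0" unfolding \<gamma> using ln_ge_half[OF k] by simp
      \<comment> \<open>The denominator 12000 in \<open>\<gamma>\<close> is twice 6000, so that the
        extracted edges complete the square:
        \<open>s^2 - 2 * \<gamma> * s <= (s - \<gamma>)^2\<close>.\<close>
      have "sqrt (real (card E) * real n * ln (real k)) / 6000 = 2 * \<gamma> * s"
        unfolding \<gamma> s_def by (simp add: real_sqrt_mult)
      then have cF: "2 * \<gamma> * s \<le> real (card F)" using F(3) by simp
      have "card (E - F) = card E - card F" using F(1) finE by (intro card_Diff_subset) (auto intro: finite_subset)
      moreover have "card F \<le> card E" using finE F(1) by (rule card_mono)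
      ultimately have "real (card (E - F)) = s\<^sup>2 - real (card F)" using s by (simp add: of_nat_diff)
      then have le: "real (card (E - F)) \<le> s\<^sup>2 - 2 * \<gamma> * s" using cF by linarith
      have "s\<^sup>2 - 2 * \<gamma> * s \<le> (real j * \<gamma>)\<^sup>2"
      proof (cases "s \<ge> \<gamma>")
        case True
        have "s - \<gamma> \<le> real j * \<gamma>" using Suc.prems(2) unfolding s_def[symmetric] by (simp add: algebra_simps)
        then have "(s - \<gamma>)\<^sup>2 \<le> (real j * \<gamma>)\<^sup>2" using True by (intro power_mono) auto
        moreover have "s\<^sup>2 - 2 * \<gamma> * s \<le> (s - \<gamma>)\<^sup>2" by (simp add: power2_diff)
        ultimately show ?thesis by linarith
      next
        \<comment> \<open>Here \<open>(s - \<gamma>)^2\<close> would compare with the wrong sign of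
          \<open>s - \<gamma>\<close>, but the remainder is already empty.\<close>
        case False
        then have "s * s \<le> \<gamma> * s" using s by (intro mult_right_mono) auto
        moreover have "0 \<le> \<gamma> * s" using s \<gamma>0 by simp
        ultimately have "s\<^sup>2 - 2 * \<gamma> * s \<le> 0" unfolding power2_eq_square by linarith
        moreover have "0 \<le> (real j * \<gamma>)\<^sup>2" by simp
        ultimately show ?thesis by linarith
      qed
      then have "sqrt (real (card (E - F))) \<le> real j * \<gamma>"
        using le \<gamma>0 by (intro real_le_lsqrt) auto
      then have "cycle_free_colourable (E - F) (j + r) n"
        using Suc.IH[of "E - F"] simple_edges_subset[OF Suc.prems(1)] by auto
      then show ?thesis using cycle_free_colourable_step[OF F(1,2)] by simp
    qed
  qed
qed

section \<open>Both bounds for the size Ramsey number\<close>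

lemma ramsey_for_cycle_not_colourable:
  assumes G: "finite_simple_graph G" and R: "ramsey_for k G (cycle_graph n)" and n: "n > 0"
  shows "\<not> cycle_free_colourable (uedges G) k n"
proof
  assume "cycle_free_colourable (uedges G) k n"
  then obtain \<chi> where \<chi>: "\<forall>e\<in>uedges G. \<chi> e < k" "\<forall>i<k. \<not> has_cycle {e \<in> uedges G. \<chi> e = i} n"
    unfolding cycle_free_colourable_def by blast
  then obtain i where i: "i < k" "contains_copy (colour_class G \<chi> i) (cycle_graph n)"
    using R unfolding ramsey_for_def edge_colouring_def by blast
  have "\<forall>e\<in>{e \<in> uedges G. \<chi> e = i}. e \<subseteq> uverts G" using G unfolding finite_simple_graph_def by auto
  then have "has_cycle {e \<in> uedges G. \<chi> e = i} n"
    using i(2) contains_copy_cycle_graph_iff[OF _ n] unfolding colour_class_def by blast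
  then show False using \<chi>(2) i(1) by blast
qed

lemma finite_simple_graph_simple_edges: "finite_simple_graph G \<Longrightarrow> simple_edges (uedges G)"
  unfolding finite_simple_graph_def simple_edges_def
  by (metis Pow_iff finite_Pow_iff finite_subset subsetI)

text \<open>Extraction works only above a threshold \<open>k1\<close> that is not computed. Smaller
  \<open>k\<close> are covered by shrinking \<open>c\<close>, using just that a Ramsey graph has at
  least \<open>n\<close> edges.\<close>

lemma ramsey_for_cycle_many_edges:
  obtains c :: real where "c > 0"
    "\<And>k n (G :: nat ugraph). k \<ge> 2 \<Longrightarrow> even n \<Longrightarrow> 100 * ln (real k) \<le> real n \<Longrightarrow> finite_simple_graph G \<Longrightarrow>
      ramsey_for k G (cycle_graph n) \<Longrightarrow> c * (real k)\<^sup>2 * ln (real k) * real n \<le> real (card (uedges G))"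
proof -
  have "eventually (\<lambda>k::real. k powr (1 / 5) \<ge> ln k) at_top" by real_asymp
  moreover have "eventually (\<lambda>k::real. sqrt k \<ge> 2 * ln k * (k powr (1 / 5))\<^sup>2) at_top" by real_asymp
  moreover have "eventually (\<lambda>k::real. k \<ge> 16) at_top" by (rule eventually_ge_at_top)
  ultimately have "eventually (\<lambda>k::real. k powr (1 / 5) \<ge> ln k \<and> sqrt k \<ge> 2 * ln k * (k powr (1 / 5))\<^sup>2 \<and> k \<ge> 16) at_top"
    by eventually_elim auto
  then obtain k0 :: real where k0: "\<And>k. k \<ge> k0 \<Longrightarrow> k powr (1 / 5) \<ge> ln k \<and> sqrt k \<ge> 2 * ln k * (k powr (1 / 5))\<^sup>2 \<and> k \<ge> 16"
    unfolding eventually_at_top_linorder by blast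
  define k1 where "k1 = max k0 2"
  have k1: "k1 \<ge> 2" "k1 \<ge> k0" unfolding k1_def by auto
  \<comment> \<open>\<open>36000 = 3 * 12000\<close>, because \<open>k div 2 >= k / 3\<close>; the
    second term gives \<open>c * k^2 * ln k <= 1\<close> for \<open>k < k1\<close>.\<close>
  define c where "c = min (1 / (36000\<^sup>2)) (1 / (k1 ^ 3))"
  have c: "c > 0" "c \<le> 1 / 36000\<^sup>2" "c \<le> 1 / k1 ^ 3" unfolding c_def using k1 by auto
  have "c * (real k)\<^sup>2 * ln (real k) * real n \<le> real (card (uedges G))"
    if k: "k \<ge> 2" and n: "even n" "100 * ln (real k) \<le> real n" and G: "finite_simple_graph G"
      and R: "ramsey_for k G (cycle_graph n)" for k n and G :: "nat ugraph"
  proof -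
    have lnk: "ln (real k) \<ge> 1 / 2" using k by (rule ln_ge_half)
    have n50: "real n \<ge> 50" using n(2) lnk by linarith
    have n3: "n \<ge> 3" using n50 by linarith
    have sE: "simple_edges (uedges G)" using finite_simple_graph_simple_edges[OF G] .
    have notcol: "\<not> cycle_free_colourable (uedges G) k n"
      using ramsey_for_cycle_not_colourable[OF G R] n3 by simp
    show ?thesis
    proof (cases "real k \<ge> k1")
      case True
      then have kk: "real k powr (1 / 5) \<ge> ln (real k)" "sqrt (real k) \<ge> 2 * ln (real k) * (real k powr (1 / 5))\<^sup>2"
        "real k \<ge> 16" using k0[of "real k"] k1 by auto
      \<comment> \<open>Half of the colours are reserved; \<open>k >= 16\<close> makes
        \<open>r >= 2 * sqrt k\<close>, which together with \<open>n - 1 >= n / 2\<close> colours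
        \<open>n * sqrt k\<close> edges.\<close>
      define r where "r = k - k div 2"
      have r2: "real k \<le> 2 * real r" unfolding r_def by linarith
      have s4: "sqrt (real k) \<ge> 4" using kk(3) by (intro real_le_rsqrt) auto
      have r: "real n * sqrt (real k) \<le> real (r * (n - 1))"
      proof -
        have "4 * sqrt (real k) \<le> sqrt (real k) * sqrt (real k)" using s4 by (intro mult_right_mono) auto
        then have "2 * sqrt (real k) \<le> real r" using r2 by simp
        then have "2 * sqrt (real k) * (real n / 2) \<le> real r * real (n - 1)"
          using n50 by (intro mult_mono) (auto simp: of_nat_diff)
        then show ?thesis by (simp add: mult.commute)
      qed
      show ?thesis
      proof (rule ccontr)
        assume "\<not> ?thesis"
        then have lt: "real (card (uedges G)) \<le> c * (real k)\<^sup>2 * ln (real k) * real n" by simp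
        define \<gamma> where "\<gamma> = sqrt (real n * ln (real k)) / 12000"
        have "sqrt (real (card (uedges G))) \<le> real (k div 2) * \<gamma>"
        proof -
          have "c * (real k)\<^sup>2 * ln (real k) * real n \<le> 1 / 36000\<^sup>2 * (real k)\<^sup>2 * ln (real k) * real n"
            using c lnk by (intro mult_right_mono) auto
          also have "\<dots> = (real k * sqrt (real n * ln (real k)) / 36000)\<^sup>2"
            using lnk by (simp add: power_mult_distrib power_divide)
          finally have "sqrt (real (card (uedges G))) \<le> real k * sqrt (real n * ln (real k)) / 36000"
            using lt lnk by (intro real_le_lsqrt) auto
          also have "\<dots> = real k / 3 * \<gamma>" unfolding \<gamma>_def by simp
          also have "\<dots> \<le> real (k div 2) * \<gamma>"
          proof (rule mult_right_mono)
            have "k \<ge> 16" using kk(3) by linarith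
            then have "k \<le> 3 * (k div 2)" by linarith
            then show "real k / 3 \<le> real (k div 2)" by linarith
            show "0 \<le> \<gamma>" unfolding \<gamma>_def using lnk by simp
          qed
          finally show ?thesis .
        qed
        then have "cycle_free_colourable (uedges G) (k div 2 + r) n"
          by (intro cycle_free_colourable_iterate[OF k n kk(1,2) r \<gamma>_def sE])
        moreover have "k div 2 + r = k" unfolding r_def by simp
        ultimately show False using notcol by simp
      qed
    next
      case False
      have "n \<le> card (uedges G)"
      proof (rule ccontr)
        assume "\<not> ?thesis"
        then have "card (uedges G) \<le> n - 1" by simp
        also have "\<dots> \<le> k * (n - 1)" using k by simp
        finally have "cycle_free_colourable (uedges G) k n"
          using sE n3 unfolding simple_edges_def by (intro cycle_free_colourable_few) auto
        then show False using notcol by simp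
      qed
      moreover have "c * (real k)\<^sup>2 * ln (real k) \<le> 1"
      proof -
        have "real k > 0" using k by simp
        then have "ln (real k) \<le> real k" using ln_less_self[of "real k"] by linarith
        then have "c * (real k)\<^sup>2 * ln (real k) \<le> c * (real k)\<^sup>2 * real k"
          using c by (intro mult_left_mono) auto
        also have "\<dots> = c * real k ^ 3" by (simp add: power2_eq_square power3_eq_cube)
        also have "\<dots> \<le> c * k1 ^ 3" using False c by (intro mult_left_mono power_mono) auto
        also have "\<dots> \<le> 1" using c(3) k1 by (simp add: le_divide_eq)
        finally show ?thesis .
      qed
      then have "c * (real k)\<^sup>2 * ln (real k) * real n \<le> 1 * real n" by (intro mult_right_mono) auto
      ultimately show ?thesis by linarith
    qed
  qed
  then show ?thesis using that c(1) by blast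
qed

theorem theorem1p1:
  "\<exists>c C :: real. c > 0 \<and> C > 0 \<and>
     (\<forall>k n :: nat. k \<ge> 2 \<longrightarrow> even n \<longrightarrow> real n \<ge> 100 * ln (real k) \<longrightarrow>
        c * (real k)\<^sup>2 * ln (real k) * real n \<le> real (size_ramsey k (cycle_graph n)) \<and>
        real (size_ramsey k (cycle_graph n)) \<le> C * (real k)\<^sup>2 * ln (real k) * real n)"
proof -
  obtain c :: real where c: "c > 0"
    "\<And>k n (G :: nat ugraph). k \<ge> 2 \<Longrightarrow> even n \<Longrightarrow> 100 * ln (real k) \<le> real n \<Longrightarrow> finite_simple_graph G \<Longrightarrow>
      ramsey_for k G (cycle_graph n) \<Longrightarrow> c * (real k)\<^sup>2 * ln (real k) * real n \<le> real (card (uedges G))"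
    using ramsey_for_cycle_many_edges by blast
  have "c * (real k)\<^sup>2 * ln (real k) * real n \<le> real (size_ramsey k (cycle_graph n)) \<and>
      real (size_ramsey k (cycle_graph n)) \<le> (3200 * 2 ^ 15) * (real k)\<^sup>2 * ln (real k) * real n"
    if k: "k \<ge> 2" and n: "even n" "100 * ln (real k) \<le> real n" for k n
  proof -
    define Q where "Q m \<longleftrightarrow> (\<exists>G :: nat ugraph. finite_simple_graph G \<and> ramsey_for k G (cycle_graph n) \<and>
      card (uedges G) = m)" for m
    have sr: "size_ramsey k (cycle_graph n) = (LEAST m. Q m)" unfolding size_ramsey_def Q_def ..
    obtain G :: "nat ugraph" where G: "finite_simple_graph G" "ramsey_for k G (cycle_graph n)"
      "real (card (uedges G)) \<le> 3200 * 2 ^ 15 * (real k)\<^sup>2 * ln (real k) * real n"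
      using exists_small_ramsey_graph[OF k n] by blast
    then have QG: "Q (card (uedges G))" unfolding Q_def by blast
    \<comment> \<open>The graph of the upper bound shows that the minimum is attained, so the lower
      bound can be applied to a minimiser.\<close>
    then have "Q (size_ramsey k (cycle_graph n))" unfolding sr by (rule LeastI)
    then obtain G' :: "nat ugraph" where G': "finite_simple_graph G'" "ramsey_for k G' (cycle_graph n)"
      "card (uedges G') = size_ramsey k (cycle_graph n)" unfolding Q_def by blast
    have "size_ramsey k (cycle_graph n) \<le> card (uedges G)" unfolding sr using QG by (rule Least_le)
    then have "real (size_ramsey k (cycle_graph n)) \<le> 3200 * 2 ^ 15 * (real k)\<^sup>2 * ln (real k) * real n"
      using G(3) by linarith
    then show ?thesis using c(2)[OF k n G'(1,2)] G'(3) by simp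
  qed
  moreover have "(3200 * 2 ^ 15 :: real) > 0" by simp
  ultimately show ?thesis using c(1) by blast
qed

end
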